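(* Fix $k\ge2$ and let $T$ be the full shift in $k$ symbols. There exists an open and dense subset $\mathcal{U}$ of $\mathrm{SL}(2,\mathbb{R})^k$ such that for every $\mathsf{A}\in\mathcal{U}$: (1) either the one-step cocycle over $T$ generated by $\mathsf{A}$ is uniformly hyperbolic; (2) or there exists a compact $T$-invariant set $K\subset\{1,\dots,k\}^{\mathbb{Z}}$ of positive topological entropy and such that the norms $\|A^{(n)}(\omega)\|$ are uniformly bounded over $(\omega,n)\in K\times\mathbb{Z}$.
   Context: $T$ is the shift $(T\omega)_n=\omega_{n+1}$ on $k^{\mathbb{Z}}=\{1,\dots,k\}^{\mathbb{Z}}$ (product topology). The one-step cocycle generated by $\mathsf{A}=(A_1,\dots,A_k)$ is $(T,A)$ with $A(\omega)=A_{\omega_0}$; $A^{(n)}(\omega)=A_{\omega_{n-1}}\cdots A_{\omega_0}$ for $n\ge0$, and $A^{(-n)}(\omega)=[A^{(n)}(T^{-n}\omega)]^{-1}$. $\|\cdot\|$ is the Euclidean operator norm. The cocycle $(T,A)$ is uniformly hyperbolic if it has an equivariant splitting $\mathbb{R}^2=e_1(\omega)\oplus e_2(\omega)$ into one-dimensional subspaces ($A(\omega)e_i(\omega)=e_i(T\omega)$), one being uniformly expanding and the other uniformly contracting: there are $c>0$, $\delta>0$ with $\|A^{(n)}(\omega)v\|\ge c e^{\delta n}\|v\|$ for $v\in e_1(\omega)$ and $\|A^{(n)}(\omega)v\|\le c^{-1}e^{-\delta n}\|v\|$ for $v\in e_2(\omega)$, for all $\omega$ and $n\ge0$. *)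

theory Defs
  imports "HOL-Analysis.Analysis"
begin

definition shift_space :: "nat \<Rightarrow> (int \<Rightarrow> nat) topology" where
  "shift_space k = product_topology (\<lambda>_. discrete_topology {1..k}) UNIV"

definition shift :: "(int \<Rightarrow> 'a) \<Rightarrow> int \<Rightarrow> 'a" where
  "shift \<omega> = (\<lambda>n. \<omega> (n + 1))"

definition SL2 :: "(real^2^2) set" where
  "SL2 = {M. det M = 1}"

text \<open>A tuple $(A_1, \ldots, A_k)$ is an extensional function on \<open>{1..k}\<close>, i.e. it is
  undefined outside \<open>{1..k}\<close>.\<close>

definition SL2_tuples :: "nat \<Rightarrow> (nat \<Rightarrow> real^2^2) topology" where
  "SL2_tuples k = product_topology (\<lambda>_. top_of_set SL2) {1..k}"

primrec cocycle_nat :: "(nat \<Rightarrow> real^2^2) \<Rightarrow> nat \<Rightarrow> (int \<Rightarrow> nat) \<Rightarrow> real^2^2" where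
  "cocycle_nat A 0 \<omega> = mat 1"
| "cocycle_nat A (Suc n) \<omega> = A (\<omega> (int n)) ** cocycle_nat A n \<omega>"

definition cocycle :: "(nat \<Rightarrow> real^2^2) \<Rightarrow> int \<Rightarrow> (int \<Rightarrow> nat) \<Rightarrow> real^2^2" where
  "cocycle A n \<omega> =
     (if 0 \<le> n then cocycle_nat A (nat n) \<omega>
      else matrix_inv (cocycle_nat A (nat (- n)) ((inv shift ^^ nat (- n)) \<omega>)))"

text \<open>The \<open>norm\<close> of the type \<open>real^2^2\<close> is the Frobenius norm, so the Euclidean operator norm
  has to be taken explicitly.\<close>

definition op_norm :: "real^2^2 \<Rightarrow> real" where
  "op_norm M = onorm (\<lambda>v. M *v v)"

definition uniformly_hyperbolic :: "nat \<Rightarrow> (nat \<Rightarrow> real^2^2) \<Rightarrow> bool" where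
  "uniformly_hyperbolic k A \<longleftrightarrow>
     (\<exists>e1 e2 :: (int \<Rightarrow> nat) \<Rightarrow> (real^2) set. \<exists>c > 0. \<exists>\<delta> > 0.
        \<forall>\<omega> \<in> topspace (shift_space k).
          subspace (e1 \<omega>) \<and> dim (e1 \<omega>) = 1 \<and>
          subspace (e2 \<omega>) \<and> dim (e2 \<omega>) = 1 \<and>
          {v + w | v w. v \<in> e1 \<omega> \<and> w \<in> e2 \<omega>} = UNIV \<and> e1 \<omega> \<inter> e2 \<omega> = {0} \<and>
          (\<lambda>v. A (\<omega> 0) *v v) ` e1 \<omega> = e1 (shift \<omega>) \<and>
          (\<lambda>v. A (\<omega> 0) *v v) ` e2 \<omega> = e2 (shift \<omega>) \<and>
          (\<forall>n::nat.
            (\<forall>v \<in> e1 \<omega>. norm (cocycle A (int n) \<omega> *v v) \<ge> c * exp (\<delta> * real n) * norm v) \<and>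
            (\<forall>v \<in> e2 \<omega>. norm (cocycle A (int n) \<omega> *v v) \<le> inverse c * exp (- \<delta> * real n) * norm v)))"

text \<open>Topological entropy of a continuous self-map \<open>f\<close> of a compact space \<open>X\<close>, defined through
  open covers following Adler, Konheim and McAndrew.  \<open>cover_join X f \<U> n\<close> is the join of
  the preimages of \<open>\<U>\<close> under the iterates $f^0, \ldots, f^{n-1}$.\<close>

definition open_cover :: "'a topology \<Rightarrow> 'a set set \<Rightarrow> bool" where
  "open_cover X \<U> \<longleftrightarrow> (\<forall>u \<in> \<U>. openin X u) \<and> \<Union>\<U> = topspace X"

definition cover_number :: "'a topology \<Rightarrow> 'a set set \<Rightarrow> nat" where
  "cover_number X \<U> =
     (LEAST m. \<exists>\<V>. \<V> \<subseteq> \<U> \<and> finite \<V> \<and> card \<V> = m \<and> \<Union>\<V> = topspace X)"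

definition cover_join :: "'a topology \<Rightarrow> ('a \<Rightarrow> 'a) \<Rightarrow> 'a set set \<Rightarrow> nat \<Rightarrow> 'a set set" where
  "cover_join X f \<U> n =
     {{x \<in> topspace X. \<forall>i<n. (f ^^ i) x \<in> u i} | u :: nat \<Rightarrow> 'a set. \<forall>i<n. u i \<in> \<U>}"

text \<open>For compact \<open>X\<close> and continuous \<open>f\<close> the sequence below converges, by subadditivity of
  $\log N$, so that the limit superior is its limit.\<close>

definition cover_entropy :: "'a topology \<Rightarrow> ('a \<Rightarrow> 'a) \<Rightarrow> 'a set set \<Rightarrow> ereal" where
  "cover_entropy X f \<U> =
     limsup (\<lambda>n. ereal (ln (real (cover_number X (cover_join X f \<U> n))) / real n))"

definition topological_entropy :: "'a topology \<Rightarrow> ('a \<Rightarrow> 'a) \<Rightarrow> ereal" where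
  "topological_entropy X f = (SUP \<U> \<in> {\<U>. open_cover X \<U>}. cover_entropy X f \<U>)"

end

theory Submission
  imports Defs "HOL-Computational_Algebra.Fundamental_Theorem_Algebra"
begin

text \<open>
  A product of matrices of the tuple is elliptic if its trace lies in the open interval $(-2,2)$,
  and having an elliptic product is an open condition. The set \<open>\<U>\<close> is the union of all open sets on
  which one of the two alternatives holds, so only its density needs an argument, and it follows
  from two facts about an open set $V$ of tuples. If no tuple in $V$ has an elliptic product, every
  tuple in $V$ is uniformly hyperbolic (\<open>uniformly_hyperbolic_if_no_elliptic_nearby\<close>). If some tuple
  in $V$ has one, the second alternative holds on a nonempty open subset of $V$
  (\<open>bounded_positive_entropy_on_open_set\<close>).

  For the first fact, all matrices of the tuple are multiplied by the rotation $R_\theta$. The trace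
  of a product of $n$ of them is $e^{-in\theta} q(e^{2i\theta})$ with a polynomial $q$ of degree $n$.
  For non-real $\theta$ the product strictly contracts the unit disc or its complement, so its trace is
  not zero: all roots of $q$ lie on the unit circle. If the traces stay out of $(-2,2)$ for
  $|\theta| \le t$, the roots avoid an arc around $1$, and comparing the values of $q$ at
  $e^{\pm 2it}$ and at $1$ root by root shows that the trace at $\theta = 0$ has absolute value at
  least $2 (\cos t)^{-n}$ (\<open>trace_growth\<close>). This bound is uniform over all words. Uniform exponential growth of
  the norms then yields the splitting: along every one-sided sequence the most contracted
  directions of the partial products converge, and the limit line is contracted uniformly
  (\<open>contracted_line\<close>, \<open>uniform_contraction\<close>). Applying this to the future and, with inverse matrices, to
  the past gives the two invariant line fields (\<open>uniformly_hyperbolic_if_growth\<close>).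

  For the second fact, the same rotation family moves an elliptic product to one whose angle is an
  irrational multiple of $\pi$, because the trace is not constant along the family. After a
  conjugation that product, of a word $w$, is a rotation. Let $B$ be the matrix of a letter $i$ other
  than the first letter of $w$. The size of a product $P$ is measured by $\cosh$ of half the
  distance that it moves the base point of the hyperbolic plane. Rotations do not change it, and if
  it is at most a constant $\rho$, then one of finitely many powers of the rotation turns the image
  of the base point so that the size is at most $\rho$ again after applying $B$ (\<open>control_step\<close>). Hence blocks
  consisting of a power of $w$ followed by $i$ can be concatenated for ever with bounded products, and
  since two disjoint sets of powers are available, each block leaves a free binary choice. Different
  choices give different sequences, so the closed invariant set of all sequences with a suitable
  bound on the products has positive entropy (\<open>elliptic_control\<close>). What was used of the tuple is a
  condition on the traces of three words and on finitely many powers of one rotation, which is stable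
  under perturbation.
\<close>


section \<open>Real matrices as real-linear maps of the complex plane\<close>

text \<open>With \<open>real^2\<close> identified with the complex plane, every real-linear map has a unique form
  $z \mapsto h z + a \bar z$. The coefficients $h$ and $a$ are the holomorphic and the antiholomorphic
  part of the matrix. They form the first row of the matrix \<open>su11 M\<close>, which lies in
  $\mathrm{SU}(1,1)$ if the determinant is 1.\<close>
definition hol :: "real^2^2 \<Rightarrow> complex" where
  "hol M = Complex ((M$1$1 + M$2$2) / 2) ((M$2$1 - M$1$2) / 2)"

definition ahol :: "real^2^2 \<Rightarrow> complex" where
  "ahol M = Complex ((M$1$1 - M$2$2) / 2) ((M$1$2 + M$2$1) / 2)"

definition mat_of :: "complex \<Rightarrow> complex \<Rightarrow> real^2^2" where
  "mat_of h a = vector [vector [Re h + Re a, Im a - Im h], vector [Im h + Im a, Re h - Re a]]"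

definition vec_complex :: "real^2 \<Rightarrow> complex" where
  "vec_complex v = Complex (v$1) (v$2)"

definition complex_vec :: "complex \<Rightarrow> real^2" where
  "complex_vec z = vector [Re z, Im z]"

definition act :: "real^2^2 \<Rightarrow> complex \<Rightarrow> complex" where
  "act M z = hol M * z + ahol M * cnj z"

text \<open>The maximum of $|h z + a \bar z|$ over the unit circle is $|h| + |a|$, so this is the Euclidean
  operator norm.\<close>
definition mnorm :: "real^2^2 \<Rightarrow> real" where
  "mnorm M = cmod (hol M) + cmod (ahol M)"

abbreviation rot :: "real \<Rightarrow> real^2^2" where
  "rot \<theta> \<equiv> mat_of (cis \<theta>) 0"

lemma hol_mat_of [simp]: "hol (mat_of h a) = h" and ahol_mat_of [simp]: "ahol (mat_of h a) = a"
  by (simp_all add: hol_def ahol_def mat_of_def complex_eq_iff)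

lemma matrix_eqI_hol:
  assumes "hol M = hol N" "ahol M = ahol N"
  shows "M = N"
proof -
  have "M = mat_of (hol M) (ahol M)" for M
    by (simp add: mat_of_def hol_def ahol_def vec_eq_iff forall_2 field_simps)
  then show ?thesis using assms by metis
qed

lemma hol_mult: "hol (M ** N) = hol M * hol N + ahol M * cnj (ahol N)"
  by (simp add: hol_def ahol_def matrix_matrix_mult_def sum_2 complex_eq_iff field_simps)

lemma ahol_mult: "ahol (M ** N) = hol M * ahol N + ahol M * cnj (hol N)"
  by (simp add: hol_def ahol_def matrix_matrix_mult_def sum_2 complex_eq_iff field_simps)

lemma hol_one [simp]: "hol (mat 1) = 1" and ahol_one [simp]: "ahol (mat 1) = 0"
  by (simp_all add: hol_def ahol_def mat_def complex_eq_iff)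

lemma trace_hol: "trace M = 2 * Re (hol M)"
  by (simp add: hol_def trace_def sum_2)

lemma det_hol: "det M = (cmod (hol M))\<^sup>2 - (cmod (ahol M))\<^sup>2"
  by (simp add: hol_def ahol_def det_2 cmod_power2) (simp add: power2_eq_square field_simps)

lemma vec_complex_inverse [simp]: "complex_vec (vec_complex v) = v" "vec_complex (complex_vec z) = z"
  by (simp_all add: vec_complex_def complex_vec_def vec_eq_iff forall_2 complex_eq_iff)

lemma vec_complex_mult: "vec_complex (M *v v) = act M (vec_complex v)"
  by (simp add: vec_complex_def act_def hol_def ahol_def matrix_vector_mult_def sum_2 complex_eq_iff
      field_simps)

lemma norm_vec_complex: "cmod (vec_complex v) = norm v"
  by (simp add: vec_complex_def norm_vec_def L2_set_def sum_2 cmod_def)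

lemma linear_complex_vec: "linear complex_vec"
  by (rule linearI) (simp_all add: complex_vec_def vec_eq_iff forall_2)

lemma linear_act: "linear (act M)"
  by (rule linearI) (simp_all add: act_def algebra_simps)

lemma act_mult: "act (M ** N) z = act M (act N z)"
  by (simp add: act_def hol_mult ahol_mult algebra_simps)

lemma act_one [simp]: "act (mat 1) z = z"
  by (simp add: act_def)

lemma mnorm_nonneg: "0 \<le> mnorm M"
  by (simp add: mnorm_def)

lemma cmod_hol_le_mnorm: "cmod (hol M) \<le> mnorm M"
  by (simp add: mnorm_def)

lemma mnorm_one [simp]: "mnorm (mat 1) = 1"
  by (simp add: mnorm_def)

lemma cmod_act_le: "cmod (act M z) \<le> mnorm M * cmod z"
  unfolding act_def mnorm_def
  by (rule order_trans[OF norm_triangle_ineq]) (simp add: norm_mult distrib_right)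

lemma mnorm_mult: "mnorm (M ** N) \<le> mnorm M * mnorm N"
proof -
  have "cmod (hol (M ** N)) \<le> cmod (hol M) * cmod (hol N) + cmod (ahol M) * cmod (ahol N)"
    unfolding hol_mult by (rule order_trans[OF norm_triangle_ineq]) (simp add: norm_mult)
  moreover have "cmod (ahol (M ** N)) \<le> cmod (hol M) * cmod (ahol N) + cmod (ahol M) * cmod (hol N)"
    unfolding ahol_mult by (rule order_trans[OF norm_triangle_ineq]) (simp add: norm_mult)
  ultimately show ?thesis by (simp add: mnorm_def algebra_simps)
qed

lemma op_norm_le_mnorm: "op_norm M \<le> mnorm M"
  unfolding op_norm_def
proof (rule onorm_bound)
  show "norm (M *v v) \<le> mnorm M * norm v" for v
    using cmod_act_le[of M "vec_complex v"] by (simp flip: vec_complex_mult add: norm_vec_complex)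
qed (rule mnorm_nonneg)

lemma SL2_hol: "M \<in> SL2 \<longleftrightarrow> (cmod (hol M))\<^sup>2 - (cmod (ahol M))\<^sup>2 = 1"
  by (simp add: SL2_def det_hol)

lemma SL2_mult: "M \<in> SL2 \<Longrightarrow> N \<in> SL2 \<Longrightarrow> M ** N \<in> SL2"
  by (simp add: SL2_def det_mul)

lemma SL2_one [simp]: "mat 1 \<in> SL2"
  by (simp add: SL2_def)

lemma SL2_rot [simp]: "rot \<theta> \<in> SL2"
  by (simp add: SL2_hol)

lemma SL2_hol_cnj:
  assumes "M \<in> SL2"
  shows "hol M * cnj (hol M) - ahol M * cnj (ahol M) = 1"
proof -
  have "hol M * cnj (hol M) - ahol M * cnj (ahol M)
      = complex_of_real ((cmod (hol M))\<^sup>2 - (cmod (ahol M))\<^sup>2)"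
    unfolding of_real_diff complex_norm_square ..
  then show ?thesis using assms by (simp only: SL2_hol of_real_1)
qed

lemma SL2_matrix_inv:
  assumes "M \<in> SL2"
  shows "matrix_inv M ** M = mat 1" "M ** matrix_inv M = mat 1" "matrix_inv M \<in> SL2"
    "hol (matrix_inv M) = cnj (hol M)" "ahol (matrix_inv M) = - ahol M"
    "mnorm (matrix_inv M) = mnorm M"
proof -
  have "invertible M"
    using assms by (simp add: invertible_det_nz SL2_def)
  then obtain B where "M ** B = mat 1 \<and> B ** M = mat 1"
    unfolding invertible_def by blast
  then have "M ** matrix_inv M = mat 1 \<and> matrix_inv M ** M = mat 1"
    unfolding matrix_inv_def by (rule someI)
  then show *: "matrix_inv M ** M = mat 1" "M ** matrix_inv M = mat 1"
    by simp_all
  define N where "N = mat_of (cnj (hol M)) (- ahol M)"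
  have 1: "cnj (hol M) * hol M - ahol M * cnj (ahol M) = 1"
    using SL2_hol_cnj[OF assms] by (simp add: mult.commute)
  have "N ** M = mat 1"
  proof (rule matrix_eqI_hol)
    show "hol (N ** M) = hol (mat 1)"
      using 1 by (simp add: N_def hol_mult)
    show "ahol (N ** M) = ahol (mat 1)"
      by (simp add: N_def ahol_mult)
  qed
  then have MN: "matrix_inv M = N"
    using *(2) matrix_mul_assoc[of N M "matrix_inv M"] by simp
  show "hol (matrix_inv M) = cnj (hol M)" "ahol (matrix_inv M) = - ahol M"
    by (simp_all add: MN N_def)
  show "matrix_inv M \<in> SL2" "mnorm (matrix_inv M) = mnorm M"
    using assms by (simp_all add: SL2_hol mnorm_def MN N_def)
qed

lemma SL2_one_le_hol:
  assumes "M \<in> SL2"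
  shows "1 \<le> cmod (hol M)"
proof -
  have "1\<^sup>2 \<le> (cmod (hol M))\<^sup>2"
    using assms zero_le_power2[of "cmod (ahol M)"] unfolding SL2_hol one_power2
    by linarith
  then show ?thesis
    by (rule power2_le_imp_le) simp
qed

lemma SL2_one_le_mnorm: "M \<in> SL2 \<Longrightarrow> 1 \<le> mnorm M"
  by (rule order_trans[OF SL2_one_le_hol cmod_hol_le_mnorm])

lemma SL2_ahol_le_hol: 
  assumes "M \<in> SL2"
  shows "cmod (ahol M) \<le> cmod (hol M)"
proof (rule power2_le_imp_le)
  show "(cmod (ahol M))\<^sup>2 \<le> (cmod (hol M))\<^sup>2"
    using assms unfolding SL2_hol by linarith
qed simp

lemma SL2_mnorm_le: "M \<in> SL2 \<Longrightarrow> mnorm M \<le> 2 * cmod (hol M)"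
  using SL2_ahol_le_hol[of M] by (simp add: mnorm_def)

text \<open>The first letter of a word acts first, as in the cocycle. Hence the matrices are multiplied in the
  order opposite to that of the list.\<close>
fun word_mat :: "(nat \<Rightarrow> real^2^2) \<Rightarrow> nat list \<Rightarrow> real^2^2" where
  "word_mat A [] = mat 1"
| "word_mat A (x # w) = word_mat A w ** A x"

lemma word_mat_append: "word_mat A (u @ v) = word_mat A v ** word_mat A u"
  by (induction u) (simp_all add: matrix_mul_assoc)

lemma word_mat_SL2: "(\<And>x. x \<in> set w \<Longrightarrow> A x \<in> SL2) \<Longrightarrow> word_mat A w \<in> SL2"
  by (induction w) (auto intro: SL2_mult)

lemma cocycle_nat_word: "cocycle_nat A n \<omega> = word_mat A (map (\<lambda>i. \<omega> (int i)) [0..<n])"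
  by (induction n) (simp_all add: word_mat_append)

lemma matrix_inv_mult:
  assumes "M \<in> SL2" "N \<in> SL2"
  shows "matrix_inv (M ** N) = matrix_inv N ** matrix_inv M"
  by (rule matrix_eqI_hol)
    (simp_all add: assms SL2_mult SL2_matrix_inv hol_mult ahol_mult algebra_simps)

text \<open>Reading a word backwards with inverse matrices undoes it. This is how statements about the future of
  a sequence are transferred to its past.\<close>
lemma word_mat_inverse:
  assumes "\<And>x. x \<in> set w \<Longrightarrow> A x \<in> SL2"
  shows "word_mat (\<lambda>x. matrix_inv (A x)) (rev w) = matrix_inv (word_mat A w)"
  using assms
proof (induction w)
  case Nil
  have "matrix_inv (mat 1) ** mat 1 = (mat 1 :: real^2^2)" by (rule SL2_matrix_inv) simp
  then show ?case by simp
next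
  case (Cons x w)
  have "word_mat A w \<in> SL2" by (rule word_mat_SL2) (use Cons.prems in auto)
  then show ?case using Cons by (simp add: word_mat_append matrix_inv_mult)
qed

lemma mnorm_word_mat_le:
  assumes "\<And>x. x \<in> set w \<Longrightarrow> A x \<in> SL2" "\<And>x. x \<in> set w \<Longrightarrow> mnorm (A x) \<le> L"
  shows "mnorm (word_mat A w) \<le> L ^ length w"
  using assms
proof (induction w)
  case (Cons x w)
  have "1 \<le> L"
    using SL2_one_le_mnorm[of "A x"] Cons.prems[of x] by simp
  have "mnorm (word_mat A (x # w)) \<le> mnorm (word_mat A w) * mnorm (A x)"
    by (simp add: mnorm_mult)
  also have "\<dots> \<le> L ^ length w * L"
    using Cons \<open>1 \<le> L\<close> by (intro mult_mono) (auto simp: mnorm_nonneg)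
  finally show ?case by (simp add: mult.commute)
qed simp

section \<open>Traces of rotated products and uniform growth\<close>

lemma matrix_mult_22:
  fixes M N :: "'a::semiring_1^2^2"
  shows "(M ** N)$i$j = M$i$1 * N$1$j + M$i$2 * N$2$j"
  by (simp add: matrix_matrix_mult_def sum_2)

lemma mat_one_22: "(mat 1 :: 'a::semiring_1^2^2)$i$j = (if i = j then 1 else 0)"
  by (simp add: mat_def)

text \<open>For $i = 1$, $j = 2$ the condition says that the closed unit disc $|v_1 / v_2| \le 1$ of the
  projective line is mapped into its interior. Exchanging the indices gives the complement of the
  disc.\<close>
definition strict_cone :: "2 \<Rightarrow> 2 \<Rightarrow> complex^2^2 \<Rightarrow> bool" where
  "strict_cone i j C \<longleftrightarrow>
     (\<forall>v. v \<noteq> 0 \<longrightarrow> cmod (v$i) \<le> cmod (v$j) \<longrightarrow> cmod ((C *v v)$i) < cmod ((C *v v)$j))"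

lemma strict_cone_mult:
  assumes "strict_cone i j C" "strict_cone i j D"
  shows "strict_cone i j (C ** D)"
  unfolding strict_cone_def
proof (intro allI impI)
  fix v :: "complex^2"
  assume v: "v \<noteq> 0" "cmod (v$i) \<le> cmod (v$j)"
  then have "cmod ((D *v v)$i) < cmod ((D *v v)$j)"
    using assms(2) by (simp add: strict_cone_def)
  moreover from this have "D *v v \<noteq> 0"
    by (metis less_irrefl norm_zero zero_index)
  ultimately show "cmod ((C ** D *v v)$i) < cmod ((C ** D *v v)$j)"
    using assms(1) by (simp add: strict_cone_def flip: matrix_vector_mul_assoc)
qed

text \<open>If the trace vanished, the square would be scalar by the Cayley-Hamilton theorem. It would then fix
  the boundary point $(1,1)$ of the cone, which is instead mapped to the interior.\<close>
lemma strict_cone_trace_nonzero: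
  assumes "strict_cone i j C"
  shows "trace C \<noteq> 0"
proof
  assume "trace C = 0"
  then have tr: "C$2$2 = - C$1$1"
    by (simp add: trace_def sum_2 add_eq_0_iff)
  define v :: "complex^2" where "v = 1"
  have "strict_cone i j (C ** C)"
    using assms by (simp add: strict_cone_mult)
  moreover have "v \<noteq> 0" by (simp add: v_def)
  moreover have "cmod (v$i) \<le> cmod (v$j)" by (simp add: v_def)
  ultimately have "cmod ((C ** C *v v)$i) < cmod ((C ** C *v v)$j)"
    unfolding strict_cone_def by blast
  moreover have "(C ** C *v v)$l = C$1$1 * C$1$1 + C$1$2 * C$2$1" for l
    using exhaust_2[of l]
    by (auto simp: v_def matrix_matrix_mult_def matrix_vector_mult_def sum_2 tr algebra_simps)
  ultimately show False by simp
qed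

text \<open>The matrix in the complex basis in which all rotations are diagonal. The disc model of the
  hyperbolic plane is the one preserved by these matrices.\<close>
definition su11 :: "real^2^2 \<Rightarrow> complex^2^2" where
  "su11 M = vector [vector [hol M, ahol M], vector [cnj (ahol M), cnj (hol M)]]"

lemma su11_mult: "su11 (M ** N) = su11 M ** su11 N"
  by (simp add: su11_def vec_eq_iff forall_2 matrix_mult_22 hol_mult ahol_mult)

lemma trace_su11: "trace (su11 M) = of_real (trace M)"
  by (simp add: su11_def trace_def[of "vector _"] sum_2 trace_hol complex_eq_iff)

lemma su11_one: "su11 (mat 1) = mat 1"
  by (simp add: su11_def vec_eq_iff forall_2 mat_one_22)

text \<open>For $z = e^{2i\theta}$ this is $e^{i\theta}$ times the image of $R_\theta M$. The factor clears the
  denominator, so that $z$ may be any complex number.\<close>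
definition scaled :: "complex \<Rightarrow> real^2^2 \<Rightarrow> complex^2^2" where
  "scaled z M = vector [vector [z * hol M, z * ahol M], vector [cnj (ahol M), cnj (hol M)]]"

lemma quadratic_form:
  assumes "M \<in> SL2"
  shows "(cmod (hol M * s + ahol M * t))\<^sup>2 - (cmod (cnj (ahol M) * s + cnj (hol M) * t))\<^sup>2
       = (cmod s)\<^sup>2 - (cmod t)\<^sup>2"
proof -
  have "(cmod (hol M * s + ahol M * t))\<^sup>2 - (cmod (cnj (ahol M) * s + cnj (hol M) * t))\<^sup>2
     = ((cmod (hol M))\<^sup>2 - (cmod (ahol M))\<^sup>2) * ((cmod s)\<^sup>2 - (cmod t)\<^sup>2)"
    unfolding cmod_power2 by (simp add: power2_eq_square algebra_simps)
  then show ?thesis using assms by (simp add: SL2_hol)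
qed

lemma su11_nonzero:
  assumes "M \<in> SL2" "hol M * s + ahol M * t = 0" "cnj (ahol M) * s + cnj (hol M) * t = 0"
  shows "s = 0 \<and> t = 0"
proof -
  have d: "hol M * cnj (hol M) - ahol M * cnj (ahol M) = 1"
    by (rule SL2_hol_cnj[OF assms(1)])
  have "(hol M * cnj (hol M) - ahol M * cnj (ahol M)) * s
      = cnj (hol M) * (hol M * s + ahol M * t) - ahol M * (cnj (ahol M) * s + cnj (hol M) * t)"
    by (simp add: algebra_simps)
  then have "s = 0" unfolding d assms(2,3) by simp
  moreover have "(hol M * cnj (hol M) - ahol M * cnj (ahol M)) * t
      = hol M * (cnj (ahol M) * s + cnj (hol M) * t) - cnj (ahol M) * (hol M * s + ahol M * t)"
    by (simp add: algebra_simps)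
  then have "t = 0" unfolding d assms(2,3) by simp
  ultimately show ?thesis by simp
qed

text \<open>A matrix of $\mathrm{SU}(1,1)$ preserves the form $|v_1|^2 - |v_2|^2$ and hence the disc; the factor
  $z$ on the first coordinate shrinks the disc if $|z| < 1$ and shrinks its complement if
  $|z| > 1$.\<close>
lemma strict_cone_scaled:
  assumes M: "M \<in> SL2" and z: "cmod z \<noteq> 1"
  shows "if cmod z < 1 then strict_cone 1 2 (scaled z M) else strict_cone 2 1 (scaled z M)"
proof -
  have *: "cmod z * cmod (hol M * v$1 + ahol M * v$2) < cmod (cnj (ahol M) * v$1 + cnj (hol M) * v$2)"
    if "cmod z < 1" "v \<noteq> 0" "cmod (v$1) \<le> cmod (v$2)" for v :: "complex^2"
  proof -
    let ?p = "hol M * v$1 + ahol M * v$2" and ?q = "cnj (ahol M) * v$1 + cnj (hol M) * v$2"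
    have pq: "cmod ?p \<le> cmod ?q"
    proof (rule power2_le_imp_le)
      show "(cmod ?p)\<^sup>2 \<le> (cmod ?q)\<^sup>2"
        using quadratic_form[OF M, of "v$1" "v$2"] power_mono[OF that(3) norm_ge_zero, of 2] by linarith
    qed simp
    have "?q \<noteq> 0"
      using pq su11_nonzero[OF M, of "v$1" "v$2"] that(2)
      by (auto simp: vec_eq_iff forall_2)
    show ?thesis
    proof -
      have "cmod z * cmod ?p \<le> cmod z * cmod ?q"
        using pq by (intro mult_left_mono) auto
      also have "\<dots> < 1 * cmod ?q"
        using \<open>?q \<noteq> 0\<close> that(1) by (intro mult_strict_right_mono) auto
      finally show ?thesis by simp
    qed
  qed
  have **: "cmod (cnj (ahol M) * v$1 + cnj (hol M) * v$2) < cmod z * cmod (hol M * v$1 + ahol M * v$2)"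
    if "1 < cmod z" "v \<noteq> 0" "cmod (v$2) \<le> cmod (v$1)" for v :: "complex^2"
  proof -
    let ?p = "hol M * v$1 + ahol M * v$2" and ?q = "cnj (ahol M) * v$1 + cnj (hol M) * v$2"
    have qp: "cmod ?q \<le> cmod ?p"
    proof (rule power2_le_imp_le)
      show "(cmod ?q)\<^sup>2 \<le> (cmod ?p)\<^sup>2"
        using quadratic_form[OF M, of "v$1" "v$2"] power_mono[OF that(3) norm_ge_zero, of 2] by linarith
    qed simp
    have "?p \<noteq> 0"
      using qp su11_nonzero[OF M, of "v$1" "v$2"] that(2)
      by (auto simp: vec_eq_iff forall_2)
    show ?thesis
    proof -
      have "1 * cmod ?p < cmod z * cmod ?p"
        using \<open>?p \<noteq> 0\<close> that(1) by (intro mult_strict_right_mono) auto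
      then show ?thesis using qp by simp
    qed
  qed
  have c: "(scaled z M *v v)$1 = z * (hol M * v$1 + ahol M * v$2)"
       "(scaled z M *v v)$2 = cnj (ahol M) * v$1 + cnj (hol M) * v$2" for v
    by (simp_all add: scaled_def matrix_vector_mult_def sum_2 algebra_simps)
  show ?thesis
    using * ** z by (auto simp: strict_cone_def c norm_mult)
qed

fun word_poly :: "(nat \<Rightarrow> real^2^2) \<Rightarrow> nat list \<Rightarrow> complex poly^2^2" where
  "word_poly A [] = mat 1"
| "word_poly A (x # w) = word_poly A w **
     vector [vector [[:0, hol (A x):], [:0, ahol (A x):]],
             vector [[:cnj (ahol (A x)):], [:cnj (hol (A x)):]]]"

definition poly_mat :: "complex poly^2^2 \<Rightarrow> complex \<Rightarrow> complex^2^2" where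
  "poly_mat P z = (\<chi> i j. poly (P$i$j) z)"

lemma poly_mat_mult: "poly_mat (P ** Q) z = poly_mat P z ** poly_mat Q z"
  by (simp add: poly_mat_def vec_eq_iff matrix_mult_22)

lemma poly_mat_one: "poly_mat (mat 1) z = mat 1"
  by (simp add: poly_mat_def vec_eq_iff mat_def)

lemma poly_mat_word_poly_Cons:
  "poly_mat (word_poly A (x # w)) z = poly_mat (word_poly A w) z ** scaled z (A x)"
proof -
  have "poly_mat (vector [vector [[:0, hol M:], [:0, ahol M:]],
             vector [[:cnj (ahol M):], [:cnj (hol M):]]]) z = scaled z M" for M
    by (simp add: poly_mat_def scaled_def vec_eq_iff forall_2)
  then show ?thesis by (simp add: poly_mat_mult)
qed

text \<open>Its value at $e^{2i\theta}$ is, up to the factor $e^{in\theta}$ with $n$ the length of the word, the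
  trace of the product of the rotated matrices.\<close>
definition trace_poly :: "(nat \<Rightarrow> real^2^2) \<Rightarrow> nat list \<Rightarrow> complex poly" where
  "trace_poly A w = trace (word_poly A w)"

lemma poly_trace_poly: "poly (trace_poly A w) z = trace (poly_mat (word_poly A w) z)"
  by (simp add: trace_poly_def poly_mat_def trace_def sum_2)

lemma trace_poly_roots:
  assumes "w \<noteq> []" "\<And>x. x \<in> set w \<Longrightarrow> A x \<in> SL2" "poly (trace_poly A w) z = 0"
  shows "cmod z = 1"
proof (rule ccontr)
  assume z: "cmod z \<noteq> 1"
  have "if cmod z < 1 then strict_cone 1 2 (poly_mat (word_poly A w) z)
        else strict_cone 2 1 (poly_mat (word_poly A w) z)"
    using assms(1,2)
  proof (induction w rule: list_nonempty_induct)
    case (single x)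
    then show ?case
      using strict_cone_scaled[OF _ z, of "A x"] by (simp add: poly_mat_word_poly_Cons poly_mat_one del: word_poly.simps(2))
  next
    case (cons x w)
    then show ?case
      using strict_cone_scaled[OF _ z, of "A x"]
      by (auto simp: poly_mat_word_poly_Cons simp del: word_poly.simps(2) intro: strict_cone_mult
          split: if_splits)
  qed
  then have "trace (poly_mat (word_poly A w) z) \<noteq> 0"
    using strict_cone_trace_nonzero by presburger
  then show False
    using assms(3) by (simp add: poly_trace_poly)
qed

lemma scaled_cis: "scaled (cis (2 * \<theta>)) M $ l $ j = cis \<theta> * su11 (rot \<theta> ** M) $ l $ j"
proof -
  have "hol (rot \<theta> ** M) = cis \<theta> * hol M" "ahol (rot \<theta> ** M) = cis \<theta> * ahol M"
    by (simp_all add: hol_mult ahol_mult)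
  moreover have "cis (2 * \<theta>) = cis \<theta> * cis \<theta>" by (simp add: cis_mult)
  moreover have "cis \<theta> * (cnj (cis \<theta>) * a) = a" for a
    by (simp only: mult.assoc[symmetric] cis_cnj cis_mult) simp
  ultimately show ?thesis
    using exhaust_2[of l] exhaust_2[of j]
    by (elim disjE) (simp_all add: scaled_def su11_def)
qed

lemma poly_trace_poly_cis:
  "poly (trace_poly A w) (cis (2 * \<theta>))
     = cis (real (length w) * \<theta>) * of_real (trace (word_mat (\<lambda>x. rot \<theta> ** A x) w))"
proof -
  have *: "poly_mat (word_poly A w) (cis (2 * \<theta>)) $ i $ j
     = cis (real (length w) * \<theta>) * su11 (word_mat (\<lambda>x. rot \<theta> ** A x) w) $ i $ j" for i j
  proof (induction w arbitrary: i j)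
    case Nil
    then show ?case by (simp add: poly_mat_one su11_one)
  next
    case (Cons x w)
    let ?S = "su11 (word_mat (\<lambda>x. rot \<theta> ** A x) w)" and ?T = "su11 (rot \<theta> ** A x)"
    have "cis (real (length (x # w)) * \<theta>) = cis (real (length w) * \<theta>) * cis \<theta>"
      by (simp add: cis_mult algebra_simps)
    moreover have "poly_mat (word_poly A (x # w)) (cis (2 * \<theta>)) $ i $ j
        = cis (real (length w) * \<theta>) * ?S $ i $ 1 * (cis \<theta> * ?T $ 1 $ j)
        + cis (real (length w) * \<theta>) * ?S $ i $ 2 * (cis \<theta> * ?T $ 2 $ j)"
      by (simp only: poly_mat_word_poly_Cons matrix_mult_22 Cons.IH scaled_cis)
    ultimately show ?case
      by (simp only: word_mat.simps su11_mult matrix_mult_22) (simp only: mult_ac distrib_left)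
  qed
  show ?thesis
    unfolding poly_trace_poly trace_su11[symmetric] by (simp add: trace_def sum_2 * distrib_left)
qed

text \<open>In the first row the variable is collected once per letter; the second row lags by one degree because
  its last factor carries no variable. So the top coefficient of the trace is the product of the
  holomorphic parts, none of which vanishes in $\mathrm{SL}(2,\mathbb{R})$.\<close>
lemma coeff_word_poly:
  "(\<forall>m > length w. \<forall>j. coeff (word_poly A w $ 1 $ j) m = 0)
   \<and> coeff (word_poly A w $ 1 $ 1) (length w) = prod_list (map (\<lambda>x. hol (A x)) w)
   \<and> (\<forall>m \<ge> length w. coeff (word_poly A w $ 2 $ 1) m = 0)
   \<and> (\<forall>m \<ge> max 1 (length w). coeff (word_poly A w $ 2 $ 2) m = 0)"
proof (induction w)
  case Nil
  then show ?case
    by (auto simp: mat_def forall_2)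
next
  case (Cons x w)
  have e: "word_poly A (x # w) $ i $ 1
           = pCons 0 (smult (hol (A x)) (word_poly A w $ i $ 1)) + smult (cnj (ahol (A x))) (word_poly A w $ i $ 2)"
       "word_poly A (x # w) $ i $ 2
           = pCons 0 (smult (ahol (A x)) (word_poly A w $ i $ 1)) + smult (cnj (hol (A x))) (word_poly A w $ i $ 2)" for i
    by (simp_all add: matrix_mult_22)
  show ?case
    using Cons unfolding forall_2
    by (auto simp: e coeff_pCons split: nat.splits simp del: word_poly.simps)
qed

lemma trace_poly_coeff:
  assumes "w \<noteq> []" "\<And>x. x \<in> set w \<Longrightarrow> A x \<in> SL2"
  shows "degree (trace_poly A w) = length w" "trace_poly A w \<noteq> 0"
proof -
  have 1: "coeff (trace_poly A w) m = 0" if "m > length w" for m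
    using coeff_word_poly[of w A] that
    by (simp add: trace_poly_def trace_def sum_2)
  have "hol (A x) \<noteq> 0" if "x \<in> set w" for x
    using SL2_one_le_hol[OF assms(2)[OF that]] by auto
  then have "prod_list (map (\<lambda>x. hol (A x)) w) \<noteq> 0"
    by (auto simp: prod_list_zero_iff)
  then have 2: "coeff (trace_poly A w) (length w) \<noteq> 0"
    using coeff_word_poly[of w A] assms(1)
    by (simp add: trace_poly_def trace_def sum_2 Suc_le_eq)
  show "degree (trace_poly A w) = length w"
    using 1 2 by (intro antisym degree_le le_degree) auto
  show "trace_poly A w \<noteq> 0" using 2 by auto
qed

text \<open>Since $z$ lies on the unit circle, $z^2 + 1 = 2 z\,\mathrm{Re}\,z$, so that the product of
  $e^{is} - z$ and $e^{-is} - z$ is $2 z (\mathrm{Re}\,z - \cos s)$.\<close>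
lemma circle_factor:
  assumes "cmod z = 1"
  shows "cmod (cis s - z) * cmod (cis (- s) - z) = 2 * \<bar>Re z - cos s\<bar>"
proof -
  have zz: "(Re z)\<^sup>2 + (Im z)\<^sup>2 = 1"
    using assms cmod_power2[of z] by simp
  have 1: "z * z = 2 * of_real (Re z) * z - 1"
  proof (rule complex_eqI)
    show "Re (z * z) = Re (2 * of_real (Re z) * z - 1)"
      using zz by (simp add: power2_eq_square)
  qed simp
  have 2: "cis s * cis (- s) = 1" by (simp add: cis_mult)
  have 3: "cis s + cis (- s) = 2 * of_real (cos s)" by (rule complex_eqI) simp_all
  have "(cis s - z) * (cis (- s) - z) = cis s * cis (- s) - (cis s + cis (- s)) * z + z * z"
    by (simp add: algebra_simps)
  also have "\<dots> = of_real (2 * (Re z - cos s)) * z"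
    unfolding 1 2 3 by (simp add: algebra_simps)
  finally have "cmod ((cis s - z) * (cis (- s) - z)) = cmod (of_real (2 * (Re z - cos s)) * z)"
    by simp
  then show ?thesis
    using assms by (simp only: norm_mult norm_of_real abs_mult abs_numeral mult_1_right)
qed

lemma circle_factor_le:
  assumes z: "cmod z = 1" "Re z \<le> cos (2 * t)"
  shows "cmod (cis (2 * t) - z) * cmod (cis (- (2 * t)) - z) \<le> (cos t)\<^sup>2 * (cmod (1 - z))\<^sup>2"
proof -
  have "-1 \<le> Re z" using abs_Re_le_cmod[of z] z(1) by linarith
  moreover have "cos (2 * t) \<le> 1" by simp
  ultimately have "0 \<le> (1 + Re z) * (1 - cos (2 * t))" by simp
  moreover have c: "(cos t)\<^sup>2 = (1 + cos (2 * t)) / 2"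
    by (simp add: cos_double_cos)
  moreover have d: "(cmod (1 - z))\<^sup>2 = 2 - 2 * Re z"
  proof -
    have "(Re z)\<^sup>2 + (Im z)\<^sup>2 = 1" using z(1) cmod_power2[of z] by simp
    then show ?thesis by (simp add: cmod_power2 power2_diff)
  qed
  ultimately have "2 * (cos (2 * t) - Re z) \<le> (cos t)\<^sup>2 * (cmod (1 - z))\<^sup>2"
    unfolding c d by (simp add: field_simps)
  then show ?thesis
    using circle_factor[OF z(1), of "2 * t"] z(2) by simp
qed

text \<open>The inequality \<open>circle_factor_le\<close> holds for every root separately, and the factors are multiplied
  by induction on the degree.\<close>
lemma poly_circle_inequality:
  fixes q :: "complex poly"
  assumes "\<And>z. poly q z = 0 \<Longrightarrow> cmod z = 1 \<and> Re z \<le> cos (2 * t)"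
  shows "cmod (poly q (cis (2 * t))) * cmod (poly q (cis (- (2 * t))))
           \<le> ((cos t)\<^sup>2) ^ degree q * (cmod (poly q 1))\<^sup>2"
  using assms
proof (induction "degree q" arbitrary: q)
  case 0
  then obtain c where "q = [:c:]" by (metis degree_eq_zeroE)
  then show ?case by (simp add: power2_eq_square)
next
  case (Suc n)
  have "\<not> constant (poly q)"
    unfolding constant_degree using Suc.hyps(2) by linarith
  then obtain z where z: "poly q z = 0"
    using fundamental_theorem_of_algebra by blast
  then obtain r where r: "q = [:- z, 1:] * r"
    by (metis dvdE poly_eq_0_iff_dvd)
  have "r \<noteq> 0"
  proof
    assume "r = 0"
    then have "degree q = 0" unfolding r by simp
    then show False using Suc.hyps(2) by simp
  qed
  then have deg: "degree q = Suc (degree r)"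
    unfolding r by (subst degree_mult_eq) auto
  then have IH: "cmod (poly r (cis (2 * t))) * cmod (poly r (cis (- (2 * t))))
           \<le> ((cos t)\<^sup>2) ^ degree r * (cmod (poly r 1))\<^sup>2"
  proof (intro Suc.hyps(1))
    show "n = degree r" using Suc.hyps(2) deg by simp
    show "cmod x = 1 \<and> Re x \<le> cos (2 * t)" if "poly r x = 0" for x
      using that by (intro Suc.prems) (simp add: r)
  qed
  have "cmod (cis (2 * t) - z) * cmod (cis (- (2 * t)) - z) \<le> (cos t)\<^sup>2 * (cmod (1 - z))\<^sup>2"
    using Suc.prems[OF z] by (intro circle_factor_le) auto
  from mult_mono[OF this IH] have "(cmod (cis (2 * t) - z) * cmod (cis (- (2 * t)) - z)) *
      (cmod (poly r (cis (2 * t))) * cmod (poly r (cis (- (2 * t)))))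
      \<le> ((cos t)\<^sup>2 * (cmod (1 - z))\<^sup>2) * (((cos t)\<^sup>2) ^ degree r * (cmod (poly r 1))\<^sup>2)"
    by (simp only: zero_le_mult_iff norm_ge_zero zero_le_power2 simp_thms)
  moreover have "poly q x = (x - z) * poly r x" for x
    by (simp add: r algebra_simps)
  ultimately show ?case
    unfolding deg by (simp add: norm_mult power_mult_distrib mult_ac)
qed


text \<open>The roots of the trace polynomial lie on the unit circle, and none lies on the arc of the points
  $e^{2i\theta}$ with $|\theta| \le t$, where the modulus of the polynomial is at least 2. Hence every
  root has real part at most $\cos 2t$, and \<open>poly_circle_inequality\<close> compares the two values of modulus at
  least 2 at the ends of the arc with the value at its centre, which is the trace of the unrotated
  product.\<close>
proposition trace_growth:
  assumes A: "\<And>x. x \<in> set w \<Longrightarrow> A x \<in> SL2"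
    and t: "0 < t" "t < pi / 2"
    and no_elliptic: "\<And>\<theta>. \<bar>\<theta>\<bar> \<le> t \<Longrightarrow> 2 \<le> \<bar>trace (word_mat (\<lambda>x. rot \<theta> ** A x) w)\<bar>"
  shows "2 * (1 / cos t) ^ length w \<le> \<bar>trace (word_mat A w)\<bar>"
proof (cases "w = []")
  case True
  then show ?thesis by (simp add: trace_hol)
next
  case False
  let ?q = "trace_poly A w"
  let ?tr = "\<lambda>\<theta>. trace (word_mat (\<lambda>x. rot \<theta> ** A x) w)"
  have q_cis: "cmod (poly ?q (cis (2 * \<theta>))) = \<bar>?tr \<theta>\<bar>" for \<theta>
    by (simp add: poly_trace_poly_cis norm_mult)
  have rot0: "rot 0 ** M = M" for M :: "real^2^2"
    by (intro matrix_eqI_hol[of "rot 0 ** M"]) (simp_all add: hol_mult ahol_mult)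
  have "cmod z = 1 \<and> Re z \<le> cos (2 * t)" if "poly ?q z = 0" for z
  proof -
    have z: "cmod z = 1"
      using trace_poly_roots[OF False A that] .
    have zc: "z = cis (2 * (Arg z / 2))"
    proof -
      have "z \<noteq> 0" using z by auto
      then show ?thesis using cis_Arg[of z] z by (simp add: sgn_div_norm)
    qed
    have "2 * t < \<bar>Arg z\<bar>"
    proof (rule ccontr)
      assume "\<not> 2 * t < \<bar>Arg z\<bar>"
      then have "2 \<le> \<bar>?tr (Arg z / 2)\<bar>" by (intro no_elliptic) auto
      moreover have "cmod (poly ?q (cis (2 * (Arg z / 2)))) = 0"
        unfolding zc[symmetric] that by simp
      ultimately show False
        using q_cis[of "Arg z / 2"] by linarith
    qed
    moreover have "\<bar>Arg z\<bar> \<le> pi"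
      using Arg_bounded[of z] by auto
    ultimately have "cos \<bar>Arg z\<bar> \<le> cos (2 * t)"
      using t by (intro cos_monotone_0_pi_le) auto
    moreover have "Re z = cos (Arg z)"
      using arg_cong[OF zc, of Re] by (simp del: cos_Arg)
    ultimately show ?thesis using z by simp
  qed
  then have "\<bar>?tr t\<bar> * \<bar>?tr (- t)\<bar> \<le> ((cos t)\<^sup>2) ^ length w * \<bar>?tr 0\<bar>\<^sup>2"
    using poly_circle_inequality[of ?q t] trace_poly_coeff(1)[OF False A] q_cis[of t] q_cis[of "- t"] q_cis[of 0]
    by simp
  moreover have "2 * 2 \<le> \<bar>?tr t\<bar> * \<bar>?tr (- t)\<bar>"
    using t by (intro mult_mono no_elliptic) auto
  moreover have "((cos t)\<^sup>2) ^ length w * \<bar>?tr 0\<bar>\<^sup>2 = (cos t ^ length w * \<bar>trace (word_mat A w)\<bar>)\<^sup>2"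
  proof -
    have "((cos t)\<^sup>2) ^ length w = (cos t ^ length w)\<^sup>2"
      unfolding power_mult[symmetric] by (simp add: mult.commute)
    then show ?thesis unfolding rot0 power_mult_distrib by simp
  qed
  ultimately have "2\<^sup>2 \<le> (cos t ^ length w * \<bar>trace (word_mat A w)\<bar>)\<^sup>2"
    by simp
  moreover have c: "0 < cos t" using t by (simp add: cos_gt_zero)
  then have "0 \<le> cos t ^ length w * \<bar>trace (word_mat A w)\<bar>" by simp
  ultimately have "2 \<le> cos t ^ length w * \<bar>trace (word_mat A w)\<bar>"
    by (rule power2_le_imp_le)
  then have "2 / cos t ^ length w \<le> \<bar>trace (word_mat A w)\<bar>"
    using c by (simp add: pos_divide_le_eq mult.commute)
  then show ?thesis
    by (simp add: power_one_over)
qed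

section \<open>The contracted line of a sequence of matrices\<close>

text \<open>The determinant of two plane vectors. On unit vectors its absolute value is the sine of the angle
  between the lines that they span, and it is invariant under $\mathrm{SL}(2,\mathbb{R})$.\<close>
definition wedge :: "complex \<Rightarrow> complex \<Rightarrow> real" where
  "wedge z w = Im (cnj z * w)"

lemma abs_wedge_le: "\<bar>wedge z w\<bar> \<le> cmod z * cmod w"
  unfolding wedge_def using abs_Im_le_cmod[of "cnj z * w"] by (simp add: norm_mult)

lemma wedge_act:
  assumes "M \<in> SL2"
  shows "wedge (act M z) (act M w) = wedge z w"
proof -
  have "wedge (act M z) (act M w) = ((cmod (hol M))\<^sup>2 - (cmod (ahol M))\<^sup>2) * wedge z w"
    unfolding cmod_power2 by (simp add: wedge_def act_def power2_eq_square algebra_simps)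
  then show ?thesis using assms by (simp add: SL2_hol)
qed

lemma unit_decompose:
  assumes "cmod s = 1"
  shows "z = Re (cnj s * z) *\<^sub>R s + wedge s z *\<^sub>R (\<i> * s)"
proof -
  have "s * cnj s = 1"
    using assms complex_norm_square[of s] by simp
  then have "z = s * (cnj s * z)"
    by (simp flip: mult.assoc)
  also have "cnj s * z = of_real (Re (cnj s * z)) + \<i> * of_real (wedge s z)"
    unfolding wedge_def by (rule complex_eq)
  finally show ?thesis
    by (simp add: scaleR_conv_of_real algebra_simps)
qed

lemma abs_wedge_triangle:
  assumes "cmod x = 1" "cmod y = 1" "cmod z = 1"
  shows "\<bar>wedge x z\<bar> \<le> \<bar>wedge x y\<bar> + \<bar>wedge y z\<bar>"
proof -
  have "y * cnj y = 1"
    using assms(2) complex_norm_square[of y] by simp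
  moreover have "(cnj x * y) * (cnj y * z) = (y * cnj y) * (cnj x * z)"
    by (simp only: mult_ac)
  ultimately have "wedge x z = Im ((cnj x * y) * (cnj y * z))"
    by (simp only: wedge_def mult_1_left)
  then have "wedge x z = Re (cnj x * y) * wedge y z + wedge x y * Re (cnj y * z)"
    unfolding wedge_def times_complex.sel(2)[of "cnj x * y"] .
  moreover have "\<bar>Re (cnj x * y)\<bar> \<le> 1" "\<bar>Re (cnj y * z)\<bar> \<le> 1"
    using abs_Re_le_cmod[of "cnj x * y"] abs_Re_le_cmod[of "cnj y * z"] assms
    by (simp_all add: norm_mult)
  then have "\<bar>Re (cnj x * y) * wedge y z\<bar> \<le> \<bar>wedge y z\<bar>" "\<bar>wedge x y * Re (cnj y * z)\<bar> \<le> \<bar>wedge x y\<bar>"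
    by (simp_all add: abs_mult mult_left_le_one_le mult_right_le_one_le)
  ultimately show ?thesis by linarith
qed

text \<open>The two terms of $h s + a \bar s$ have opposite directions when $s^2$ has the argument of $-a / h$.
  Then the modulus is $|h| - |a|$, the inverse of $|h| + |a|$.\<close>
lemma most_contracted:
  assumes "M \<in> SL2"
  obtains s where "cmod s = 1" "cmod (act M s) = 1 / mnorm M"
proof -
  define a where "a = (if ahol M = 0 then 1 else sgn (ahol M))"
  \<comment> \<open>a square root of the unit complex number in the direction of $-a/h$\<close>
  define s where "s = csqrt (- (cnj (sgn (hol M)) * a))"
  have h: "1 \<le> cmod (hol M)" by (rule SL2_one_le_hol[OF assms])
  then have h0: "hol M \<noteq> 0" by auto
  have a1: "cmod a = 1" by (simp add: a_def norm_sgn)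
  have s2: "s\<^sup>2 = - (cnj (sgn (hol M)) * a)" unfolding s_def by (rule power2_csqrt)
  then have "cmod (s\<^sup>2) = 1" using a1 h0 by (simp add: norm_mult norm_sgn)
  then have s1: "cmod s = 1" by (simp add: norm_power power2_eq_1_iff)
       (metis norm_ge_zero not_one_le_zero neg_equal_iff_equal le_minus_one_simps(3))
  have sc: "s * cnj s = 1" using s1 complex_norm_square[of s] by simp
  have sg: "hol M * cnj (sgn (hol M)) = of_real (cmod (hol M))"
  proof -
    have "hol M = of_real (cmod (hol M)) * sgn (hol M)"
      using h0 by (simp add: sgn_eq)
    moreover have "sgn (hol M) * cnj (sgn (hol M)) = 1"
      using complex_norm_square[of "sgn (hol M)"] h0 by (simp add: norm_sgn)
    ultimately show ?thesis by (metis mult.assoc mult_1_right)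
  qed
  have "s * act M s = hol M * s\<^sup>2 + ahol M * (s * cnj s)"
    by (simp add: act_def power2_eq_square algebra_simps)
  also have "\<dots> = - (hol M * cnj (sgn (hol M)) * a) + ahol M"
    by (simp add: sc s2)
  also have "ahol M = of_real (cmod (ahol M)) * a"
    by (simp add: a_def sgn_eq)
  finally have "s * act M s = of_real (cmod (ahol M) - cmod (hol M)) * a"
    unfolding sg by (simp add: algebra_simps)
  then have "cmod (s * act M s) = cmod (of_real (cmod (ahol M) - cmod (hol M)) * a)"
    by (rule arg_cong)
  then have "cmod (act M s) = \<bar>cmod (ahol M) - cmod (hol M)\<bar>"
    using s1 a1 by (simp only: norm_mult norm_of_real mult_1_right mult_1_left)
  then have 1: "cmod (act M s) = cmod (hol M) - cmod (ahol M)"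
    using SL2_ahol_le_hol[OF assms] by simp
  have "(cmod (hol M) - cmod (ahol M)) * mnorm M = 1"
    using assms unfolding SL2_hol mnorm_def by (simp add: power2_eq_square algebra_simps)
  moreover have "mnorm M \<noteq> 0" using SL2_one_le_mnorm[OF assms] by auto
  ultimately have "cmod (act M s) = 1 / mnorm M"
    unfolding 1 by (simp add: eq_divide_eq)
  then show thesis using s1 that by blast
qed

text \<open>The vector is decomposed along $s$, which is contracted by the norm, and along the direction
  orthogonal to $s$, which is expanded by at most the norm.\<close>
lemma cmod_act_le_wedge:
  assumes "M \<in> SL2" "cmod s = 1" "cmod (act M s) = 1 / mnorm M"
  shows "cmod (act M z) \<le> \<bar>wedge s z\<bar> * mnorm M + cmod z / mnorm M"
proof -
  have "act M z = Re (cnj s * z) *\<^sub>R act M s + wedge s z *\<^sub>R act M (\<i> * s)"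
    by (subst unit_decompose[OF assms(2), of z])
      (simp add: linear_add[OF linear_act] linear_cmul[OF linear_act])
  then have "cmod (act M z) \<le> \<bar>Re (cnj s * z)\<bar> * (1 / mnorm M) + \<bar>wedge s z\<bar> * cmod (act M (\<i> * s))"
    using norm_triangle_ineq[of "Re (cnj s * z) *\<^sub>R act M s" "wedge s z *\<^sub>R act M (\<i> * s)"]
    by (simp add: assms(3))
  moreover have "\<bar>Re (cnj s * z)\<bar> \<le> cmod z"
    using abs_Re_le_cmod[of "cnj s * z"] assms(2) by (simp add: norm_mult)
  then have "\<bar>Re (cnj s * z)\<bar> * (1 / mnorm M) \<le> cmod z * (1 / mnorm M)"
    by (rule mult_right_mono) (simp add: mnorm_nonneg)
  moreover have "cmod (act M (\<i> * s)) \<le> mnorm M"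
    using cmod_act_le[of M "\<i> * s"] assms(2) by (simp add: norm_mult)
  then have "\<bar>wedge s z\<bar> * cmod (act M (\<i> * s)) \<le> \<bar>wedge s z\<bar> * mnorm M"
    by (rule mult_left_mono) simp
  ultimately show ?thesis by simp
qed

primrec iter :: "(nat \<Rightarrow> real^2^2) \<Rightarrow> nat \<Rightarrow> real^2^2" where
  "iter X 0 = mat 1"
| "iter X (Suc n) = X n ** iter X n"

lemma iter_add: "iter X (n + m) = iter (\<lambda>i. X (i + m)) n ** iter X m"
  by (induction n) (simp_all add: matrix_mul_assoc)

text \<open>The growth is required of all windows of the sequence, so that the property passes to shifted
  sequences with the same constants.\<close>
definition growing :: "real \<Rightarrow> real \<Rightarrow> (nat \<Rightarrow> real^2^2) \<Rightarrow> bool" where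
  "growing L lam X \<longleftrightarrow>
     (\<forall>j. X j \<in> SL2 \<and> mnorm (X j) \<le> L) \<and> (\<forall>j n. lam ^ n \<le> mnorm (iter (\<lambda>i. X (i + j)) n))"

lemma growing_shift:
  assumes "growing L lam X"
  shows "growing L lam (\<lambda>i. X (i + m))"
proof -
  have "(\<lambda>i. X (i + j + m)) = (\<lambda>i. X (i + (j + m)))" for j by (simp add: add.assoc)
  then show ?thesis using assms unfolding growing_def by simp
qed

lemma growingD:
  assumes "growing L lam X"
  shows "X j \<in> SL2" "mnorm (X j) \<le> L" "lam ^ n \<le> mnorm (iter X n)" "1 \<le> L"
    "iter X n \<in> SL2" "mnorm (iter X n) \<le> L ^ n"
proof -
  show *: "X j \<in> SL2" "mnorm (X j) \<le> L" for j using assms by (simp_all add: growing_def)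
  have "lam ^ n \<le> mnorm (iter (\<lambda>i. X (i + 0)) n)" using assms unfolding growing_def by blast
  then show "lam ^ n \<le> mnorm (iter X n)" by simp
  show L: "1 \<le> L" using SL2_one_le_mnorm[OF *(1)[of 0]] *(2)[of 0] by linarith
  show "iter X n \<in> SL2" by (induction n) (simp_all add: * SL2_mult)
  show "mnorm (iter X n) \<le> L ^ n"
  proof (induction n)
    case (Suc n)
    have "mnorm (iter X (Suc n)) \<le> mnorm (X n) * mnorm (iter X n)"
      by (simp add: mnorm_mult)
    also have "\<dots> \<le> L * L ^ n"
      using Suc * L by (intro mult_mono) (auto simp: mnorm_nonneg)
    finally show ?case by simp
  qed simp
qed

text \<open>For a growing sequence this is the stable line. Comparing with the norm of the partial product,
  instead of asking for convergence to 0, makes uniqueness of the line immediate: a vector off the line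
  is expanded at a rate comparable with the norm at all large times, not only at some of them.\<close>
definition contracted :: "(nat \<Rightarrow> real^2^2) \<Rightarrow> complex set" where
  "contracted X = {z. (\<lambda>n. cmod (act (iter X n) z) / mnorm (iter X n)) \<longlonglongrightarrow> 0}"

text \<open>Let $s_n$ be the most contracted direction of the $n$-th partial product and $a_n$ the norm of that
  product. Invariance of the wedge bounds the sine of the angle between $s_n$ and $s_{n+1}$ by
  $L / (a_n a_{n+1})$, so the $s_n$ converge to a limit $u$. In general $u$ need not be close enough to
  $s_n$ to be contracted at time $n$. It is, however, if the norms after time $n$ grow geometrically
  starting from $a_n$: then the tail of the angle bounds is of order $a_n^{-2}$ and $u$ is contracted by
  the order of $a_n^{-1}$.\<close>
lemma contracted_line:
  assumes X: "growing L lam X" and lam: "1 < lam"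
  obtains u where "cmod u = 1" "contracted X = range (\<lambda>c. c *\<^sub>R u)"
    "\<And>n \<mu>. 1 < \<mu> \<Longrightarrow> (\<And>j. n \<le> j \<Longrightarrow> mnorm (iter X n) * \<mu> ^ (j - n) \<le> mnorm (iter X j)) \<Longrightarrow>
        cmod (act (iter X n) u) \<le> (L / (1 - 1 / \<mu>) + 1) / mnorm (iter X n)"
proof -
  define a where "a n = mnorm (iter X n)" for n
  note XD = growingD[OF X]
  have a1: "1 \<le> a n" for n unfolding a_def by (rule SL2_one_le_mnorm[OF XD(5)])
  then have a0: "0 < a n" for n using less_le_trans[OF zero_less_one] by blast
  have "\<exists>s. cmod s = 1 \<and> cmod (act (iter X n) s) = 1 / a n" for n
    unfolding a_def using most_contracted[OF XD(5)[of n]] by metis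
  then obtain s where s: "\<And>n. cmod (s n) = 1" "\<And>n. cmod (act (iter X n) (s n)) = 1 / a n"
    by metis
  have step: "\<bar>wedge (s (Suc n)) (s n)\<bar> \<le> L / (a n * a (Suc n))" for n
  proof -
    have "act (iter X n) (s (Suc n)) = act (matrix_inv (X n)) (act (iter X (Suc n)) (s (Suc n)))"
      by (simp flip: act_mult add: matrix_mul_assoc SL2_matrix_inv[OF XD(1)])
    then have "cmod (act (iter X n) (s (Suc n))) \<le> mnorm (X n) * (1 / a (Suc n))"
      using cmod_act_le[of "matrix_inv (X n)" "act (iter X (Suc n)) (s (Suc n))"]
      by (simp only: SL2_matrix_inv(6)[OF XD(1)] s)
    also have "\<dots> \<le> L * (1 / a (Suc n))"
      using XD(2) a0[of "Suc n"] by (intro mult_right_mono) auto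
    finally have "cmod (act (iter X n) (s (Suc n))) * cmod (act (iter X n) (s n)) \<le> L * (1 / a (Suc n)) * (1 / a n)"
      unfolding s using a0[of n] by (intro mult_right_mono) auto
    moreover have "\<bar>wedge (s (Suc n)) (s n)\<bar> = \<bar>wedge (act (iter X n) (s (Suc n))) (act (iter X n) (s n))\<bar>"
      by (simp add: wedge_act[OF XD(5)])
    ultimately show ?thesis
      using abs_wedge_le[of "act (iter X n) (s (Suc n))" "act (iter X n) (s n)"] by (simp add: mult.commute)
  qed
  have cauchy: "\<bar>wedge (s (n + m)) (s n)\<bar> \<le> L / \<alpha>\<^sup>2 * (1 / (1 - 1 / \<mu>))"
    if \<mu>: "1 < \<mu>" and \<alpha>: "0 < \<alpha>" and growth: "\<And>j. n \<le> j \<Longrightarrow> \<alpha> * \<mu> ^ (j - n) \<le> a j" for n m \<mu> \<alpha>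
  proof -
    have "\<bar>wedge (s (n + m)) (s n)\<bar> \<le> L / \<alpha>\<^sup>2 * (\<Sum>i<m. (1 / \<mu>) ^ i)"
    proof (induction m)
      case 0
      then show ?case by (simp add: wedge_def)
    next
      case (Suc m)
      have "\<alpha> * \<mu> ^ m \<le> a (n + m)" using growth[of "n + m"] by simp
      moreover have "\<alpha> * 1 \<le> \<alpha> * \<mu> ^ Suc m"
        using \<alpha> \<mu> by (intro mult_left_mono one_le_power) auto
      then have "\<alpha> \<le> a (Suc (n + m))" using growth[of "Suc (n + m)"] by (simp add: Suc_diff_le)
      ultimately have "(\<alpha> * \<mu> ^ m) * \<alpha> \<le> a (n + m) * a (Suc (n + m))"
        using \<alpha> a0 \<mu> by (intro mult_mono) (auto intro: less_imp_le)
      then have "L / (a (n + m) * a (Suc (n + m))) \<le> L / ((\<alpha> * \<mu> ^ m) * \<alpha>)"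
        using \<alpha> \<mu> XD(4) by (intro divide_left_mono mult_pos_pos a0) auto
      also have "\<dots> = L / \<alpha>\<^sup>2 * (1 / \<mu>) ^ m"
        by (simp add: power2_eq_square power_one_over mult_ac)
      finally have "\<bar>wedge (s (Suc (n + m))) (s (n + m))\<bar> \<le> L / \<alpha>\<^sup>2 * (1 / \<mu>) ^ m"
        using step[of "n + m"] by linarith
      then show ?case
        using Suc abs_wedge_triangle[OF s(1) s(1) s(1), of "Suc (n + m)" n "n + m"]
        by (simp add: distrib_left)
    qed
    also have "\<dots> \<le> L / \<alpha>\<^sup>2 * (1 / (1 - 1 / \<mu>))"
    proof (rule mult_left_mono)
      have "(\<Sum>i<m. (1 / \<mu>) ^ i) = (1 - (1 / \<mu>) ^ m) / (1 - 1 / \<mu>)"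
        using \<mu> by (subst sum_gp_strict) auto
      also have "\<dots> \<le> 1 / (1 - 1 / \<mu>)"
        using \<mu> by (intro divide_right_mono) auto
      finally show "(\<Sum>i<m. (1 / \<mu>) ^ i) \<le> 1 / (1 - 1 / \<mu>)" .
      show "0 \<le> L / \<alpha>\<^sup>2" using XD(4) by simp
    qed
    finally show ?thesis .
  qed
  have "compact (sphere (0::complex) 1)" by simp
  then have "seq_compact (sphere (0::complex) 1)" by (simp add: compact_eq_seq_compact_metric)
  moreover have "\<forall>n. s n \<in> sphere 0 1" using s(1) by simp
  ultimately obtain u r where u: "u \<in> sphere 0 1" "strict_mono r" "(s \<circ> r) \<longlonglongrightarrow> u"
    using seq_compactE by metis
  have u1: "cmod u = 1" using u(1) by simp
  have lim_wedge: "(\<lambda>m. wedge (s (r m)) z) \<longlonglongrightarrow> wedge u z" for z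
    using u(3) unfolding wedge_def comp_def by (intro tendsto_intros)
  have near: "\<bar>wedge u (s n)\<bar> \<le> L / \<alpha>\<^sup>2 * (1 / (1 - 1 / \<mu>))"
    if "1 < \<mu>" "0 < \<alpha>" "\<And>j. n \<le> j \<Longrightarrow> \<alpha> * \<mu> ^ (j - n) \<le> a j" for n \<mu> \<alpha>
  proof (rule LIMSEQ_le_const2)
    show "(\<lambda>m. \<bar>wedge (s (r m)) (s n)\<bar>) \<longlonglongrightarrow> \<bar>wedge u (s n)\<bar>"
      by (intro tendsto_rabs lim_wedge)
    show "\<exists>N. \<forall>m\<ge>N. \<bar>wedge (s (r m)) (s n)\<bar> \<le> L / \<alpha>\<^sup>2 * (1 / (1 - 1 / \<mu>))"
    proof (intro exI allI impI)
      fix m assume "n \<le> m"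
      then have "n \<le> r m" using seq_suble[OF u(2), of m] by linarith
      then show "\<bar>wedge (s (r m)) (s n)\<bar> \<le> L / \<alpha>\<^sup>2 * (1 / (1 - 1 / \<mu>))"
        using cauchy[OF that, of "r m - n"] by simp
    qed
  qed
  have wedge_swap: "\<bar>wedge x y\<bar> = \<bar>wedge y x\<bar>" for x y
  proof -
    have "wedge x y = - wedge y x" by (simp add: wedge_def)
    then show ?thesis by simp
  qed
  have near0: "(\<lambda>n. wedge u (s n)) \<longlonglongrightarrow> 0"
  proof (rule Lim_null_comparison)
    show "\<forall>\<^sub>F n in sequentially. norm (wedge u (s n)) \<le> L * (1 / (1 - 1 / lam)) * (1 / lam) ^ n"
    proof (intro always_eventually allI)
      fix n
      have "lam ^ n * lam ^ (j - n) \<le> a j" if "n \<le> j" for j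
        using XD(3)[of j] that by (simp add: a_def flip: power_add)
      then have "\<bar>wedge u (s n)\<bar> \<le> L / (lam ^ n)\<^sup>2 * (1 / (1 - 1 / lam))"
        using lam by (intro near) auto
      also have "\<dots> \<le> L / lam ^ n * (1 / (1 - 1 / lam))"
      proof (intro mult_right_mono divide_left_mono)
        show "lam ^ n \<le> (lam ^ n)\<^sup>2"
          using lam by (simp add: power2_eq_square one_le_power)
      qed (use lam XD(4) in auto)
      finally show "norm (wedge u (s n)) \<le> L * (1 / (1 - 1 / lam)) * (1 / lam) ^ n"
        by (simp add: power_one_over mult_ac)
    qed
    have "(\<lambda>n. (1 / lam) ^ n) \<longlonglongrightarrow> 0" using lam by (intro LIMSEQ_realpow_zero) auto
    then show "(\<lambda>n. L * (1 / (1 - 1 / lam)) * (1 / lam) ^ n) \<longlonglongrightarrow> 0"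
      by (rule tendsto_mult_right_zero)
  qed
  have act_u: "cmod (act (iter X n) u) \<le> \<bar>wedge u (s n)\<bar> * a n + 1 / a n" for n
    using cmod_act_le_wedge[OF XD(5) s(1) s(2)[unfolded a_def], of n u] u1
    unfolding a_def by (simp add: wedge_swap)
  have sub: "c *\<^sub>R u \<in> contracted X" for c
  proof -
    have "(\<lambda>n. \<bar>c\<bar> * (\<bar>wedge u (s n)\<bar> + 1 / a n)) \<longlonglongrightarrow> \<bar>c\<bar> * (\<bar>0\<bar> + 0)"
    proof (intro tendsto_mult tendsto_add tendsto_const tendsto_rabs near0)
      have "(\<lambda>n. (1 / lam) ^ n) \<longlonglongrightarrow> 0" using lam by (intro LIMSEQ_realpow_zero) auto
      then show "(\<lambda>n. 1 / a n) \<longlonglongrightarrow> 0"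
      proof (rule Lim_null_comparison[rotated], intro always_eventually allI)
        fix n
        have "1 / a n \<le> 1 / lam ^ n"
          using XD(3)[of n] a0[of n] lam unfolding a_def by (intro divide_left_mono) auto
        then show "norm (1 / a n) \<le> (1 / lam) ^ n"
          using a0[of n] by (simp add: power_one_over)
      qed
    qed
    then have null: "(\<lambda>n. \<bar>c\<bar> * (\<bar>wedge u (s n)\<bar> + 1 / a n)) \<longlonglongrightarrow> 0"
      by simp
    have "(\<lambda>n. cmod (act (iter X n) (c *\<^sub>R u)) / a n) \<longlonglongrightarrow> 0"
    proof (rule Lim_null_comparison[OF _ null], rule always_eventually, rule allI)
      fix n
      have "cmod (act (iter X n) (c *\<^sub>R u)) / a n = \<bar>c\<bar> * (cmod (act (iter X n) u) / a n)"
        by (simp add: linear_cmul[OF linear_act])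
      also have "\<dots> \<le> \<bar>c\<bar> * (\<bar>wedge u (s n)\<bar> + 1 / a n)"
      proof (rule mult_left_mono)
        have "cmod (act (iter X n) u) / a n \<le> (\<bar>wedge u (s n)\<bar> * a n + 1 / a n) / a n"
          using act_u[of n] a0[of n] by (intro divide_right_mono) auto
        also have "\<dots> = \<bar>wedge u (s n)\<bar> + 1 / a n / a n"
          using a0[of n] by (simp add: add_divide_distrib)
        finally show "cmod (act (iter X n) u) / a n \<le> \<bar>wedge u (s n)\<bar> + 1 / a n"
          using divide_left_mono[of 1 "a n" "1 / a n"] a0[of n] a1[of n] by simp
      qed simp
      finally show "norm (cmod (act (iter X n) (c *\<^sub>R u)) / a n) \<le> \<bar>c\<bar> * (\<bar>wedge u (s n)\<bar> + 1 / a n)"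
        using a0[of n] by simp
    qed
    then show ?thesis by (simp add: contracted_def a_def)
  qed
  have sup: "z \<in> range (\<lambda>c. c *\<^sub>R u)" if "z \<in> contracted X" for z
  proof -
    have "(\<lambda>n. cmod (act (iter X n) z) / a n) \<longlonglongrightarrow> 0"
      using that by (simp add: contracted_def a_def)
    then have "(\<lambda>n. wedge (s n) z) \<longlonglongrightarrow> 0"
    proof (rule Lim_null_comparison[rotated], intro always_eventually allI)
      fix n
      have "\<bar>wedge (act (iter X n) (s n)) (act (iter X n) z)\<bar> \<le> 1 / a n * cmod (act (iter X n) z)"
        using abs_wedge_le[of "act (iter X n) (s n)" "act (iter X n) z"] by (simp only: s)
      then show "norm (wedge (s n) z) \<le> cmod (act (iter X n) z) / a n"
        by (simp add: wedge_act[OF XD(5)])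
    qed
    then have "(\<lambda>m. wedge (s (r m)) z) \<longlonglongrightarrow> 0"
      using LIMSEQ_subseq_LIMSEQ[OF _ u(2), of "\<lambda>n. wedge (s n) z"] by (simp add: comp_def)
    then have "wedge u z = 0"
      using LIMSEQ_unique[OF lim_wedge[of z]] by simp
    then have "z = Re (cnj u * z) *\<^sub>R u"
      using unit_decompose[OF u1, of z] by simp
    then show ?thesis by (rule range_eqI)
  qed
  show thesis
  proof (rule that[OF u1])
    show "contracted X = range (\<lambda>c. c *\<^sub>R u)" using sub sup by blast
    fix n and \<mu> :: real
    assume "1 < \<mu>" "\<And>j. n \<le> j \<Longrightarrow> mnorm (iter X n) * \<mu> ^ (j - n) \<le> mnorm (iter X j)"
    then have "\<bar>wedge u (s n)\<bar> \<le> L / (a n)\<^sup>2 * (1 / (1 - 1 / \<mu>))"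
      by (intro near a0) (auto simp: a_def)
    then have "\<bar>wedge u (s n)\<bar> * a n \<le> L / (a n)\<^sup>2 * (1 / (1 - 1 / \<mu>)) * a n"
      using a0[of n] by (intro mult_right_mono) auto
    also have "\<dots> = L / (1 - 1 / \<mu>) / a n"
      using a0[of n] by (simp add: power2_eq_square)
    finally have "cmod (act (iter X n) u) \<le> L / (1 - 1 / \<mu>) / a n + 1 / a n"
      using act_u[of n] by linarith
    then show "cmod (act (iter X n) u) \<le> (L / (1 - 1 / \<mu>) + 1) / mnorm (iter X n)"
      by (simp add: a_def add_divide_distrib)
  qed
qed

section \<open>Uniform growth of norms implies uniform hyperbolicity\<close>

text \<open>The time $g$ is the last one at which the norm divided by $\mu^m$ is at most its value at time $N$.
  After it the norms grow at least like powers of $\mu$. The time exists and is bounded, because the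
  norm grows at least like $\mu^{2m}$ while its value at time $N$ is at most $L^N$.\<close>
lemma good_time:
  assumes X: "growing L lam X" and mu: "1 < \<mu>" "lam = \<mu>\<^sup>2" and kap: "L ^ N < \<mu> ^ \<kappa>"
  obtains g where "N \<le> g" "g \<le> \<kappa>"
    "\<And>j. g \<le> j \<Longrightarrow> mnorm (iter X g) * \<mu> ^ (j - g) \<le> mnorm (iter X j)"
proof -
  define a where "a n = mnorm (iter X n)" for n
  define S where "S = {m. N \<le> m \<and> a m * \<mu> ^ N \<le> a N * \<mu> ^ m}"
  note XD = growingD[OF X]
  have bound: "m \<le> \<kappa>" if "m \<in> S" for m
  proof (rule ccontr)
    assume "\<not> m \<le> \<kappa>"
    then have "\<mu> ^ \<kappa> \<le> \<mu> ^ m" using mu by (intro power_increasing) auto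
    have "\<mu> ^ m * \<mu> ^ m * 1 \<le> a m * \<mu> ^ N"
      using XD(3)[of m] mu one_le_power[of \<mu> N]
      by (intro mult_mono) (auto simp: a_def mnorm_nonneg power2_eq_square power_mult_distrib)
    also have "\<dots> \<le> a N * \<mu> ^ m" using that by (simp add: S_def)
    also have "\<dots> \<le> L ^ N * \<mu> ^ m"
      using XD(6)[of N] mu by (intro mult_right_mono) (auto simp: a_def)
    finally have "\<mu> ^ m * \<mu> ^ m \<le> L ^ N * \<mu> ^ m" by simp
    then have "\<mu> ^ m \<le> L ^ N" using mu by simp
    then show False using kap \<open>\<mu> ^ \<kappa> \<le> \<mu> ^ m\<close> by linarith
  qed
  then have "finite S" using finite_subset[of S "{..\<kappa>}"] by auto
  moreover have "N \<in> S" by (simp add: S_def)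
  ultimately have g: "Max S \<in> S" by (intro Max_in) auto
  have later: "a (Max S) * \<mu> ^ (j - Max S) \<le> a j" if "Max S \<le> j" for j
  proof (cases "j = Max S")
    case False
    then have "Max S < j" using that by simp
    then have "j \<notin> S" using Max_ge[OF \<open>finite S\<close>, of j] by (meson not_less)
    moreover have "N \<le> j" using g that by (simp add: S_def)
    ultimately have "a N * \<mu> ^ j < a j * \<mu> ^ N" by (simp add: S_def)
    moreover have "a (Max S) * \<mu> ^ N * \<mu> ^ (j - Max S) \<le> a N * \<mu> ^ Max S * \<mu> ^ (j - Max S)"
      using g mu by (intro mult_right_mono) (auto simp: S_def)
    moreover have "a N * \<mu> ^ Max S * \<mu> ^ (j - Max S) = a N * \<mu> ^ j"
      using that by (simp add: mult.assoc flip: power_add)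
    moreover have "a (Max S) * \<mu> ^ N * \<mu> ^ (j - Max S) = (a (Max S) * \<mu> ^ (j - Max S)) * \<mu> ^ N"
      by (simp only: mult_ac)
    ultimately have "(a (Max S) * \<mu> ^ (j - Max S)) * \<mu> ^ N \<le> a j * \<mu> ^ N"
      by linarith
    then show ?thesis using mu by simp
  qed simp
  show thesis
  proof (rule that[of "Max S"])
    show "N \<le> Max S" using g by (simp add: S_def)
    show "Max S \<le> \<kappa>" using bound g by blast
  qed (use later in \<open>simp add: a_def\<close>)
qed

text \<open>At a good time after $N$ the contracted vector is shortened by a constant divided by $\lambda^N$, so
  it suffices to take $N$ large.\<close>
lemma halving_time:
  assumes "1 < lam"
  obtains \<kappa> where "0 < \<kappa>"
    "\<And>X z. growing L lam X \<Longrightarrow> z \<in> contracted X \<Longrightarrow>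
       \<exists>g. 0 < g \<and> g \<le> \<kappa> \<and> cmod (act (iter X g) z) \<le> cmod z / 2"
proof -
  define \<mu> where "\<mu> = sqrt lam"
  have mu: "1 < \<mu>" "lam = \<mu>\<^sup>2" using assms by (simp_all add: \<mu>_def)
  define D where "D = L / (1 - 1 / \<mu>) + 1"
  obtain N where N: "2 * D < lam ^ N"
    using real_arch_pow[OF assms] by blast
  obtain \<kappa>' where "L ^ Suc N < \<mu> ^ \<kappa>'"
    using real_arch_pow[OF mu(1)] by blast
  then have kap: "L ^ Suc N < \<mu> ^ Suc \<kappa>'"
    using mu(1) power_strict_increasing[of \<kappa>' "Suc \<kappa>'" \<mu>] by linarith
  show thesis
  proof (rule that[of "Suc \<kappa>'"])
    fix X z
    assume X: "growing L lam X" and z: "z \<in> contracted X"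
    obtain u where u: "cmod u = 1" "contracted X = range (\<lambda>c. c *\<^sub>R u)"
      "\<And>n \<mu>. 1 < \<mu> \<Longrightarrow> (\<And>j. n \<le> j \<Longrightarrow> mnorm (iter X n) * \<mu> ^ (j - n) \<le> mnorm (iter X j)) \<Longrightarrow>
        cmod (act (iter X n) u) \<le> (L / (1 - 1 / \<mu>) + 1) / mnorm (iter X n)"
      using contracted_line[OF X assms] by metis
    obtain c where c: "z = c *\<^sub>R u" using z u(2) by blast
    obtain g where g: "Suc N \<le> g" "g \<le> Suc \<kappa>'"
      "\<And>j. g \<le> j \<Longrightarrow> mnorm (iter X g) * \<mu> ^ (j - g) \<le> mnorm (iter X j)"
      using good_time[OF X mu kap] by metis
    have "cmod (act (iter X g) u) \<le> D / mnorm (iter X g)"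
      unfolding D_def by (rule u(3)[OF mu(1) g(3)])
    also have "\<dots> \<le> 1 / 2"
    proof -
      have "lam ^ N \<le> lam ^ g" using g(1) assms by (intro power_increasing) auto
      then have "2 * D \<le> mnorm (iter X g)"
        using N growingD(3)[OF X, of g] by linarith
      moreover have "0 < mnorm (iter X g)"
        using SL2_one_le_mnorm[OF growingD(5)[OF X, of g]] by linarith
      ultimately show ?thesis by (simp add: field_simps)
    qed
    finally have "\<bar>c\<bar> * cmod (act (iter X g) u) \<le> \<bar>c\<bar> * (1 / 2)"
      by (rule mult_left_mono) simp
    then have "cmod (act (iter X g) z) \<le> cmod z / 2"
      unfolding c by (simp add: linear_cmul[OF linear_act] u(1))
    then show "\<exists>g. 0 < g \<and> g \<le> Suc \<kappa>' \<and> cmod (act (iter X g) z) \<le> cmod z / 2"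
      using g(1,2) by (intro exI[of _ g]) auto
  qed simp
qed

lemma act_in_contracted_iff:
  assumes X: "growing L lam X"
  shows "act (X 0) z \<in> contracted (\<lambda>i. X (i + 1)) \<longleftrightarrow> z \<in> contracted X"
proof -
  let ?Y = "\<lambda>i. X (i + 1)"
  note XD = growingD[OF X]
  have L: "0 < L" using XD(4) by linarith
  have it: "iter X (Suc n) = iter ?Y n ** X 0" for n
    using iter_add[of X n 1] by simp
  have a: "act (iter X (Suc n)) z = act (iter ?Y n) (act (X 0) z)" for n
    by (simp add: it act_mult del: iter.simps)
  have Y: "iter ?Y n \<in> SL2" for n by (rule growingD(5)[OF growing_shift[OF X]])
  have pos: "0 < mnorm (iter X n)" "0 < mnorm (iter ?Y n)" for n
    using SL2_one_le_mnorm[OF XD(5)[of n]] SL2_one_le_mnorm[OF Y[of n]] by linarith+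
  have 1: "mnorm (iter X (Suc n)) \<le> mnorm (iter ?Y n) * L" for n
  proof -
    have "mnorm (iter X (Suc n)) \<le> mnorm (iter ?Y n) * mnorm (X 0)"
      unfolding it by (rule mnorm_mult)
    also have "\<dots> \<le> mnorm (iter ?Y n) * L" by (intro mult_left_mono XD(2) mnorm_nonneg)
    finally show ?thesis .
  qed
  have 2: "mnorm (iter ?Y n) \<le> mnorm (iter X (Suc n)) * L" for n
  proof -
    have "iter ?Y n = iter X (Suc n) ** matrix_inv (X 0)"
      unfolding it by (simp add: SL2_matrix_inv[OF XD(1)] flip: matrix_mul_assoc)
    then have "mnorm (iter ?Y n) \<le> mnorm (iter X (Suc n)) * mnorm (matrix_inv (X 0))"
      by (simp only: mnorm_mult)
    also have "\<dots> \<le> mnorm (iter X (Suc n)) * L"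
      unfolding SL2_matrix_inv(6)[OF XD(1)] by (intro mult_left_mono XD(2) mnorm_nonneg)
    finally show ?thesis .
  qed
  define b where "b n = cmod (act (iter X (Suc n)) z)" for n
  have b: "0 \<le> b n" for n by (simp add: b_def)
  have "(\<lambda>n. b n / mnorm (iter ?Y n)) \<longlonglongrightarrow> 0 \<longleftrightarrow> (\<lambda>n. b n / mnorm (iter X (Suc n))) \<longlonglongrightarrow> 0"
  proof
    assume *: "(\<lambda>n. b n / mnorm (iter ?Y n)) \<longlonglongrightarrow> 0"
    show "(\<lambda>n. b n / mnorm (iter X (Suc n))) \<longlonglongrightarrow> 0"
    proof (rule Lim_null_comparison[OF _ tendsto_mult_right_zero[OF *, of L]], rule always_eventually, rule allI)
      fix n
      have "b n / mnorm (iter X (Suc n)) = L * b n / (mnorm (iter X (Suc n)) * L)"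
        using L by simp
      also have "\<dots> \<le> L * b n / mnorm (iter ?Y n)"
        using 2[of n] pos L b[of n] by (intro divide_left_mono mult_pos_pos) (auto simp del: iter.simps)
      finally show "norm (b n / mnorm (iter X (Suc n))) \<le> L * (b n / mnorm (iter ?Y n))"
        using b[of n] pos(1)[of "Suc n"] by (simp del: iter.simps)
    qed
  next
    assume *: "(\<lambda>n. b n / mnorm (iter X (Suc n))) \<longlonglongrightarrow> 0"
    show "(\<lambda>n. b n / mnorm (iter ?Y n)) \<longlonglongrightarrow> 0"
    proof (rule Lim_null_comparison[OF _ tendsto_mult_right_zero[OF *, of L]], rule always_eventually, rule allI)
      fix n
      have "b n / mnorm (iter ?Y n) = L * b n / (mnorm (iter ?Y n) * L)"
        using L by simp
      also have "\<dots> \<le> L * b n / mnorm (iter X (Suc n))"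
        using 1[of n] pos L b[of n] by (intro divide_left_mono mult_pos_pos) (auto simp del: iter.simps)
      finally show "norm (b n / mnorm (iter ?Y n)) \<le> L * (b n / mnorm (iter X (Suc n)))"
        using b[of n] pos(2)[of n] by (simp del: iter.simps)
    qed
  qed
  moreover have "z \<in> contracted X \<longleftrightarrow> (\<lambda>n. b n / mnorm (iter X (Suc n))) \<longlonglongrightarrow> 0"
    unfolding contracted_def b_def mem_Collect_eq
    using filterlim_sequentially_Suc[of "\<lambda>n. cmod (act (iter X n) z) / mnorm (iter X n)" "nhds 0"]
    by (simp del: iter.simps)
  ultimately show ?thesis
    unfolding contracted_def mem_Collect_eq b_def a by simp
qed

lemma act_iter_contracted:
  assumes "growing L lam X" "z \<in> contracted X"
  shows "act (iter X m) z \<in> contracted (\<lambda>i. X (i + m))"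
proof (induction m)
  case 0
  then show ?case using assms by simp
next
  case (Suc m)
  have "growing L lam (\<lambda>i. X (i + m))" by (rule growing_shift[OF assms(1)])
  from act_in_contracted_iff[OF this, of "act (iter X m) z"] Suc show ?case
    by (simp add: act_mult)
qed

text \<open>By \<open>halving_time\<close> the length is halved within a bounded time, and by invariance of the contracted
  lines this repeats from there on. The constant $K$ accounts for the steps after the last halving.\<close>
lemma uniform_contraction:
  assumes "1 < lam" "1 \<le> L"
  obtains K \<theta> where "1 \<le> K" "0 < \<theta>" "\<theta> < 1"
    "\<And>X z n. growing L lam X \<Longrightarrow> z \<in> contracted X \<Longrightarrow> cmod (act (iter X n) z) \<le> K * \<theta> ^ n * cmod z"
proof -
  obtain \<kappa> where \<kappa>: "0 < \<kappa>" "\<And>X z. growing L lam X \<Longrightarrow> z \<in> contracted X \<Longrightarrow>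
       \<exists>g. 0 < g \<and> g \<le> \<kappa> \<and> cmod (act (iter X g) z) \<le> cmod z / 2"
    using halving_time[OF assms(1), of L] by metis
  \<comment> \<open>a factor 1/2 per \<open>\<kappa>\<close> steps\<close>
  define \<theta> where "\<theta> = root \<kappa> (1 / 2)"
  have t: "0 < \<theta>" "\<theta> < 1" "\<theta> ^ \<kappa> = 1 / 2"
    using \<kappa>(1) by (simp_all add: \<theta>_def)
  define K where "K = 2 * L ^ \<kappa>"
  have K: "1 \<le> K" using one_le_power[OF assms(2), of \<kappa>] by (simp add: K_def)
  have main: "cmod (act (iter X n) z) \<le> K * \<theta> ^ n * cmod z" if "growing L lam X" "z \<in> contracted X" for X z n
    using that
  proof (induction n arbitrary: X z rule: less_induct)
    case (less n)
    show ?case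
    proof (cases "n < \<kappa>")
      case True
      have "cmod (act (iter X n) z) \<le> L ^ n * cmod z"
        using cmod_act_le[of "iter X n" z] growingD(6)[OF less.prems(1), of n]
        by (meson mult_right_mono norm_ge_zero order_trans)
      also have "\<dots> \<le> L ^ \<kappa> * cmod z"
        using True assms by (intro mult_right_mono power_increasing) auto
      also have "L ^ \<kappa> = K * \<theta> ^ \<kappa>" by (simp add: K_def t)
      also have "K * \<theta> ^ \<kappa> * cmod z \<le> K * \<theta> ^ n * cmod z"
        using True t K by (intro mult_right_mono mult_left_mono power_decreasing) auto
      finally show ?thesis .
    next
      case False
      obtain g where g: "0 < g" "g \<le> \<kappa>" "cmod (act (iter X g) z) \<le> cmod z / 2"
        using \<kappa>(2)[OF less.prems] by blast
      have n: "n = (n - g) + g" using False g by simp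
      have "act (iter X n) z = act (iter (\<lambda>i. X (i + g)) (n - g)) (act (iter X g) z)"
        by (subst n, subst iter_add) (simp add: act_mult)
      also have "cmod \<dots> \<le> K * \<theta> ^ (n - g) * cmod (act (iter X g) z)"
        using g False \<kappa>(1)
        by (intro less.IH growing_shift[OF less.prems(1)] act_iter_contracted[OF less.prems]) auto
      also have "\<dots> \<le> K * \<theta> ^ (n - g) * (\<theta> ^ g * cmod z)"
      proof (rule mult_left_mono)
        have "\<theta> ^ \<kappa> \<le> \<theta> ^ g" using t g by (intro power_decreasing) auto
        then have "1 / 2 * cmod z \<le> \<theta> ^ g * cmod z" unfolding t by (rule mult_right_mono) simp
        then show "cmod (act (iter X g) z) \<le> \<theta> ^ g * cmod z" using g(3) by simp
      qed (use K t in simp)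
      also have "\<dots> = K * \<theta> ^ n * cmod z"
        by (subst (2) n) (simp add: power_add)
      finally show ?thesis .
    qed
  qed
  show thesis by (rule that[OF K t(1,2) main])
qed


lemma iter_word: "iter (\<lambda>i. A (f i)) n = word_mat A (map f [0..<n])"
  by (induction n) (simp_all add: word_mat_append)

lemma iter_inverse_word:
  assumes "\<And>i. A (f i) \<in> SL2"
  shows "iter (\<lambda>i. matrix_inv (A (f i))) n = matrix_inv (word_mat A (rev (map f [0..<n])))"
proof -
  have "iter (\<lambda>i. matrix_inv (A (f i))) n = word_mat (\<lambda>x. matrix_inv (A x)) (rev (rev (map f [0..<n])))"
    using iter_word[of "\<lambda>x. matrix_inv (A x)" f n] by simp
  also have "\<dots> = matrix_inv (word_mat A (rev (map f [0..<n])))"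
    by (rule word_mat_inverse) (use assms in auto)
  finally show ?thesis .
qed

lemma act_inverse:
  assumes "M \<in> SL2"
  shows "act (matrix_inv M) (act M z) = z" "act M (act (matrix_inv M) z) = z"
  by (simp_all add: SL2_matrix_inv[OF assms] flip: act_mult)

lemma contracted_line_vec:
  assumes "growing L lam X" "1 < lam"
  shows "subspace (complex_vec ` contracted X)" "dim (complex_vec ` contracted X) = 1"
proof -
  obtain u where u: "cmod u = 1" "contracted X = range (\<lambda>c. c *\<^sub>R u)"
    using contracted_line[OF assms] by metis
  have "complex_vec ` contracted X = range (\<lambda>c. c *\<^sub>R complex_vec u)"
    unfolding u(2) image_image by (simp add: linear_cmul[OF linear_complex_vec])
  then have *: "complex_vec ` contracted X = span {complex_vec u}"
    by (simp add: span_singleton)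
  have "complex_vec u \<noteq> 0"
  proof
    assume "complex_vec u = 0"
    then have "vec_complex (complex_vec u) = 0" by (simp add: vec_complex_def complex_eq_iff)
    then show False using u(1) by simp
  qed
  then show "subspace (complex_vec ` contracted X)" "dim (complex_vec ` contracted X) = 1"
    unfolding * by (simp_all add: dim_singleton)
qed

text \<open>The contracting direction at \<open>\<omega>\<close> is the contracted line of the future matrices of \<open>\<omega>\<close>, the
  expanding direction is the contracted line of the inverses of its past matrices. Expansion along the
  latter is the contraction estimate read backwards in time. The two lines are transverse, since a common
  vector would be exponentially expanded and contracted at once.\<close>
theorem uniformly_hyperbolic_if_growth:
  assumes A: "\<And>x. x \<in> {1..k} \<Longrightarrow> A x \<in> SL2"
    and lam: "1 < lam"
    and growth: "\<And>w. set w \<subseteq> {1..k} \<Longrightarrow> lam ^ length w \<le> mnorm (word_mat A w)"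
  shows "uniformly_hyperbolic k A"
proof -
  define L where "L = Max (insert 1 ((\<lambda>x. mnorm (A x)) ` {1..k}))"
  have L: "mnorm (A x) \<le> L" if "x \<in> {1..k}" for x
    unfolding L_def using that by (intro Max_ge) auto
  have L1: "1 \<le> L" unfolding L_def by (intro Max_ge) auto
  obtain K \<theta> where K: "1 \<le> K" "0 < \<theta>" "\<theta> < 1"
    "\<And>X z n. growing L lam X \<Longrightarrow> z \<in> contracted X \<Longrightarrow> cmod (act (iter X n) z) \<le> K * \<theta> ^ n * cmod z"
    using uniform_contraction[OF lam L1] by metis
  define Xf where "Xf \<omega> = (\<lambda>i. A (\<omega> (int i)))" for \<omega> :: "int \<Rightarrow> nat"
  define Xb where "Xb \<omega> = (\<lambda>i. matrix_inv (A (\<omega> (- 1 - int i))))" for \<omega> :: "int \<Rightarrow> nat"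
  define \<Omega> where "\<Omega> = {\<omega> :: int \<Rightarrow> nat. \<forall>i. \<omega> i \<in> {1..k}}"
  have topspace: "topspace (shift_space k) = \<Omega>"
    by (auto simp: shift_space_def \<Omega>_def PiE_def)
  have shift_\<Omega>: "shift \<omega> \<in> \<Omega>" if "\<omega> \<in> \<Omega>" for \<omega>
    using that by (simp add: \<Omega>_def shift_def)
  have A\<Omega>: "A (\<omega> i) \<in> SL2" "mnorm (A (\<omega> i)) \<le> L" if "\<omega> \<in> \<Omega>" for \<omega> i
    using that A L by (simp_all add: \<Omega>_def)
  have map_subset: "(\<lambda>i. \<omega> (g i)) ` S \<subseteq> {1..k}" if "\<omega> \<in> \<Omega>" for \<omega> g and S :: "nat set"
    using that unfolding \<Omega>_def by blast
  have growing_f: "growing L lam (Xf \<omega>)" if "\<omega> \<in> \<Omega>" for \<omega>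
    unfolding growing_def
  proof (intro conjI allI)
    fix j n
    have "iter (\<lambda>i. Xf \<omega> (i + j)) n = word_mat A (map (\<lambda>i. \<omega> (int (i + j))) [0..<n])"
      unfolding Xf_def by (rule iter_word)
    then show "lam ^ n \<le> mnorm (iter (\<lambda>i. Xf \<omega> (i + j)) n)"
      using growth[of "map (\<lambda>i. \<omega> (int (i + j))) [0..<n]"] map_subset[OF that] by simp
  qed (use A\<Omega>[OF that] in \<open>auto simp: Xf_def\<close>)
  have growing_b: "growing L lam (Xb \<omega>)" if "\<omega> \<in> \<Omega>" for \<omega>
    unfolding growing_def
  proof (intro conjI allI)
    fix j n
    let ?w = "rev (map (\<lambda>i. \<omega> (- 1 - int (i + j))) [0..<n])"
    have "iter (\<lambda>i. Xb \<omega> (i + j)) n = matrix_inv (word_mat A ?w)"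
      unfolding Xb_def by (rule iter_inverse_word) (rule A\<Omega>[OF that])
    moreover have "word_mat A ?w \<in> SL2"
      by (rule word_mat_SL2) (use A\<Omega>[OF that] in auto)
    ultimately show "lam ^ n \<le> mnorm (iter (\<lambda>i. Xb \<omega> (i + j)) n)"
      using growth[of ?w] map_subset[OF that] by (simp add: SL2_matrix_inv(6))
  qed (use A\<Omega>[OF that] SL2_matrix_inv in \<open>auto simp: Xb_def\<close>)
  define e1 where "e1 \<omega> = complex_vec ` contracted (Xb \<omega>)" for \<omega>
  define e2 where "e2 \<omega> = complex_vec ` contracted (Xf \<omega>)" for \<omega>
  have vec_back: "vec_complex v \<in> S" if "v \<in> complex_vec ` S" for v S
    using that by auto
  have image_eq: "(\<lambda>v. M *v v) ` (complex_vec ` S) = complex_vec ` (act M ` S)" for M S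
  proof -
    have "M *v complex_vec z = complex_vec (act M z)" for z
      using arg_cong[OF vec_complex_mult[of M "complex_vec z"], of complex_vec] by simp
    then show ?thesis by (simp add: image_image)
  qed
  have Xb_shift: "Xb \<omega> = (\<lambda>i. Xb (shift \<omega>) (i + 1))" for \<omega>
    by (rule ext) (simp add: Xb_def shift_def algebra_simps)
  have Xf_shift: "Xf (shift \<omega>) = (\<lambda>i. Xf \<omega> (i + 1))" for \<omega>
    by (rule ext) (simp add: Xf_def shift_def algebra_simps)
  have Xb0: "Xb (shift \<omega>) 0 = matrix_inv (A (\<omega> 0))" for \<omega>
    by (simp add: Xb_def shift_def)
  have Xf0: "Xf \<omega> 0 = A (\<omega> 0)" for \<omega>
    by (simp add: Xf_def)
  have inv_f: "act (A (\<omega> 0)) ` contracted (Xf \<omega>) = contracted (Xf (shift \<omega>))" if "\<omega> \<in> \<Omega>" for \<omega>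
  proof -
    have *: "act (A (\<omega> 0)) z \<in> contracted (Xf (shift \<omega>)) \<longleftrightarrow> z \<in> contracted (Xf \<omega>)" for z
      using act_in_contracted_iff[OF growing_f[OF that], of z] unfolding Xf_shift Xf0 .
    have "z \<in> act (A (\<omega> 0)) ` contracted (Xf \<omega>)" if z: "z \<in> contracted (Xf (shift \<omega>))" for z
      using *[of "act (matrix_inv (A (\<omega> 0))) z"] z act_inverse(2)[OF A\<Omega>(1)[OF \<open>\<omega> \<in> \<Omega>\<close>], of 0 z]
      by (intro image_eqI[of _ _ "act (matrix_inv (A (\<omega> 0))) z"]) auto
    then show ?thesis using * by auto
  qed
  have inv_b: "act (A (\<omega> 0)) ` contracted (Xb \<omega>) = contracted (Xb (shift \<omega>))" if "\<omega> \<in> \<Omega>" for \<omega>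
  proof -
    have *: "act (matrix_inv (A (\<omega> 0))) z \<in> contracted (Xb \<omega>) \<longleftrightarrow> z \<in> contracted (Xb (shift \<omega>))" for z
      using act_in_contracted_iff[OF growing_b[OF shift_\<Omega>[OF that]], of z] unfolding Xb_shift[symmetric] Xb0 .
    note inv = act_inverse[OF A\<Omega>(1)[OF that], of 0]
    have "z \<in> act (A (\<omega> 0)) ` contracted (Xb \<omega>)" if z: "z \<in> contracted (Xb (shift \<omega>))" for z
      using *[of z] z inv(2)[of z]
      by (intro image_eqI[of _ _ "act (matrix_inv (A (\<omega> 0))) z"]) auto
    moreover have "act (A (\<omega> 0)) z \<in> contracted (Xb (shift \<omega>))" if z: "z \<in> contracted (Xb \<omega>)" for z
      using *[of "act (A (\<omega> 0)) z"] z inv(1)[of z] by simp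
    ultimately show ?thesis by blast
  qed
  have forward: "iter (Xf \<omega>) n = cocycle A (int n) \<omega>" for \<omega> n
    using iter_word[of A "\<lambda>i. \<omega> (int i)" n] by (simp add: Xf_def cocycle_def cocycle_nat_word)
  have shift_pow: "(shift ^^ n) \<omega> = (\<lambda>i. \<omega> (i + int n))" for \<omega> :: "int \<Rightarrow> nat" and n
    by (induction n) (auto simp: shift_def algebra_simps)
  have shift_pow_\<Omega>: "(shift ^^ n) \<omega> \<in> \<Omega>" if "\<omega> \<in> \<Omega>" for \<omega> n
    using that by (simp add: shift_pow \<Omega>_def)
  have iter_b: "act (iter (Xf \<omega>) n) z \<in> contracted (Xb ((shift ^^ n) \<omega>))"
    if "\<omega> \<in> \<Omega>" "z \<in> contracted (Xb \<omega>)" for \<omega> z n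
  proof (induction n)
    case 0
    then show ?case using that by simp
  next
    case (Suc n)
    have "Xf \<omega> n = A ((shift ^^ n) \<omega> 0)" by (simp add: Xf_def shift_pow)
    then show ?case
      using inv_b[OF shift_pow_\<Omega>[OF that(1)], of n] Suc by (auto simp: act_mult)
  qed
  have backward: "act (iter (Xb ((shift ^^ n) \<omega>)) n) (act (iter (Xf \<omega>) n) z) = z" if "\<omega> \<in> \<Omega>" for \<omega> n z
  proof -
    have "rev (map (\<lambda>i. (shift ^^ n) \<omega> (- 1 - int i)) [0..<n]) = map (\<lambda>i. \<omega> (int i)) [0..<n]"
      by (rule nth_equalityI) (auto simp: rev_nth shift_pow of_nat_diff intro!: arg_cong[of _ _ \<omega>])
    moreover have "iter (Xb ((shift ^^ n) \<omega>)) n = matrix_inv (word_mat A (rev (map (\<lambda>i. (shift ^^ n) \<omega> (- 1 - int i)) [0..<n])))"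
      unfolding Xb_def by (rule iter_inverse_word) (rule A\<Omega>[OF shift_pow_\<Omega>[OF that]])
    moreover have "iter (Xf \<omega>) n = word_mat A (map (\<lambda>i. \<omega> (int i)) [0..<n])"
      unfolding Xf_def by (rule iter_word)
    moreover have "word_mat A (map (\<lambda>i. \<omega> (int i)) [0..<n]) \<in> SL2"
      by (rule word_mat_SL2) (use A\<Omega>[OF that] in auto)
    ultimately show ?thesis by (simp add: act_inverse)
  qed
  have contr: "cmod (act (iter (Xf \<omega>) n) z) \<le> K * \<theta> ^ n * cmod z"
    if "\<omega> \<in> \<Omega>" "z \<in> contracted (Xf \<omega>)" for \<omega> z n
    by (rule K(4)[OF growing_f[OF that(1)] that(2)])
  have expand: "cmod z \<le> K * \<theta> ^ n * cmod (act (iter (Xf \<omega>) n) z)"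
    if "\<omega> \<in> \<Omega>" "z \<in> contracted (Xb \<omega>)" for \<omega> z n
    using K(4)[OF growing_b[OF shift_pow_\<Omega>[OF that(1)]] iter_b[OF that], of n n] unfolding backward[OF that(1)] .
  have disjoint: "z = 0" if "\<omega> \<in> \<Omega>" "z \<in> contracted (Xb \<omega>)" "z \<in> contracted (Xf \<omega>)" for \<omega> z
  proof -
    have "cmod z \<le> K * K * cmod z * (\<theta> * \<theta>) ^ n" for n
    proof -
      have "cmod z \<le> K * \<theta> ^ n * cmod (act (iter (Xf \<omega>) n) z)" by (rule expand[OF that(1,2)])
      also have "\<dots> \<le> K * \<theta> ^ n * (K * \<theta> ^ n * cmod z)"
        using K by (intro mult_left_mono contr[OF that(1,3)]) auto
      finally show ?thesis by (simp add: power_mult_distrib mult_ac)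
    qed
    moreover have "(\<lambda>n. K * K * cmod z * (\<theta> * \<theta>) ^ n) \<longlonglongrightarrow> 0"
      using K(2,3) mult_strict_mono[of \<theta> 1 \<theta> 1]
      by (intro tendsto_mult_right_zero LIMSEQ_realpow_zero) auto
    ultimately have "cmod z \<le> 0" by (intro LIMSEQ_le_const) auto
    then show ?thesis by simp
  qed
  have exp_\<theta>: "exp (- (- ln \<theta>) * real n) = \<theta> ^ n" for n
    using K(2) exp_of_nat_mult[of n "ln \<theta>"] by (simp add: mult.commute)
  show ?thesis
    unfolding uniformly_hyperbolic_def
  proof (rule exI[of _ e1], rule exI[of _ e2], rule exI[of _ "inverse K"], rule conjI[rotated],
      rule exI[of _ "- ln \<theta>"], rule conjI[rotated], rule ballI, intro conjI)
    show "0 < inverse K" "0 < - ln \<theta>" using K by auto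
    fix \<omega> assume "\<omega> \<in> topspace (shift_space k)"
    then have \<omega>: "\<omega> \<in> \<Omega>" by (simp add: topspace)
    show sub: "subspace (e1 \<omega>)" "dim (e1 \<omega>) = 1" "subspace (e2 \<omega>)" "dim (e2 \<omega>) = 1"
      unfolding e1_def e2_def
      using contracted_line_vec[OF growing_b[OF \<omega>] lam] contracted_line_vec[OF growing_f[OF \<omega>] lam] by auto
    show int: "e1 \<omega> \<inter> e2 \<omega> = {0}"
    proof
      show "e1 \<omega> \<inter> e2 \<omega> \<subseteq> {0}"
      proof
        fix v assume v: "v \<in> e1 \<omega> \<inter> e2 \<omega>"
        then have "vec_complex v \<in> contracted (Xb \<omega>)" "vec_complex v \<in> contracted (Xf \<omega>)"
          using vec_back by (simp_all add: e1_def e2_def)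
        then have "vec_complex v = 0" using disjoint[OF \<omega>] by blast
        then have "norm v = 0" using norm_vec_complex[of v] by simp
        then show "v \<in> {0}" by simp
      qed
      show "{0} \<subseteq> e1 \<omega> \<inter> e2 \<omega>" using sub by (auto intro: subspace_0)
    qed
    have "dim {v + w |v w. v \<in> e1 \<omega> \<and> w \<in> e2 \<omega>} = DIM(real^2)"
      using dim_sums_Int[OF sub(1,3)] by (simp add: sub(2,4) int)
    then have "span {v + w |v w. v \<in> e1 \<omega> \<and> w \<in> e2 \<omega>} = UNIV"
      by (simp only: dim_eq_full)
    moreover have "span {v + w |v w. v \<in> e1 \<omega> \<and> w \<in> e2 \<omega>} = {v + w |v w. v \<in> e1 \<omega> \<and> w \<in> e2 \<omega>}"
      using subspace_sums[OF sub(1,3)] by (simp only: span_eq_iff)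
    ultimately show "{v + w |v w. v \<in> e1 \<omega> \<and> w \<in> e2 \<omega>} = UNIV" by simp
    show "(\<lambda>v. A (\<omega> 0) *v v) ` e1 \<omega> = e1 (shift \<omega>)" "(\<lambda>v. A (\<omega> 0) *v v) ` e2 \<omega> = e2 (shift \<omega>)"
      unfolding e1_def e2_def image_eq inv_b[OF \<omega>] inv_f[OF \<omega>] by simp_all
    have coc: "norm (cocycle A (int n) \<omega> *v v) = cmod (act (iter (Xf \<omega>) n) (vec_complex v))" for n v
      unfolding forward[symmetric] by (simp flip: vec_complex_mult add: norm_vec_complex)
    show "\<forall>n. (\<forall>v\<in>e1 \<omega>. inverse K * exp (- ln \<theta> * real n) * norm v \<le> norm (cocycle A (int n) \<omega> *v v)) \<and>
             (\<forall>v\<in>e2 \<omega>. norm (cocycle A (int n) \<omega> *v v) \<le> inverse (inverse K) * exp (- (- ln \<theta>) * real n) * norm v)"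
    proof (intro allI conjI ballI)
      fix n v
      assume "v \<in> e2 \<omega>"
      then have "vec_complex v \<in> contracted (Xf \<omega>)" using vec_back by (simp add: e2_def)
      from contr[OF \<omega> this, of n]
      show "norm (cocycle A (int n) \<omega> *v v) \<le> inverse (inverse K) * exp (- (- ln \<theta>) * real n) * norm v"
        unfolding coc exp_\<theta> norm_vec_complex by simp
    next
      fix n v
      assume "v \<in> e1 \<omega>"
      then have "vec_complex v \<in> contracted (Xb \<omega>)" using vec_back by (simp add: e1_def)
      from expand[OF \<omega> this, of n]
      have *: "norm v \<le> K * \<theta> ^ n * norm (cocycle A (int n) \<omega> *v v)"
        unfolding coc norm_vec_complex .
      have "exp (- ln \<theta> * real n) = inverse (\<theta> ^ n)"
        unfolding exp_\<theta>[symmetric] by (simp flip: exp_minus)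
      moreover have "inverse K * inverse (\<theta> ^ n) * norm v
          \<le> inverse K * inverse (\<theta> ^ n) * (K * \<theta> ^ n * norm (cocycle A (int n) \<omega> *v v))"
        using K by (intro mult_left_mono[OF *]) auto
      moreover have "inverse K * inverse (\<theta> ^ n) * (K * \<theta> ^ n * x) = x" for x
        using K(1,2) by (simp add: field_simps)
      ultimately show "inverse K * exp (- ln \<theta> * real n) * norm v \<le> norm (cocycle A (int n) \<omega> *v v)"
        by simp
    qed
  qed
qed

section \<open>Invariant sets of sequences with bounded products\<close>

definition window :: "(int \<Rightarrow> nat) \<Rightarrow> int \<Rightarrow> nat \<Rightarrow> nat list" where
  "window \<omega> j n = map (\<lambda>i. \<omega> (j + int i)) [0..<n]"

text \<open>All windows are bounded, including those in the past. This makes the set invariant under the shift in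
  both directions, and closed, because each window is a finite set of coordinates.\<close>
definition bounded_set :: "nat \<Rightarrow> (nat \<Rightarrow> real^2^2) \<Rightarrow> real \<Rightarrow> (int \<Rightarrow> nat) set" where
  "bounded_set k A C =
     {\<omega> \<in> topspace (shift_space k). \<forall>j n. mnorm (word_mat A (window \<omega> j n)) \<le> C}"

lemma topspace_shift_space: "topspace (shift_space k) = {\<omega>. \<forall>i. \<omega> i \<in> {1..k}}"
  by (auto simp: shift_space_def PiE_def)

text \<open>Cylinders are a basis of the product topology: a set is open if membership in it is always witnessed
  by finitely many coordinates.\<close>
lemma openin_shift_space_if_local:
  assumes "S \<subseteq> topspace (shift_space k)"
    and loc: "\<And>\<omega>. \<omega> \<in> S \<Longrightarrow> \<exists>I. finite I \<and>
      (\<forall>\<omega>' \<in> topspace (shift_space k). (\<forall>i\<in>I. \<omega>' i = \<omega> i) \<longrightarrow> \<omega>' \<in> S)"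
  shows "openin (shift_space k) S"
proof (subst openin_subopen, intro ballI)
  fix \<omega> assume \<omega>: "\<omega> \<in> S"
  then obtain I where I: "finite I"
    "\<And>\<omega>'. \<omega>' \<in> topspace (shift_space k) \<Longrightarrow> \<forall>i\<in>I. \<omega>' i = \<omega> i \<Longrightarrow> \<omega>' \<in> S"
    using loc by metis
  define T where "T = PiE UNIV (\<lambda>i. if i \<in> I then {\<omega> i} else {1..k})"
  have \<omega>k: "\<omega> i \<in> {1..k}" for i
    using assms(1) \<omega> by (auto simp: topspace_shift_space)
  have "openin (shift_space k) T"
    unfolding shift_space_def T_def openin_PiE_gen
    using I(1) \<omega>k by (intro disjI2 conjI) (auto intro: finite_subset[OF _ I(1)])
  moreover have "\<omega> \<in> T" using \<omega>k by (auto simp: T_def)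
  moreover have "T \<subseteq> S"
  proof
    fix \<omega>' assume "\<omega>' \<in> T"
    then have *: "\<omega>' i \<in> (if i \<in> I then {\<omega> i} else {1..k})" for i
      by (auto simp: T_def PiE_def Pi_def)
    have "\<omega>' i \<in> {1..k}" for i using *[of i] \<omega>k[of i] by (cases "i \<in> I") auto
    moreover have "\<forall>i\<in>I. \<omega>' i = \<omega> i"
    proof
      fix i assume "i \<in> I" then show "\<omega>' i = \<omega> i" using *[of i] by simp
    qed
    ultimately show "\<omega>' \<in> S" by (intro I(2)) (simp_all add: topspace_shift_space)
  qed
  ultimately show "\<exists>T. openin (shift_space k) T \<and> \<omega> \<in> T \<and> T \<subseteq> S" by blast
qed

lemma compactin_bounded_set: "compactin (shift_space k) (bounded_set k A C)"
proof (rule closedin_compact_space)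
  show "compact_space (shift_space k)"
    unfolding shift_space_def by (simp add: compact_space_product_topology compact_space_discrete_topology)
  show "closedin (shift_space k) (bounded_set k A C)"
    unfolding closedin_def
  proof (intro conjI openin_shift_space_if_local)
    fix \<omega> assume "\<omega> \<in> topspace (shift_space k) - bounded_set k A C"
    then obtain j n where jn: "\<not> mnorm (word_mat A (window \<omega> j n)) \<le> C"
      by (auto simp: bounded_set_def)
    have "\<omega>' \<in> topspace (shift_space k) - bounded_set k A C"
      if "\<omega>' \<in> topspace (shift_space k)" "\<forall>i\<in>{j..<j + int n}. \<omega>' i = \<omega> i" for \<omega>'
    proof -
      have "window \<omega>' j n = window \<omega> j n" using that(2) by (simp add: window_def)
      then have "\<not> mnorm (word_mat A (window \<omega>' j n)) \<le> C" using jn by simp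
      then have "\<omega>' \<notin> bounded_set k A C" unfolding bounded_set_def by blast
      then show ?thesis using that(1) by blast
    qed
    then show "\<exists>I. finite I \<and> (\<forall>\<omega>'\<in>topspace (shift_space k).
        (\<forall>i\<in>I. \<omega>' i = \<omega> i) \<longrightarrow> \<omega>' \<in> topspace (shift_space k) - bounded_set k A C)"
      by (intro exI[of _ "{j..<j + int n}"]) simp
  qed (auto simp: bounded_set_def)
qed

lemma shift_in_bounded_set_iff: "shift \<omega> \<in> bounded_set k A C \<longleftrightarrow> \<omega> \<in> bounded_set k A C"
proof -
  have w: "window (shift \<omega>) j n = window \<omega> (j + 1) n" for j n
    by (simp add: window_def shift_def algebra_simps)
  have all_shift: "(\<forall>i::int. P (i + 1)) \<longleftrightarrow> (\<forall>i. P i)" for P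
  proof
    assume *: "\<forall>i::int. P (i + 1)"
    show "\<forall>i. P i"
    proof
      fix i show "P i" using spec[OF *, of "i - 1"] by simp
    qed
  qed blast
  have "(\<forall>i. \<omega> (i + 1) \<in> {1..k}) \<longleftrightarrow> (\<forall>i. \<omega> i \<in> {1..k})"
    by (rule all_shift)
  moreover have "(\<forall>j n. mnorm (word_mat A (window \<omega> (j + 1) n)) \<le> C)
      \<longleftrightarrow> (\<forall>j n. mnorm (word_mat A (window \<omega> j n)) \<le> C)"
    by (rule all_shift)
  ultimately show ?thesis
    by (simp add: bounded_set_def topspace_shift_space w) (simp add: shift_def)
qed

lemma shift_inverse: "shift (\<lambda>n. \<omega> (n - 1)) = \<omega>" "(\<lambda>n. shift \<omega> (n - 1)) = \<omega>"
  by (simp_all add: shift_def)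

lemma inv_shift: "inv shift \<omega> = (\<lambda>n. \<omega> (n - 1))"
proof (rule inv_f_eq)
  show "inj shift" by (rule inj_on_inverseI[of _ "\<lambda>\<omega> n. \<omega> (n - 1)"]) (rule shift_inverse)
qed (rule shift_inverse)

lemma shift_image_bounded_set: "shift ` bounded_set k A C = bounded_set k A C"
proof
  show "shift ` bounded_set k A C \<subseteq> bounded_set k A C"
    using shift_in_bounded_set_iff by blast
  show "bounded_set k A C \<subseteq> shift ` bounded_set k A C"
  proof
    fix \<omega> assume "\<omega> \<in> bounded_set k A C"
    then have "(\<lambda>n. \<omega> (n - 1)) \<in> bounded_set k A C"
      using shift_in_bounded_set_iff[of "\<lambda>n. \<omega> (n - 1)"] by (simp add: shift_inverse)
    then show "\<omega> \<in> shift ` bounded_set k A C"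
      by (rule image_eqI[rotated]) (simp add: shift_inverse)
  qed
qed

lemma op_norm_cocycle_le:
  assumes \<omega>: "\<omega> \<in> bounded_set k A C" and A: "\<And>x. x \<in> {1..k} \<Longrightarrow> A x \<in> SL2"
  shows "op_norm (cocycle A n \<omega>) \<le> C"
proof (cases "0 \<le> n")
  case True
  then have "cocycle A n \<omega> = word_mat A (window \<omega> 0 (nat n))"
    by (simp add: cocycle_def cocycle_nat_word window_def)
  then show ?thesis
    using \<omega> op_norm_le_mnorm[of "cocycle A n \<omega>"] by (auto simp: bounded_set_def intro: order_trans)
next
  case False
  have pow: "(inv shift ^^ m) \<omega> = (\<lambda>i. \<omega> (i - int m))" for m
    by (induction m) (auto simp: inv_shift algebra_simps)
  have "cocycle A n \<omega> = matrix_inv (word_mat A (window \<omega> n (nat (- n))))"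
    using False by (simp add: cocycle_def cocycle_nat_word window_def pow add.commute)
  moreover have "word_mat A (window \<omega> n (nat (- n))) \<in> SL2"
    by (rule word_mat_SL2) (use \<omega> A in \<open>auto simp: window_def bounded_set_def topspace_shift_space\<close>)
  ultimately have "mnorm (cocycle A n \<omega>) \<le> C"
    using \<omega> by (simp add: SL2_matrix_inv bounded_set_def)
  then show ?thesis
    using op_norm_le_mnorm[of "cocycle A n \<omega>"] by linarith
qed

text \<open>The cover by the cylinders of the zeroth coordinate is a partition, so a member of its join determines
  the word at positions $0, \ldots, n-1$. A subcover therefore has at least as many members as there are
  words.\<close>
lemma cover_number_ge_words:
  assumes K: "K \<subseteq> topspace (shift_space k)" and inv: "shift ` K \<subseteq> K"
  defines "X \<equiv> subtopology (shift_space k) K"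
    and "\<U> \<equiv> (\<lambda>s. {x \<in> K. x 0 = s}) ` {1..k}"
  shows "card ((\<lambda>\<omega>. window \<omega> 0 n) ` K) \<le> cover_number X (cover_join X shift \<U> n)"
proof -
  have top: "topspace X = K" using K by (auto simp: X_def)
  have pow: "(shift ^^ i) x = (\<lambda>j. x (j + int i))" for i and x :: "int \<Rightarrow> nat"
    by (induction i) (auto simp: shift_def algebra_simps)
  define J where "J = cover_join X shift \<U> n"
  have Jconst: "window x 0 n = window y 0 n" if v: "v \<in> J" "x \<in> v" "y \<in> v" for v x y
  proof -
    obtain u where u: "v = {x \<in> K. \<forall>i<n. (shift ^^ i) x \<in> u i}" "\<forall>i<n. u i \<in> \<U>"
      using v(1) unfolding J_def cover_join_def top by blast
    have "x (int i) = y (int i)" if "i < n" for i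
    proof -
      have "u i \<in> \<U>" "(shift ^^ i) x \<in> u i" "(shift ^^ i) y \<in> u i"
        using u \<open>x \<in> v\<close> \<open>y \<in> v\<close> that by auto
      then have "(shift ^^ i) x 0 = (shift ^^ i) y 0" by (auto simp: \<U>_def)
      then show ?thesis by (simp add: pow)
    qed
    then show ?thesis by (simp add: window_def)
  qed
  have Jcover: "\<Union>J = K"
  proof
    show "\<Union>J \<subseteq> K" by (auto simp: J_def cover_join_def top)
    show "K \<subseteq> \<Union>J"
    proof
      fix x assume x: "x \<in> K"
      have orbit: "(shift ^^ i) x \<in> K" for i
        by (induction i) (use x inv in auto)
      define u where "u i = {y \<in> K. y 0 = (shift ^^ i) x 0}" for i
      have "u i \<in> \<U>" for i
        using orbit[of i] K by (auto simp: u_def \<U>_def topspace_shift_space)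
      then have "{y \<in> K. \<forall>i<n. (shift ^^ i) y \<in> u i} \<in> J"
        unfolding J_def cover_join_def top by blast
      moreover have "x \<in> {y \<in> K. \<forall>i<n. (shift ^^ i) y \<in> u i}"
        using x orbit by (simp add: u_def)
      ultimately show "x \<in> \<Union>J" by blast
    qed
  qed
  have Jfinite: "finite J"
  proof (rule finite_subset)
    show "J \<subseteq> (\<lambda>u. {x \<in> K. \<forall>i<n. (shift ^^ i) x \<in> u i}) ` (PiE {..<n} (\<lambda>_. \<U>))"
    proof
      fix v assume "v \<in> J"
      then obtain u where u: "v = {x \<in> K. \<forall>i<n. (shift ^^ i) x \<in> u i}" "\<forall>i<n. u i \<in> \<U>"
        unfolding J_def cover_join_def top by blast
      show "v \<in> (\<lambda>u. {x \<in> K. \<forall>i<n. (shift ^^ i) x \<in> u i}) ` (PiE {..<n} (\<lambda>_. \<U>))"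
        by (rule image_eqI[of _ _ "restrict u {..<n}"]) (use u in auto)
    qed
    show "finite ((\<lambda>u. {x \<in> K. \<forall>i<n. (shift ^^ i) x \<in> u i}) ` (PiE {..<n} (\<lambda>_. \<U>)))"
      by (intro finite_imageI finite_PiE) (auto simp: \<U>_def)
  qed
  have ge: "card ((\<lambda>\<omega>. window \<omega> 0 n) ` K) \<le> card \<V>" if \<V>: "\<V> \<subseteq> J" "finite \<V>" "\<Union>\<V> = K" for \<V>
  proof (rule surj_card_le[OF \<V>(2), of _ "\<lambda>v. window (SOME x. x \<in> v) 0 n"], rule subsetI)
    fix w assume "w \<in> (\<lambda>\<omega>. window \<omega> 0 n) ` K"
    then obtain x v where xv: "x \<in> v" "v \<in> \<V>" "w = window x 0 n" using \<V>(3) by blast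
    have "(SOME x. x \<in> v) \<in> v" by (rule someI[of "\<lambda>x. x \<in> v", OF xv(1)])
    then have "w = window (SOME x. x \<in> v) 0 n"
      unfolding xv(3) using xv(1,2) \<V>(1) by (intro Jconst[of v]) auto
    then show "w \<in> (\<lambda>v. window (SOME x. x \<in> v) 0 n) ` \<V>"
      using xv(2) by (rule image_eqI)
  qed
  have "\<exists>m \<V>. \<V> \<subseteq> J \<and> finite \<V> \<and> card \<V> = m \<and> \<Union>\<V> = topspace X"
    using Jfinite Jcover top by (intro exI[of _ "card J"] exI[of _ J]) simp
  then have "\<exists>\<V>. \<V> \<subseteq> J \<and> finite \<V> \<and> card \<V> = cover_number X J \<and> \<Union>\<V> = topspace X"
    unfolding cover_number_def by (rule LeastI_ex)
  then obtain \<V> where \<V>: "\<V> \<subseteq> J" "finite \<V>" "card \<V> = cover_number X J" "\<Union>\<V> = K"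
    unfolding top by blast
  show ?thesis
    using ge[OF \<V>(1,2,4)] unfolding \<V>(3) J_def .
qed

lemma finite_windows:
  assumes K: "K \<subseteq> topspace (shift_space k)"
  shows "finite ((\<lambda>\<omega>. window \<omega> 0 n) ` K)"
proof (rule finite_subset)
  show "(\<lambda>\<omega>. window \<omega> 0 n) ` K \<subseteq> {xs. set xs \<subseteq> {1..k} \<and> length xs = n}"
  proof
    fix w assume "w \<in> (\<lambda>\<omega>. window \<omega> 0 n) ` K"
    then obtain \<omega> where "\<omega> \<in> K" "w = window \<omega> 0 n" by blast
    moreover have "\<omega> i \<in> {1..k}" for i
      using subsetD[OF K calculation(1)] unfolding topspace_shift_space by blast
    ultimately show "w \<in> {xs. set xs \<subseteq> {1..k} \<and> length xs = n}"
      by (auto simp: window_def)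
  qed
qed (simp add: finite_lists_length_eq)

text \<open>The number of words of length $n$ does not decrease with $n$, so a bound along the multiples of $l$
  gives the exponential rate $(\log 2) / (2 l)$ for all $n \ge l$.\<close>
lemma positive_entropy:
  assumes K: "K \<subseteq> topspace (shift_space k)" and inv: "shift ` K \<subseteq> K" and "0 < l"
    and words: "\<And>q. 2 ^ q \<le> card ((\<lambda>\<omega>. window \<omega> 0 (q * l)) ` K)"
  shows "0 < topological_entropy (subtopology (shift_space k) K) shift"
proof -
  define X where "X = subtopology (shift_space k) K"
  define \<U> where "\<U> = (\<lambda>s. {x \<in> K. x 0 = s}) ` {1..k}"
  have top: "topspace X = K" using K by (auto simp: X_def)
  have "open_cover X \<U>"
    unfolding open_cover_def
  proof (intro conjI ballI)
    fix v assume "v \<in> \<U>"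
    then obtain s where s: "v = {x \<in> K. x 0 = s}" by (auto simp: \<U>_def)
    have "openin (shift_space k) {x \<in> topspace (shift_space k). x 0 = s}"
    proof (rule openin_shift_space_if_local)
      fix \<omega> assume "\<omega> \<in> {x \<in> topspace (shift_space k). x 0 = s}"
      then show "\<exists>I. finite I \<and> (\<forall>\<omega>'\<in>topspace (shift_space k). (\<forall>i\<in>I. \<omega>' i = \<omega> i)
          \<longrightarrow> \<omega>' \<in> {x \<in> topspace (shift_space k). x 0 = s})"
        by (intro exI[of _ "{0}"]) simp
    qed blast
    moreover have "v = {x \<in> topspace (shift_space k). x 0 = s} \<inter> K" using s K by blast
    ultimately show "openin X v" unfolding X_def openin_subtopology by blast
  next
    show "\<Union>\<U> = topspace X" using K by (auto simp: top \<U>_def topspace_shift_space)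
  qed
  then have le: "cover_entropy X shift \<U> \<le> topological_entropy X shift"
    unfolding topological_entropy_def by (intro SUP_upper) simp
  have "ereal (ln 2 / (2 * real l)) \<le> ereal (ln (real (cover_number X (cover_join X shift \<U> n))) / real n)"
    if n: "l \<le> n" for n
  proof -
    define q where "q = n div l"
    have "0 < q" using n \<open>0 < l\<close> by (simp add: q_def div_greater_zero_iff)
    have ql: "q * l \<le> n" by (simp add: q_def)
    have "n < (q + 1) * l" using \<open>0 < l\<close> dividend_less_div_times[of l n] by (simp add: q_def)
    also have "\<dots> \<le> (2 * q) * l" using \<open>0 < q\<close> by (intro mult_right_mono) auto
    finally have n2: "n \<le> 2 * q * l" by simp
    have "(\<lambda>\<omega>. window \<omega> 0 (q * l)) ` K = take (q * l) ` (\<lambda>\<omega>. window \<omega> 0 n) ` K"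
      unfolding image_image using ql by (simp add: window_def take_map)
    then have "card ((\<lambda>\<omega>. window \<omega> 0 (q * l)) ` K) \<le> card ((\<lambda>\<omega>. window \<omega> 0 n) ` K)"
      by (simp only: card_image_le[OF finite_windows[OF K]])
    with words[of q] have "2 ^ q \<le> card ((\<lambda>\<omega>. window \<omega> 0 n) ` K)"
      by (rule order_trans)
    also have "\<dots> \<le> cover_number X (cover_join X shift \<U> n)"
      unfolding X_def \<U>_def by (rule cover_number_ge_words[OF K inv])
    finally have "real (2 ^ q) \<le> real (cover_number X (cover_join X shift \<U> n))"
      by (simp only: of_nat_le_iff)
    then have "ln (2 ^ q) \<le> ln (real (cover_number X (cover_join X shift \<U> n)))"
      by (intro ln_mono) auto
    then have "real q * ln 2 / real n \<le> ln (real (cover_number X (cover_join X shift \<U> n))) / real n"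
      by (intro divide_right_mono) (simp_all add: ln_realpow)
    moreover have "ln 2 / (2 * real l) \<le> real q * ln 2 / real n"
    proof -
      have "real n \<le> real (2 * q * l)" using n2 by (simp only: of_nat_le_iff)
      then have "ln 2 / (2 * real l) * real n \<le> ln 2 / (2 * real l) * real (2 * q * l)"
        by (rule mult_left_mono) simp
      also have "\<dots> = real q * ln 2" using \<open>0 < l\<close> by simp
      finally show ?thesis using n \<open>0 < l\<close> by (subst pos_le_divide_eq) auto
    qed
    ultimately show ?thesis by simp
  qed
  then have "\<forall>\<^sub>F n in sequentially. ereal (ln 2 / (2 * real l))
      \<le> ereal (ln (real (cover_number X (cover_join X shift \<U> n))) / real n)"
    by (rule eventually_sequentiallyI[of l])
  then have "ereal (ln 2 / (2 * real l)) \<le> cover_entropy X shift \<U>"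
    unfolding cover_entropy_def by (intro le_Limsup) simp_all
  also note le
  finally have "ereal (ln 2 / (2 * real l)) \<le> topological_entropy X shift" .
  moreover have "0 < ereal (ln 2 / (2 * real l))" using \<open>0 < l\<close> by simp
  ultimately show ?thesis
    unfolding X_def by (rule less_le_trans[rotated])
qed

section \<open>Control of a product by rotations\<close>

text \<open>The squares of the first $N$ powers of $e^{i\alpha}$ come $\delta$-close to every point of the unit
  circle. Squares occur because a rotation by an angle of the plane turns the hyperbolic plane by
  twice that angle.\<close>
definition dense_rotation :: "nat \<Rightarrow> real \<Rightarrow> real \<Rightarrow> bool" where
  "dense_rotation N \<delta> \<alpha> \<longleftrightarrow>
     (\<forall>u. cmod u = 1 \<longrightarrow> (\<exists>m<N. cmod (cis (2 * (real m * \<alpha>)) - u) \<le> \<delta>))"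

lemma dense_rotation_uminus:
  assumes "dense_rotation N \<delta> \<alpha>"
  shows "dense_rotation N \<delta> (- \<alpha>)"
  unfolding dense_rotation_def
proof (intro allI impI)
  fix u :: complex assume "cmod u = 1"
  then have "cmod (cnj u) = 1" by simp
  then obtain m where m: "m < N" "cmod (cis (2 * (real m * \<alpha>)) - cnj u) \<le> \<delta>"
    using assms unfolding dense_rotation_def by blast
  have "cis (2 * (real m * - \<alpha>)) - u = cnj (cis (2 * (real m * \<alpha>)) - cnj u)"
    by (simp add: cis_cnj)
  then have "cmod (cis (2 * (real m * - \<alpha>)) - u) \<le> \<delta>"
    using m(2) by (simp only: complex_mod_cnj)
  then show "\<exists>m<N. cmod (cis (2 * (real m * - \<alpha>)) - u) \<le> \<delta>" using m(1) by blast
qed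

lemma opposing_unit:
  fixes x y :: complex
  obtains u where "cmod u = 1" "cmod (u * x + y) = \<bar>cmod x - cmod y\<bar>"
proof -
  define x' where "x' = (if x = 0 then 1 else sgn x)"
  define y' where "y' = (if y = 0 then 1 else sgn y)"
  have x': "cmod x' = 1" by (simp add: x'_def norm_sgn)
  have y': "cmod y' = 1" by (simp add: y'_def norm_sgn)
  have x: "x = of_real (cmod x) * x'" by (simp add: x'_def sgn_eq)
  have y: "y = of_real (cmod y) * y'" by (simp add: y'_def sgn_eq)
  have c: "cnj x' * x' = 1" using x' complex_norm_square[of x'] by (simp add: mult.commute)
  have "- (y' * cnj x') * x = - (of_real (cmod x) * y' * (cnj x' * x'))"
    by (subst x) (simp only: mult_minus_left mult_minus_right mult_ac)
  then have "- (y' * cnj x') * x + y = of_real (cmod y - cmod x) * y'"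
    by (subst y) (simp add: c left_diff_distrib)
  then have "cmod (- (y' * cnj x') * x + y) = cmod (of_real (cmod y - cmod x) * y')"
    by (rule arg_cong)
  then have "cmod (- (y' * cnj x') * x + y) = \<bar>cmod x - cmod y\<bar>"
    by (simp only: norm_mult norm_of_real y' mult_1_right abs_minus_commute)
  moreover have "cmod (- (y' * cnj x')) = 1" using x' y' by (simp add: norm_mult)
  ultimately show thesis using that by blast
qed

text \<open>The value $\rho = 2 (C + 1)$ is chosen so that both losses are covered: $d$ is less than $c$ by a factor
  bounded away from 1 in terms of $C$, and the rotation is only $1/\rho$-close to the optimal one. The
  left side increases with $a$, so that it is enough to take $a = \rho$.\<close>
lemma control_inequality:
  fixes a c d C :: real
  assumes c: "c\<^sup>2 = 1 + d\<^sup>2" "0 \<le> d" "0 \<le> c" "c \<le> C" and a: "a \<le> 2 * (C + 1)"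
  shows "c * a - (1 - 1 / (2 * (C + 1))) * (d * (a - 1)) \<le> 2 * (C + 1)"
proof -
  define \<rho> where "\<rho> = 2 * (C + 1)"
  have dc: "d \<le> c" by (rule power2_le_imp_le) (use c in simp_all)
  have rho: "2 \<le> \<rho>" using c by (simp add: \<rho>_def)
  define \<kappa> where "\<kappa> = 1 - 1 / \<rho>"
  have "\<kappa> * d \<le> 1 * d" using c(2) rho by (intro mult_right_mono) (auto simp: \<kappa>_def)
  then have "a * (c - \<kappa> * d) \<le> \<rho> * (c - \<kappa> * d)"
    using a dc by (intro mult_right_mono) (auto simp: \<rho>_def)
  then have "c * a - \<kappa> * (d * (a - 1)) \<le> \<rho> * c - \<kappa> * (\<rho> - 1) * d"
    by (simp add: algebra_simps)
  also have "\<dots> \<le> \<rho>"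
  proof -
    have "c * (2 * \<rho> - 1) \<le> C * (2 * \<rho> - 1)" using c(4) rho by (intro mult_right_mono) auto
    also have "C * (2 * \<rho> - 1) = (\<rho> - 1)\<^sup>2 - C - 1"
      by (simp add: \<rho>_def power2_eq_square algebra_simps)
    finally have "c * (2 * \<rho> - 1) \<le> (\<rho> - 1)\<^sup>2" using c(3,4) by linarith
    moreover have "\<rho>\<^sup>2 * c = c * (\<rho> - 1)\<^sup>2 + c * (2 * \<rho> - 1)"
      by (simp add: power2_eq_square algebra_simps)
    moreover have "(c + 1) * (\<rho> - 1)\<^sup>2 = c * (\<rho> - 1)\<^sup>2 + (\<rho> - 1)\<^sup>2"
      by (simp add: distrib_right)
    ultimately have 1: "\<rho>\<^sup>2 * c \<le> (c + 1) * (\<rho> - 1)\<^sup>2" by linarith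
    have "\<rho>\<^sup>2 * d \<le> \<rho>\<^sup>2 * c" using dc by (rule mult_left_mono) simp
    then have "\<rho>\<^sup>2 * d * d \<le> (c + 1) * (\<rho> - 1)\<^sup>2 * d"
      using 1 by (intro mult_right_mono[OF _ c(2)]) linarith
    moreover have "(c + 1) * (\<rho>\<^sup>2 * (c - 1)) = \<rho>\<^sup>2 * (c\<^sup>2 - 1)"
      by (simp add: power2_eq_square algebra_simps)
    moreover have "\<rho>\<^sup>2 * (c\<^sup>2 - 1) = \<rho>\<^sup>2 * d * d"
      unfolding c(1) by (simp add: power2_eq_square)
    moreover have "(c + 1) * (\<rho> - 1)\<^sup>2 * d = (c + 1) * ((\<rho> - 1)\<^sup>2 * d)"
      by (rule mult.assoc)
    ultimately have "(c + 1) * (\<rho>\<^sup>2 * (c - 1)) \<le> (c + 1) * ((\<rho> - 1)\<^sup>2 * d)"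
      by linarith
    then have 2: "\<rho>\<^sup>2 * (c - 1) \<le> (\<rho> - 1)\<^sup>2 * d"
      by (rule mult_left_le_imp_le) (use c(3) in linarith)
    have "1 / \<rho> * \<rho> = 1" using rho by simp
    then have kr: "\<kappa> * \<rho> = \<rho> - 1" unfolding \<kappa>_def left_diff_distrib by simp
    have "\<rho> * (\<rho> * (c - 1)) = \<rho>\<^sup>2 * (c - 1)"
      by (simp only: power2_eq_square mult.assoc)
    moreover have "\<rho> * (\<kappa> * (\<rho> - 1) * d) = (\<kappa> * \<rho>) * (\<rho> - 1) * d"
      by (simp only: mult_ac)
    moreover have "(\<kappa> * \<rho>) * (\<rho> - 1) * d = (\<rho> - 1)\<^sup>2 * d"
      by (simp only: kr power2_eq_square)
    ultimately have "\<rho> * (\<rho> * (c - 1)) \<le> \<rho> * (\<kappa> * (\<rho> - 1) * d)"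
      using 2 by linarith
    then have "\<rho> * (c - 1) \<le> \<kappa> * (\<rho> - 1) * d"
      by (rule mult_left_le_imp_le) (use rho in linarith)
    moreover have "\<rho> * (c - 1) = \<rho> * c - \<rho>" by (simp add: right_diff_distrib)
    ultimately show ?thesis by linarith
  qed
  finally show ?thesis unfolding \<kappa>_def \<rho>_def .
qed

text \<open>The modulus of the holomorphic part is $\cosh$ of half the distance by which the matrix moves the base
  point of the hyperbolic plane. Turning the image of the base point under $P$ by the rotation makes the
  two terms in the holomorphic part of the product nearly opposite. This is the position from which $B$
  does not move a point within the bound beyond it, by \<open>control_inequality\<close>.\<close>
lemma control_step:
  assumes B: "B \<in> SL2" "cmod (hol B) \<le> C" and P: "P \<in> SL2" "cmod (hol P) \<le> 2 * (C + 1)"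
    and dense: "\<And>u. cmod u = 1 \<Longrightarrow> \<exists>m\<in>S. cmod (cis (2 * (real m * \<alpha>)) - u) \<le> 1 / (2 * (C + 1))"
  shows "\<exists>m\<in>S. cmod (hol (B ** (rot (real m * \<alpha>) ** P))) \<le> 2 * (C + 1)"
proof -
  let ?x = "hol B * hol P" and ?y = "ahol B * cnj (ahol P)"
  obtain u where u: "cmod u = 1" "cmod (u * ?x + ?y) = \<bar>cmod ?x - cmod ?y\<bar>"
    by (rule opposing_unit)
  obtain m where m: "m \<in> S" "cmod (cis (2 * (real m * \<alpha>)) - u) \<le> 1 / (2 * (C + 1))"
    using dense[OF u(1)] by blast
  define t where "t = real m * \<alpha>"
  have tt: "cis t * cis t = cis (2 * t)" by (simp add: cis_mult)
  have ct: "cis t * cnj (cis t) = 1" by (simp add: cis_cnj cis_mult)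
  have "hol (B ** (rot t ** P)) = hol B * (cis t * hol P) + ahol B * cnj (cis t * ahol P)"
    by (simp add: hol_mult ahol_mult)
  then have "cis t * hol (B ** (rot t ** P)) = (cis t * cis t) * ?x + (cis t * cnj (cis t)) * ?y"
    by (simp add: algebra_simps)
  then have "cis t * hol (B ** (rot t ** P)) = cis (2 * t) * ?x + ?y"
    unfolding tt ct by simp
  then have "cmod (cis t * hol (B ** (rot t ** P))) = cmod (cis (2 * t) * ?x + ?y)"
    by (rule arg_cong)
  then have e: "cmod (hol (B ** (rot t ** P))) = cmod (cis (2 * t) * ?x + ?y)"
    by (simp only: norm_mult norm_cis mult_1_left)
  have "u * cnj (cis (2 * t)) * (cis (2 * t) * ?x + ?y)
      = (cis (2 * t) * cnj (cis (2 * t))) * (u * ?x) + ?y + (u * cnj (cis (2 * t)) - 1) * ?y"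
    by (simp add: algebra_simps)
  also have "cis (2 * t) * cnj (cis (2 * t)) = 1" by (simp add: cis_cnj cis_mult)
  finally have "cmod (u * cnj (cis (2 * t)) * (cis (2 * t) * ?x + ?y))
      = cmod (u * ?x + ?y + (u * cnj (cis (2 * t)) - 1) * ?y)" by simp
  then have "cmod (cis (2 * t) * ?x + ?y) = cmod (u * ?x + ?y + (u * cnj (cis (2 * t)) - 1) * ?y)"
    by (simp only: norm_mult complex_mod_cnj norm_cis u(1) mult_1_left)
  also have "\<dots> \<le> \<bar>cmod ?x - cmod ?y\<bar> + cmod (u * cnj (cis (2 * t)) - 1) * cmod ?y"
    using norm_triangle_ineq[of "u * ?x + ?y" "(u * cnj (cis (2 * t)) - 1) * ?y"]
    by (simp only: u(2) norm_mult)
  also have "u * cnj (cis (2 * t)) - 1 = - (cnj (cis (2 * t)) * (cis (2 * t) - u))"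
    by (simp add: algebra_simps cis_cnj cis_mult)
  also have "cmod \<dots> = cmod (cis (2 * t) - u)"
    by (simp only: norm_minus_cancel norm_mult complex_mod_cnj norm_cis mult_1_left)
  finally have bound: "cmod (hol (B ** (rot t ** P)))
      \<le> \<bar>cmod ?x - cmod ?y\<bar> + cmod (cis (2 * t) - u) * cmod ?y"
    unfolding e .
  define a b c d where "a = cmod (hol P)" and "b = cmod (ahol P)" and "c = cmod (hol B)" and "d = cmod (ahol B)"
  have cd: "c\<^sup>2 = 1 + d\<^sup>2" "d \<le> c" "0 \<le> d" "1 \<le> c"
    using B(1) SL2_ahol_le_hol[OF B(1)] SL2_one_le_hol[OF B(1)] unfolding SL2_hol by (simp_all add: c_def d_def)
  have ab: "a\<^sup>2 = 1 + b\<^sup>2" "b \<le> a" "0 \<le> b" "1 \<le> a"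
    using P(1) SL2_ahol_le_hol[OF P(1)] SL2_one_le_hol[OF P(1)] unfolding SL2_hol by (simp_all add: a_def b_def)
  have "a - 1 \<le> b"
  proof (rule power2_le_imp_le)
    show "(a - 1)\<^sup>2 \<le> b\<^sup>2" using ab by (simp add: power2_diff)
  qed (rule ab)
  have xy: "cmod ?x = c * a" "cmod ?y = d * b" by (simp_all add: norm_mult a_def b_def c_def d_def)
  have "d * b \<le> c * a" using cd ab by (intro mult_mono) auto
  then have "cmod (hol (B ** (rot t ** P))) \<le> c * a - d * b + cmod (cis (2 * t) - u) * (d * b)"
    using bound unfolding xy by simp
  also have "\<dots> \<le> c * a - d * b + 1 / (2 * (C + 1)) * (d * b)"
    using m(2) cd ab unfolding t_def by (intro add_left_mono mult_right_mono) auto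
  also have "\<dots> = c * a - (1 - 1 / (2 * (C + 1))) * (d * b)"
    by (simp only: left_diff_distrib mult_1_left)
  also have "\<dots> \<le> c * a - (1 - 1 / (2 * (C + 1))) * (d * (a - 1))"
    using \<open>a - 1 \<le> b\<close> cd B(2) by (intro diff_left_mono mult_left_mono) (auto simp: c_def)
  also have "\<dots> \<le> 2 * (C + 1)"
    using cd B(2) P(2) by (intro control_inequality) (auto simp: c_def a_def)
  finally show ?thesis using m(1) unfolding t_def by blast
qed

definition block :: "nat list \<Rightarrow> nat \<Rightarrow> nat \<Rightarrow> nat list" where
  "block w i m = concat (replicate m w) @ [i]"

lemma rot_add: "rot s ** rot t = rot (s + t)"
  by (rule matrix_eqI_hol) (simp_all add: hol_mult ahol_mult cis_mult)

lemma word_mat_power: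
  assumes "word_mat A w = rot \<alpha>"
  shows "word_mat A (concat (replicate m w)) = rot (real m * \<alpha>)"
proof (induction m)
  case 0
  show ?case by (rule matrix_eqI_hol) simp_all
next
  case (Suc m)
  then show ?case by (simp add: word_mat_append assms rot_add algebra_simps)
qed

lemma length_block: "length (block w i m) = m * length w + 1"
  by (simp add: block_def length_concat sum_list_replicate)

lemma block_nth_eq: "block w i m ! (m * length w) = i"
  by (simp add: block_def nth_append length_concat sum_list_replicate)

text \<open>With \<open>block_nth_eq\<close> this shows that blocks with different numbers of repetitions are not prefixes of
  each other when \<open>i\<close> differs from the first letter of \<open>w\<close>: after the smaller number of repetitions
  one block has \<open>i\<close> and the other starts \<open>w\<close> again.\<close>
lemma block_nth_less:
  assumes "w \<noteq> []" "m < m'"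
  shows "block w i m' ! (m * length w) = hd w"
proof -
  obtain j where "m' = m + Suc j"
    using assms(2) less_iff_Suc_add[of m m'] by auto
  then have "concat (replicate m' w) = concat (replicate m w) @ w @ concat (replicate j w)"
    by (simp only: replicate_add concat_append replicate_Suc concat.simps)
  then show ?thesis
    using assms(1) by (simp add: block_def nth_append length_concat sum_list_replicate hd_conv_nth)
qed

section \<open>Many sequences with bounded products\<close>

text \<open>The infinite sequence can be read off from a finite prefix, because each block is nonempty and the
  first $n + 1$ blocks together have more than $n$ letters.\<close>
lemma infinite_concatenation:
  fixes path :: "nat \<Rightarrow> 'a list"
  assumes path0: "path 0 = []" and pathS: "\<And>q. path (Suc q) = path q @ bl q"
    and ne: "\<And>q. bl q \<noteq> []" and len: "\<And>q. length (bl q) \<le> l"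
  defines "\<xi> \<equiv> (\<lambda>n. path (Suc n) ! n)"
  shows "q \<le> length (path q)" "length (path q) \<le> q * l"
    "map \<xi> [0..<length (path q)] = path q"
    "\<exists>q r. n = length (path q) + r \<and> r \<le> l"
    "i < length (path q) \<Longrightarrow> \<xi> i = path q ! i"
proof -
  show le: "q \<le> length (path q)" for q
  proof (induction q)
    case (Suc q)
    have "0 < length (bl q)" using ne[of q] by simp
    then show ?case using Suc unfolding pathS length_append by linarith
  qed simp
  show "length (path q) \<le> q * l"
  proof (induction q)
    case (Suc q)
    then show ?case using len[of q] by (simp add: pathS)
  qed (simp add: path0)
  have prefix: "path (q + d) ! i = path q ! i" if "i < length (path q)" for q d i
  proof (induction d)
    case (Suc d)
    have "length (path q) \<le> length (path (q + d))"
      by (induction d) (simp_all add: pathS)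
    then have "i < length (path (q + d))" using that by linarith
    then show ?case using Suc by (simp add: pathS nth_append)
  qed simp
  show nth: "\<xi> i = path q ! i" if "i < length (path q)" for i q
  proof (cases "q \<le> Suc i")
    case True
    then show ?thesis using prefix[OF that, of "Suc i - q"] by (simp add: \<xi>_def)
  next
    case False
    have "i < length (path (Suc i))" using le[of "Suc i"] by linarith
    then show ?thesis using prefix[of i "Suc i" "q - Suc i"] False by (simp add: \<xi>_def)
  qed
  show "map \<xi> [0..<length (path q)] = path q"
    by (rule nth_equalityI) (simp_all add: nth)
  have "\<exists>q. length (path q) \<le> n \<and> n < length (path (Suc q))"
  proof (induction n)
    case 0
    have "0 < length (bl 0)" using ne[of 0] by simp
    then show ?case by (intro exI[of _ 0]) (simp add: pathS path0)
  next
    case (Suc n)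
    then obtain q where q: "length (path q) \<le> n" "n < length (path (Suc q))" by blast
    show ?case
    proof (cases "Suc n < length (path (Suc q))")
      case True
      then show ?thesis using q by (intro exI[of _ q]) simp
    next
      case False
      have "0 < length (bl (Suc q))" using ne[of "Suc q"] by simp
      then have "length (path (Suc q)) < length (path (Suc (Suc q)))" by (simp add: pathS)
      then show ?thesis using q False by (intro exI[of _ "Suc q"]) linarith
    qed
  qed
  then obtain q where q: "length (path q) \<le> n" "n < length (path (Suc q))" by blast
  have "n - length (path q) \<le> l" using q(2) len[of q] unfolding pathS length_append by linarith
  then show "\<exists>q r. n = length (path q) + r \<and> r \<le> l"
    using q(1) by (intro exI[of _ q] exI[of _ "n - length (path q)"]) simp
qed

text \<open>The blocks are chosen one after the other so that the size of the product stays at most $\rho$ at the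
  end of each block. A binary sequence \<open>c\<close> selects for each block which of two disjoint sets the number
  of repetitions is taken from. Both sets satisfy the density condition, since one is a translate of
  the other and translation acts as a rotation of the circle.\<close>
lemma controlled_sequences:
  assumes A: "\<And>x. x \<in> set w \<union> {i} \<Longrightarrow> A x \<in> SL2" and w: "w \<noteq> []" "word_mat A w = rot \<alpha>"
    and C: "cmod (hol (A i)) \<le> C"
    and dense: "dense_rotation N (1 / (2 * (C + 1))) \<alpha>"
  shows "\<exists>(\<xi> :: (nat \<Rightarrow> bool) \<Rightarrow> nat \<Rightarrow> nat) (D :: real) (l :: nat).
     0 < l \<and> (\<forall>c n. \<xi> c n \<in> set w \<union> {i}) \<and> (\<forall>c n. mnorm (word_mat A (map (\<xi> c) [0..<n])) \<le> D) \<and>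
     (i \<noteq> hd w \<longrightarrow> (\<forall>c c' q r. r < q \<longrightarrow> c r \<noteq> c' r \<longrightarrow>
        map (\<xi> c) [0..<q * l] \<noteq> map (\<xi> c') [0..<q * l]))"
proof -
  \<comment> \<open>disjoint sets, so that blocks for different choices have different numbers of repetitions\<close>
  define S where "S b = (if b then {N..<2 * N} else {..<N})" for b
  have S_dense: "\<exists>m\<in>S b. cmod (cis (2 * (real m * \<alpha>)) - u) \<le> 1 / (2 * (C + 1))" if u: "cmod u = 1" for u b
  proof (cases b)
    case True
    define v where "v = cis (2 * (real N * \<alpha>))"
    have vv: "v * cnj v = 1" by (simp add: v_def cis_cnj cis_mult)
    have v1: "cmod v = 1" by (simp add: v_def)
    have "cmod (cnj v * u) = 1" using u v1 by (simp only: norm_mult complex_mod_cnj mult_1_left)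
    then obtain m where m: "m < N" "cmod (cis (2 * (real m * \<alpha>)) - cnj v * u) \<le> 1 / (2 * (C + 1))"
      using dense unfolding dense_rotation_def by blast
    have "cis (2 * (real (N + m) * \<alpha>)) = v * cis (2 * (real m * \<alpha>))"
      by (simp add: v_def cis_mult algebra_simps)
    moreover have "u = v * (cnj v * u)" using vv by (simp flip: mult.assoc)
    ultimately have "cis (2 * (real (N + m) * \<alpha>)) - u = v * (cis (2 * (real m * \<alpha>)) - cnj v * u)"
      by (simp only: right_diff_distrib)
    then have "cmod (cis (2 * (real (N + m) * \<alpha>)) - u) = cmod (v * (cis (2 * (real m * \<alpha>)) - cnj v * u))"
      by (rule arg_cong)
    then have "cmod (cis (2 * (real (N + m) * \<alpha>)) - u) \<le> 1 / (2 * (C + 1))"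
      using m(2) v1 by (simp only: norm_mult mult_1_left)
    then show ?thesis using m(1) True unfolding S_def by (intro bexI[of _ "N + m"]) auto
  next
    case False
    then show ?thesis using dense u unfolding dense_rotation_def S_def by auto
  qed
  let ?\<rho> = "2 * (C + 1)"
  define good where "good M \<longleftrightarrow> cmod (hol M) \<le> ?\<rho>" for M
  have "\<exists>m\<in>S b. good (word_mat A L) \<longrightarrow> set L \<subseteq> set w \<union> {i} \<longrightarrow> good (word_mat A (L @ block w i m))" for L b
  proof (cases "good (word_mat A L) \<and> set L \<subseteq> set w \<union> {i}")
    case True
    have "word_mat A L \<in> SL2" by (rule word_mat_SL2) (use True A in blast)
    then obtain m where m: "m \<in> S b" "cmod (hol (A i ** (rot (real m * \<alpha>) ** word_mat A L))) \<le> ?\<rho>"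
      using control_step[of "A i" C "word_mat A L" "S b" \<alpha>] A C True S_dense unfolding good_def by blast
    have "word_mat A (L @ block w i m) = A i ** (rot (real m * \<alpha>) ** word_mat A L)"
      by (simp add: block_def word_mat_append word_mat_power[OF w(2)] matrix_mul_assoc)
    then have "good (word_mat A (L @ block w i m))" using m(2) by (simp only: good_def)
    then show ?thesis using m(1) by blast
  next
    case False
    then show ?thesis using S_dense[of 1 b] by auto
  qed
  then obtain f where f: "\<And>b L. f b L \<in> S b"
    "\<And>b L. good (word_mat A L) \<Longrightarrow> set L \<subseteq> set w \<union> {i} \<Longrightarrow> good (word_mat A (L @ block w i (f b L)))"
    by metis
  define path where "path c = rec_nat [] (\<lambda>q L. L @ block w i (f (c q) L))" for c :: "nat \<Rightarrow> bool"
  have path0: "path c 0 = []" for c by (simp add: path_def)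
  have pathS: "path c (Suc q) = path c q @ block w i (f (c q) (path c q))" for c q by (simp add: path_def)
  have block_letters: "set (block w i m) \<subseteq> set w \<union> {i}" for m
    by (auto simp: block_def)
  have path_letters: "set (path c q) \<subseteq> set w \<union> {i}" for c q
    by (induction q) (use block_letters in \<open>auto simp: path0 pathS\<close>)
  have "1 \<le> cmod (hol (A i))" by (rule SL2_one_le_hol) (use A in blast)
  then have C1: "1 \<le> C" using C by linarith
  have path_good: "good (word_mat A (path c q))" for c q
  proof (induction q)
    case 0
    then show ?case using C1 by (simp add: path0 good_def)
  next
    case (Suc q)
    then show ?case unfolding pathS by (rule f(2)[OF _ path_letters])
  qed
  define l where "l = 2 * N * length w + 1"
  have "f b L < 2 * N" for b L
    using f(1)[of b L] by (cases b) (auto simp: S_def)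
  then have "f b L * length w \<le> 2 * N * length w" for b L
    by (intro mult_right_mono) (auto intro: less_imp_le)
  then have block_len: "length (block w i (f b L)) \<le> l" for b L
    by (simp add: length_block l_def)
  have block_ne: "block w i m \<noteq> []" for m by (simp add: block_def)
  define \<xi> where "\<xi> c = (\<lambda>n. path c (Suc n) ! n)" for c
  have conc: "q \<le> length (path c q)" "length (path c q) \<le> q * l"
    "map (\<xi> c) [0..<length (path c q)] = path c q"
    "\<exists>q r. n = length (path c q) + r \<and> r \<le> l"
    "j < length (path c q) \<Longrightarrow> \<xi> c j = path c q ! j" for c q n j
  proof -
    note ic = infinite_concatenation[of "path c" "\<lambda>q. block w i (f (c q) (path c q))" l,
        OF path0 pathS block_ne block_len, folded \<xi>_def]
    show "q \<le> length (path c q)" "length (path c q) \<le> q * l"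
      "map (\<xi> c) [0..<length (path c q)] = path c q"
      "\<exists>q r. n = length (path c q) + r \<and> r \<le> l"
      by (rule ic)+
    show "\<xi> c j = path c q ! j" if "j < length (path c q)"
      using ic(5)[OF that] by (simp add: \<xi>_def)
  qed
  have letters: "\<xi> c n \<in> set w \<union> {i}" for c n
  proof -
    have "n < length (path c (Suc n))" using conc(1)[of "Suc n" c] by linarith
    then have "\<xi> c n \<in> set (path c (Suc n))" unfolding \<xi>_def by (rule nth_mem)
    then show ?thesis using path_letters by blast
  qed
  define L where "L = Max (insert 1 ((\<lambda>x. mnorm (A x)) ` (set w \<union> {i})))"
  have L: "mnorm (A x) \<le> L" if "x \<in> set w \<union> {i}" for x
    unfolding L_def using that by (intro Max_ge) auto
  have L1: "1 \<le> L" unfolding L_def by (intro Max_ge) auto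
  have bound: "mnorm (word_mat A (map (\<xi> c) [0..<n])) \<le> L ^ l * (2 * ?\<rho>)" for c n
  proof -
    obtain q r where qr: "n = length (path c q) + r" "r \<le> l" using conc(4) by blast
    let ?v = "map (\<xi> c) [length (path c q)..<length (path c q) + r]"
    have "map (\<xi> c) [0..<n] = path c q @ ?v"
      unfolding qr(1) using upt_add_eq_append[of 0 "length (path c q)" r] conc(3)[of c q] by simp
    then have "mnorm (word_mat A (map (\<xi> c) [0..<n])) \<le> mnorm (word_mat A ?v) * mnorm (word_mat A (path c q))"
      by (simp only: word_mat_append mnorm_mult)
    also have "\<dots> \<le> L ^ l * (2 * ?\<rho>)"
    proof (rule mult_mono)
      have "mnorm (word_mat A ?v) \<le> L ^ length ?v"
        by (rule mnorm_word_mat_le) (use A L letters in auto)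
      also have "\<dots> \<le> L ^ l" using qr(2) L1 by (intro power_increasing) auto
      finally show "mnorm (word_mat A ?v) \<le> L ^ l" .
      have "word_mat A (path c q) \<in> SL2" by (rule word_mat_SL2) (use A path_letters in blast)
      then show "mnorm (word_mat A (path c q)) \<le> 2 * ?\<rho>"
        using SL2_mnorm_le[of "word_mat A (path c q)"] path_good[of c q] unfolding good_def by linarith
    qed (use L1 in \<open>auto simp: mnorm_nonneg\<close>)
    finally show ?thesis .
  qed
  have distinct: "map (\<xi> c) [0..<q * l] \<noteq> map (\<xi> c') [0..<q * l]"
    if i: "i \<noteq> hd w" and "r < q" "c r \<noteq> c' r" for c c' q r
  proof -
    \<comment> \<open>the states agree up to the first difference of the choices, where the blocks differ\<close>
    define r0 where "r0 = (LEAST r. c r \<noteq> c' r)"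
    have r0: "c r0 \<noteq> c' r0" unfolding r0_def using that(3) by (rule LeastI)
    have "r0 \<le> r" unfolding r0_def using that(3) by (rule Least_le)
    then have "Suc r0 * l \<le> q * l" using that(2) by (intro mult_right_mono) auto
    have agree: "c s = c' s" if "s < r0" for s using not_less_Least that unfolding r0_def by blast
    have same: "path c s = path c' s" if "s \<le> r0" for s
      using that by (induction s) (simp_all add: path0 pathS agree)
    have differ: "\<exists>p < q * l. \<xi> d p \<noteq> \<xi> d' p"
      if "path d r0 = path d' r0" "f (d r0) (path d r0) < f (d' r0) (path d' r0)" for d d'
    proof -
      let ?P = "path d r0" and ?m = "f (d r0) (path d r0)" and ?m' = "f (d' r0) (path d' r0)"
      define p where "p = length ?P + ?m * length w"
      have S1: "path d (Suc r0) = ?P @ block w i ?m" "path d' (Suc r0) = ?P @ block w i ?m'"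
        by (simp_all only: pathS that(1))
      have len: "p < length (path d (Suc r0))" unfolding S1 by (simp add: p_def length_block)
      have "?m * length w < ?m' * length w" using that(2) w(1) by simp
      then have len': "p < length (path d' (Suc r0))" unfolding S1 p_def length_append length_block by linarith
      have "\<xi> d p = i" using conc(5)[OF len] unfolding S1 by (simp add: p_def nth_append block_nth_eq)
      moreover have "\<xi> d' p = hd w"
        using conc(5)[OF len'] block_nth_less[OF w(1) that(2), of i] unfolding S1 by (simp add: p_def nth_append)
      moreover have "p < q * l"
        using len conc(2)[of d "Suc r0"] \<open>Suc r0 * l \<le> q * l\<close> by linarith
      ultimately show ?thesis using i by (intro exI[of _ p]) simp
    qed
    have "f (c r0) (path c r0) \<noteq> f (c' r0) (path c' r0)"
      using f(1)[of "c r0" "path c r0"] f(1)[of "c' r0" "path c' r0"] r0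
      by (cases "c r0"; cases "c' r0") (auto simp: S_def)
    then consider "f (c r0) (path c r0) < f (c' r0) (path c' r0)" | "f (c' r0) (path c' r0) < f (c r0) (path c r0)"
      by linarith
    then obtain p where "p < q * l" "\<xi> c p \<noteq> \<xi> c' p"
    proof cases
      case 1
      then show thesis using differ[OF same] that by blast
    next
      case 2
      then show thesis using differ[OF same[symmetric]] that by (metis order_refl)
    qed
    then show ?thesis by auto
  qed
  show ?thesis
    using letters bound distinct
    by (intro exI[of _ \<xi>] exI[of _ "L ^ l * (2 * ?\<rho>)"] exI[of _ l] conjI allI impI) (simp_all add: l_def)
qed


text \<open>The second alternative of the theorem.\<close>
definition bounded_positive_entropy :: "nat \<Rightarrow> (nat \<Rightarrow> real^2^2) \<Rightarrow> bool" where
  "bounded_positive_entropy k A \<longleftrightarrow>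
     (\<exists>K. compactin (shift_space k) K \<and> shift ` K = K \<and>
        topological_entropy (subtopology (shift_space k) K) shift > 0 \<and>
        (\<exists>C. \<forall>\<omega> \<in> K. \<forall>n::int. op_norm (cocycle A n \<omega>) \<le> C))"

lemma window_add: "window \<omega> j (m + n) = window \<omega> j m @ window \<omega> (j + int m) n"
  by (rule nth_equalityI) (auto simp: window_def nth_append of_nat_diff)

text \<open>A window to the right of the origin is a quotient of two prefixes, one to the left is a quotient of two
  suffixes of the past, and one that contains the origin is a product of a prefix and a suffix. Inverses
  do not change the norm in $\mathrm{SL}(2,\mathbb{R})$.\<close>
lemma all_windows_bounded:
  assumes A: "\<And>i. A (\<omega> i) \<in> SL2"
    and right: "\<And>n. mnorm (word_mat A (window \<omega> 0 n)) \<le> D"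
    and left: "\<And>n. mnorm (word_mat A (window \<omega> (- int n) n)) \<le> D"
  shows "mnorm (word_mat A (window \<omega> j n)) \<le> D * D"
proof -
  have SL: "word_mat A (window \<omega> j n) \<in> SL2" for j n
    by (rule word_mat_SL2) (use A in \<open>auto simp: window_def\<close>)
  have D: "0 \<le> D" using mnorm_nonneg right order_trans by blast
  have bound: "mnorm (M ** N) \<le> D * D" if "mnorm M \<le> D" "mnorm N \<le> D" for M N
    by (rule order_trans[OF mnorm_mult]) (intro mult_mono that D mnorm_nonneg)
  consider "0 \<le> j" | "j \<le> 0" "0 \<le> j + int n" | "j + int n \<le> 0" by linarith
  then show ?thesis
  proof cases
    case 1
    let ?W = "word_mat A (window \<omega> 0 (nat j))"
    have "word_mat A (window \<omega> 0 (nat j + n)) = word_mat A (window \<omega> j n) ** ?W"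
      using 1 by (simp add: window_add word_mat_append)
    then have "word_mat A (window \<omega> j n) = word_mat A (window \<omega> 0 (nat j + n)) ** matrix_inv ?W"
      by (simp add: SL2_matrix_inv[OF SL] flip: matrix_mul_assoc)
    then show ?thesis
      using bound[OF right, of "matrix_inv ?W" "nat j + n"] right[of "nat j"]
      by (simp add: SL2_matrix_inv[OF SL])
  next
    case 2
    have "n = nat (- j) + nat (j + int n)" using 2 by linarith
    then have "word_mat A (window \<omega> j n) = word_mat A (window \<omega> j (nat (- j) + nat (j + int n)))"
      by simp
    also have "\<dots> = word_mat A (window \<omega> 0 (nat (j + int n))) ** word_mat A (window \<omega> (- int (nat (- j))) (nat (- j)))"
      using 2 by (simp only: window_add word_mat_append) simp
    finally show ?thesis by (simp only: bound[OF right left])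
  next
    case 3
    let ?W = "word_mat A (window \<omega> (j + int n) (nat (- j - int n)))"
    have "nat (- j) = n + nat (- j - int n)" using 3 by linarith
    then have "word_mat A (window \<omega> j (nat (- j))) = ?W ** word_mat A (window \<omega> j n)"
      by (simp add: window_add word_mat_append)
    then have "word_mat A (window \<omega> j n) = matrix_inv ?W ** word_mat A (window \<omega> j (nat (- j)))"
      by (simp add: SL2_matrix_inv[OF SL] matrix_mul_assoc)
    moreover have "mnorm (matrix_inv ?W) \<le> D"
      using left[of "nat (- j - int n)"] 3 by (simp add: SL2_matrix_inv[OF SL] add.commute)
    moreover have "mnorm (word_mat A (window \<omega> j (nat (- j)))) \<le> D"
      using left[of "nat (- j)"] 3 by simp
    ultimately show ?thesis using bound by simp
  qed
qed

lemma word_mat_conjugate: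
  assumes G: "G \<in> SL2"
  shows "word_mat (\<lambda>x. matrix_inv G ** A x ** G) w = matrix_inv G ** word_mat A w ** G"
proof (induction w)
  case Nil
  then show ?case by (simp add: SL2_matrix_inv[OF G])
next
  case (Cons x w)
  have "(matrix_inv G ** word_mat A w ** G) ** (matrix_inv G ** A x ** G)
      = matrix_inv G ** word_mat A w ** (G ** matrix_inv G) ** A x ** G"
    by (simp only: matrix_mul_assoc)
  then show ?case using Cons by (simp add: SL2_matrix_inv[OF G] matrix_mul_assoc)
qed

text \<open>The right halves of the sequences come from \<open>controlled_sequences\<close> and carry the free choices. The
  left half is a single sequence, obtained from the same lemma for the inverse matrices and the reversed
  word, whose product is the rotation by the opposite angle.\<close>
proposition elliptic_control:
  assumes A: "\<And>x. x \<in> {1..k} \<Longrightarrow> A x \<in> SL2"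
    and w: "w \<noteq> []" "set w \<subseteq> {1..k}" and i: "i \<in> {1..k}" "i \<noteq> hd w"
    and G: "G \<in> SL2" "matrix_inv G ** word_mat A w ** G = rot \<alpha>"
    and C: "cmod (hol (matrix_inv G ** A i ** G)) \<le> C"
    and dense: "dense_rotation N (1 / (2 * (C + 1))) \<alpha>"
  shows "bounded_positive_entropy k A"
proof -
  define B where "B x = matrix_inv G ** A x ** G" for x
  have B: "B x \<in> SL2" if "x \<in> {1..k}" for x
    using A[OF that] G(1) SL2_matrix_inv(3) by (simp add: B_def SL2_mult)
  have letters: "set w \<union> {i} \<subseteq> {1..k}" using w(2) i(1) by blast
  have Bw: "word_mat B w = rot \<alpha>"
    using word_mat_conjugate[OF G(1), of A w] G(2) by (simp add: B_def[abs_def])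
  have B1: "B x \<in> SL2" if "x \<in> set w \<union> {i}" for x using B letters that by blast
  have B2: "cmod (hol (B i)) \<le> C" using C by (simp add: B_def)
  have "\<exists>(\<xi> :: (nat \<Rightarrow> bool) \<Rightarrow> nat \<Rightarrow> nat) (D :: real) (l :: nat).
     0 < l \<and> (\<forall>c n. \<xi> c n \<in> set w \<union> {i}) \<and> (\<forall>c n. mnorm (word_mat B (map (\<xi> c) [0..<n])) \<le> D) \<and>
     (i \<noteq> hd w \<longrightarrow> (\<forall>c c' q r. r < q \<longrightarrow> c r \<noteq> c' r \<longrightarrow>
        map (\<xi> c) [0..<q * l] \<noteq> map (\<xi> c') [0..<q * l]))"
    by (rule controlled_sequences[of w i B \<alpha> C N]) (fact B1 w(1) Bw B2 dense)+
  then obtain \<xi> :: "(nat \<Rightarrow> bool) \<Rightarrow> nat \<Rightarrow> nat" and D :: real and l :: nat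
    where \<xi>: "0 < l" "\<forall>c n. \<xi> c n \<in> set w \<union> {i}" "\<forall>c n. mnorm (word_mat B (map (\<xi> c) [0..<n])) \<le> D"
    "i \<noteq> hd w \<longrightarrow> (\<forall>c c' q r. r < q \<longrightarrow> c r \<noteq> c' r \<longrightarrow>
       map (\<xi> c) [0..<q * l] \<noteq> map (\<xi> c') [0..<q * l])"
    by (elim exE conjE)
  define B' where "B' x = matrix_inv (B x)" for x
  have B'1: "B' x \<in> SL2" if "x \<in> set (rev w) \<union> {i}" for x
  proof -
    have "B x \<in> SL2" using B letters that by auto
    then show ?thesis unfolding B'_def by (rule SL2_matrix_inv)
  qed
  have B'2: "cmod (hol (B' i)) \<le> C"
  proof -
    have "B i \<in> SL2" using B i(1) by blast
    then have "cmod (hol (B' i)) = cmod (hol (B i))" by (simp add: B'_def SL2_matrix_inv)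
    then show "cmod (hol (B' i)) \<le> C" using C by (simp add: B_def)
  qed
  have B'w: "word_mat B' (rev w) = rot (- \<alpha>)"
  proof -
    have "word_mat B' (rev w) = matrix_inv (rot \<alpha>)"
      unfolding B'_def[abs_def] Bw[symmetric] by (rule word_mat_inverse) (use B letters in blast)
    also have "\<dots> = rot (- \<alpha>)"
      by (rule matrix_eqI_hol) (simp_all add: SL2_matrix_inv cis_cnj)
    finally show "word_mat B' (rev w) = rot (- \<alpha>)" .
  qed
  have dense': "dense_rotation N (1 / (2 * (C + 1))) (- \<alpha>)"
    by (rule dense_rotation_uminus[OF dense])
  have w': "rev w \<noteq> []" using w by simp
  have "\<exists>(\<xi> :: (nat \<Rightarrow> bool) \<Rightarrow> nat \<Rightarrow> nat) (D :: real) (l :: nat).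
     0 < l \<and> (\<forall>c n. \<xi> c n \<in> set (rev w) \<union> {i}) \<and> (\<forall>c n. mnorm (word_mat B' (map (\<xi> c) [0..<n])) \<le> D) \<and>
     (i \<noteq> hd (rev w) \<longrightarrow> (\<forall>c c' q r. r < q \<longrightarrow> c r \<noteq> c' r \<longrightarrow>
        map (\<xi> c) [0..<q * l] \<noteq> map (\<xi> c') [0..<q * l]))"
    by (rule controlled_sequences[of "rev w" i B' "- \<alpha>" C N]) (fact B'1 w' B'w B'2 dense')+
  then obtain \<zeta> :: "(nat \<Rightarrow> bool) \<Rightarrow> nat \<Rightarrow> nat" and D' :: real
    where \<zeta>: "\<forall>c n. \<zeta> c n \<in> set (rev w) \<union> {i}" "\<forall>c n. mnorm (word_mat B' (map (\<zeta> c) [0..<n])) \<le> D'"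
    by (elim exE conjE)
  define \<omega> where "\<omega> c j = (if 0 \<le> j then \<xi> c (nat j) else \<zeta> (\<lambda>_. True) (nat (- 1 - j)))" for c :: "nat \<Rightarrow> bool" and j :: int
  have \<omega>k: "\<omega> c j \<in> {1..k}" for c j
  proof -
    have "\<omega> c j \<in> set w \<union> {i}"
      using \<xi>(2) \<zeta>(1) unfolding \<omega>_def set_rev by (cases "0 \<le> j") simp_all
    then show ?thesis using letters by blast
  qed
  have right: "window (\<omega> c) 0 n = map (\<xi> c) [0..<n]" for c n
    by (simp add: window_def \<omega>_def)
  have left: "window (\<omega> c) (- int n) n = rev (map (\<zeta> (\<lambda>_. True)) [0..<n])" for c n
    by (rule nth_equalityI) (auto simp: window_def \<omega>_def rev_nth nat_diff_distrib
        intro!: arg_cong[of _ _ "\<zeta> (\<lambda>_. True)"])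
  define E where "E = max D D'"
  have "mnorm (word_mat B (window (\<omega> c) j n)) \<le> E * E" for c j n
  proof (rule all_windows_bounded)
    show "B (\<omega> c i) \<in> SL2" for i using B \<omega>k by blast
    show "mnorm (word_mat B (window (\<omega> c) 0 n)) \<le> E" for n
      unfolding right E_def using spec[OF spec[OF \<xi>(3), of c], of n] by simp
    show "mnorm (word_mat B (window (\<omega> c) (- int n) n)) \<le> E" for n
    proof -
      let ?v = "window (\<omega> c) (- int n) n"
      have SL: "word_mat B ?v \<in> SL2" "\<And>x. x \<in> set ?v \<Longrightarrow> B x \<in> SL2"
        using B \<omega>k word_mat_SL2[of ?v B] by (auto simp: window_def)
      have "word_mat B' (map (\<zeta> (\<lambda>_. True)) [0..<n]) = matrix_inv (word_mat B ?v)"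
        using word_mat_inverse[of ?v B] SL(2) unfolding B'_def[abs_def] left by simp
      then show ?thesis
        using spec[OF spec[OF \<zeta>(2), of "\<lambda>_. True"], of n] SL(1) by (simp add: SL2_matrix_inv E_def)
    qed
  qed
  then have boundB: "mnorm (word_mat B (window (\<omega> c) j n)) \<le> E * E" for c j n .
  define F where "F = mnorm G * (E * E) * mnorm G"
  have bound: "mnorm (word_mat A v) \<le> F" if "mnorm (word_mat B v) \<le> E * E" for v
  proof -
    have "word_mat B v = matrix_inv G ** word_mat A v ** G"
      unfolding B_def[abs_def] by (rule word_mat_conjugate[OF G(1)])
    then have "G ** word_mat B v ** matrix_inv G
        = (G ** matrix_inv G) ** word_mat A v ** (G ** matrix_inv G)"
      by (simp only: matrix_mul_assoc)
    then have "word_mat A v = G ** word_mat B v ** matrix_inv G"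
      by (simp add: SL2_matrix_inv[OF G(1)])
    then have "mnorm (word_mat A v) \<le> mnorm (G ** word_mat B v) * mnorm (matrix_inv G)"
      by (simp only: mnorm_mult)
    also have "\<dots> \<le> mnorm G * (E * E) * mnorm G"
      unfolding SL2_matrix_inv(6)[OF G(1)]
      by (intro mult_right_mono mnorm_nonneg order_trans[OF mnorm_mult] mult_left_mono that)
    finally show ?thesis unfolding F_def .
  qed
  define K where "K = bounded_set k A F"
  have \<omega>K: "\<omega> c \<in> K" for c
    using \<omega>k bound[OF boundB] by (simp add: K_def bounded_set_def topspace_shift_space)
  have Ktop: "K \<subseteq> topspace (shift_space k)" by (auto simp: K_def bounded_set_def)
  have shiftK: "shift ` K = K" unfolding K_def by (rule shift_image_bounded_set)
  have "0 < topological_entropy (subtopology (shift_space k) K) shift"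
  proof (rule positive_entropy[OF Ktop _ \<xi>(1)])
    show "shift ` K \<subseteq> K" using shiftK by simp
    fix q
    define ch where "ch bs = (\<lambda>r. r < q \<and> bs ! r)" for bs :: "bool list"
    let ?T = "{bs :: bool list. length bs = q}"
    have "finite ((\<lambda>\<omega>. window \<omega> 0 (q * l)) ` K)"
      by (rule finite_windows[OF Ktop])
    moreover have "inj_on (\<lambda>bs. window (\<omega> (ch bs)) 0 (q * l)) ?T"
    proof (rule inj_onI, rule ccontr)
      fix bs bs' assume *: "bs \<in> ?T" "bs' \<in> ?T"
        "window (\<omega> (ch bs)) 0 (q * l) = window (\<omega> (ch bs')) 0 (q * l)" "bs \<noteq> bs'"
      have "\<not> (\<forall>r<q. bs ! r = bs' ! r)"
      proof
        assume "\<forall>r<q. bs ! r = bs' ! r"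
        then have "bs = bs'" using *(1,2) by (intro nth_equalityI) simp_all
        then show False using *(4) by contradiction
      qed
      then obtain r where "r < q" "bs ! r \<noteq> bs' ! r" by blast
      then show False
        using mp[OF \<xi>(4) i(2), rule_format, of r q "ch bs" "ch bs'"] *(3) unfolding right by (simp add: ch_def)
    qed
    moreover have "(\<lambda>bs. window (\<omega> (ch bs)) 0 (q * l)) ` ?T \<subseteq> (\<lambda>\<omega>. window \<omega> 0 (q * l)) ` K"
      using \<omega>K by blast
    ultimately have "card ?T \<le> card ((\<lambda>\<omega>. window \<omega> 0 (q * l)) ` K)"
      by (intro card_inj_on_le)
    moreover have "card ?T = 2 ^ q"
      using card_lists_length_eq[of "UNIV :: bool set" q] by simp
    ultimately show "2 ^ q \<le> card ((\<lambda>\<omega>. window \<omega> 0 (q * l)) ` K)" by simp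
  qed
  moreover have "compactin (shift_space k) K" unfolding K_def by (rule compactin_bounded_set)
  moreover have "\<forall>\<omega>\<in>K. \<forall>n. op_norm (cocycle A n \<omega>) \<le> F"
    unfolding K_def by (intro ballI allI op_norm_cocycle_le[where k = k] A)
  ultimately show ?thesis
    unfolding bounded_positive_entropy_def using shiftK by (intro exI[of _ K] conjI exI[of _ F])
qed

section \<open>Irrational rotations and elliptic matrices\<close>

lemma isCont_cis_linear: "isCont (\<lambda>x. cis (2 * (c * x))) a"
  unfolding cis_conv_exp by (intro continuous_intros)

lemma irrational_rotation_dense:
  assumes irr: "\<alpha> / pi \<notin> \<rat>" and \<delta>: "0 < \<delta>"
  shows "\<exists>N. \<forall>u. cmod u = 1 \<longrightarrow> (\<exists>m<N. cmod (cis (2 * (real m * \<alpha>)) - u) < \<delta>)"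
proof -
  define f where "f m = cis (2 * (real m * \<alpha>))" for m
  have near: "\<exists>m. cmod (f m - u) < \<delta>" if u: "cmod u = 1" for u
  proof -
    define \<beta> where "\<beta> = Arg u / (2 * pi)"
    have "u \<noteq> 0" using u by auto
    then have "u = cis (Arg u)" using cis_Arg[of u] u by (simp add: sgn_div_norm)
    then have \<beta>: "u = cis (2 * pi * \<beta>)" by (simp add: \<beta>_def)
    have "isCont (\<lambda>x. cis (2 * pi * x)) \<beta>"
      using isCont_cis_linear[of \<beta> pi] by (simp only: mult.assoc)
    then obtain e where e: "0 < e" "\<And>x. dist x \<beta> < e \<Longrightarrow> dist (cis (2 * pi * x)) (cis (2 * pi * \<beta>)) < \<delta>"
      using \<delta> unfolding continuous_at_eps_delta by metis
    obtain h k where hk: "k > 0" "\<bar>of_int k * (\<alpha> / pi) - of_int h - \<beta>\<bar> < e"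
      using sequence_of_fractional_parts_is_dense[OF irr e(1)] .
    have "2 * pi * (of_int k * (\<alpha> / pi) - of_int h) = 2 * (real (nat k) * \<alpha>) + 2 * pi * of_int (- h)"
      using hk(1) by (simp add: right_diff_distrib)
    moreover have "cis (2 * (real (nat k) * \<alpha>) + 2 * pi * of_int (- h)) = f (nat k) * cis (2 * pi * of_int (- h))"
      by (simp add: f_def cis_mult)
    moreover have "cis (2 * pi * of_int (- h)) = 1" by (rule cis_multiple_2pi) simp
    ultimately have "cis (2 * pi * (of_int k * (\<alpha> / pi) - of_int h)) = f (nat k)" by simp
    then show ?thesis
      using e(2)[of "of_int k * (\<alpha> / pi) - of_int h"] hk(2) unfolding \<beta>[symmetric] dist_norm by auto
  qed
  have "compact (sphere (0::complex) 1)" by simp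
  moreover have "sphere (0::complex) 1 \<subseteq> (\<Union>m\<in>UNIV. ball (f m) \<delta>)"
  proof
    fix u :: complex assume "u \<in> sphere 0 1"
    then obtain m where "cmod (f m - u) < \<delta>" using near[of u] by auto
    then show "u \<in> (\<Union>m\<in>UNIV. ball (f m) \<delta>)" by (auto simp: dist_norm)
  qed
  ultimately obtain I where I: "finite I" "sphere (0::complex) 1 \<subseteq> (\<Union>m\<in>I. ball (f m) \<delta>)"
    using compactE_image[of "sphere (0::complex) 1" UNIV "\<lambda>m. ball (f m) \<delta>"] by (metis open_ball)
  have "\<exists>m<Suc (Max I). cmod (f m - u) < \<delta>" if "cmod u = 1" for u
  proof -
    have "u \<in> (\<Union>m\<in>I. ball (f m) \<delta>)" by (rule subsetD[OF I(2)]) (simp add: that)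
    then obtain m where "m \<in> I" "cmod (f m - u) < \<delta>" by (auto simp: dist_norm)
    then show ?thesis using Max_ge[OF I(1)] by (intro exI[of _ m]) (simp add: less_Suc_eq_le)
  qed
  then show ?thesis unfolding f_def by blast
qed

text \<open>Density up to $\delta / 2$ at an irrational angle involves only finitely many powers, so it persists as
  density up to $\delta$ for nearby angles, rational ones included.\<close>
lemma dense_rotation_nearby:
  assumes irr: "\<alpha> / pi \<notin> \<rat>" and \<delta>: "0 < \<delta>"
  obtains N where "\<forall>\<^sub>F \<beta> in nhds \<alpha>. dense_rotation N \<delta> \<beta>"
proof -
  have "0 < \<delta> / 2" using \<delta> by simp
  then obtain N where N: "\<And>u. cmod u = 1 \<Longrightarrow> \<exists>m<N. cmod (cis (2 * (real m * \<alpha>)) - u) < \<delta> / 2"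
    using irrational_rotation_dense[OF irr] by blast
  have "\<forall>\<^sub>F \<beta> in nhds \<alpha>. \<forall>m\<in>{..<N}. dist (cis (2 * (real m * \<beta>))) (cis (2 * (real m * \<alpha>))) < \<delta> / 2"
  proof (rule eventually_ball_finite, simp, rule ballI)
    fix m
    obtain e where "0 < e" "\<And>x. dist x \<alpha> < e \<Longrightarrow> dist (cis (2 * (real m * x))) (cis (2 * (real m * \<alpha>))) < \<delta> / 2"
      using isCont_cis_linear[of \<alpha> "real m"] \<open>0 < \<delta> / 2\<close> unfolding continuous_at_eps_delta by metis
    then show "\<forall>\<^sub>F \<beta> in nhds \<alpha>. dist (cis (2 * (real m * \<beta>))) (cis (2 * (real m * \<alpha>))) < \<delta> / 2"
      unfolding eventually_nhds_metric by blast
  qed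
  then have "\<forall>\<^sub>F \<beta> in nhds \<alpha>. dense_rotation N \<delta> \<beta>"
  proof (rule eventually_mono)
    fix \<beta>
    assume *: "\<forall>m\<in>{..<N}. dist (cis (2 * (real m * \<beta>))) (cis (2 * (real m * \<alpha>))) < \<delta> / 2"
    show "dense_rotation N \<delta> \<beta>"
      unfolding dense_rotation_def
    proof (intro allI impI)
      fix u :: complex assume "cmod u = 1"
      then obtain m where m: "m < N" "cmod (cis (2 * (real m * \<alpha>)) - u) < \<delta> / 2" using N by blast
      have "dist (cis (2 * (real m * \<beta>))) u
          \<le> dist (cis (2 * (real m * \<beta>))) (cis (2 * (real m * \<alpha>))) + dist (cis (2 * (real m * \<alpha>))) u"
        by (rule dist_triangle)
      also have "\<dots> \<le> \<delta> / 2 + \<delta> / 2"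
        using * m by (intro add_mono) (auto simp: dist_norm intro: less_imp_le)
      finally show "\<exists>m<N. cmod (cis (2 * (real m * \<beta>)) - u) \<le> \<delta>"
        using m(1) by (intro exI[of _ m]) (simp add: dist_norm)
    qed
  qed
  then show thesis by (rule that)
qed

text \<open>With $b$ the antiholomorphic part of $M$, $y$ the imaginary part of its holomorphic part and
  $s = \sin \alpha$, the matrix with parts $g$ and $h = i b g / (y + s)$ conjugates $M$ to the rotation for
  every real $g \ne 0$, as $|b|^2 = y^2 - s^2$; the choice of $g$ normalizes the determinant. The sign condition
  selects between the angles $\alpha$ and $-\alpha$, which have the same trace.\<close>
lemma elliptic_conjugate_rotation:
  assumes M: "M \<in> SL2" and \<alpha>: "Re (hol M) = cos \<alpha>" "0 < sin \<alpha> * Im (hol M)"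
  obtains G where "G \<in> SL2" "matrix_inv G ** M ** G = rot \<alpha>"
proof -
  define y s b where "y = Im (hol M)" and "s = sin \<alpha>" and "b = ahol M"
  have sc: "s\<^sup>2 + (cos \<alpha>)\<^sup>2 = 1" by (simp add: s_def)
  have "(cos \<alpha>)\<^sup>2 + y\<^sup>2 - (cmod b)\<^sup>2 = 1"
    using M unfolding SL2_hol cmod_power2[of "hol M"] \<alpha>(1) by (simp add: y_def b_def)
  then have yb: "(cmod b)\<^sup>2 = (y - s) * (y + s)"
    using sc by (simp add: power2_eq_square algebra_simps)
  have sy: "0 < s * y" using \<alpha>(2) by (simp add: s_def y_def)
  then have ys0: "y + s \<noteq> 0" "s \<noteq> 0"
    by (auto simp: zero_less_mult_iff)
  have pos: "0 < (y + s) / (2 * s)"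
    using sy by (auto simp: zero_less_mult_iff zero_less_divide_iff)
  define g where "g = sqrt ((y + s) / (2 * s))"
  have g2: "g\<^sup>2 = (y + s) / (2 * s)" using pos by (simp add: g_def)
  define h where "h = \<i> * b * of_real (g / (y + s))"
  define G where "G = mat_of (of_real g) h"
  have "(cmod h)\<^sup>2 = (cmod b)\<^sup>2 * (g\<^sup>2 / (y + s)\<^sup>2)"
    by (simp only: h_def norm_mult norm_ii norm_of_real power_mult_distrib power2_abs power_divide mult_1_left)
  also have "\<dots> = (y - s) / (2 * s)"
    unfolding yb g2 using ys0 by (simp add: power2_eq_square)
  finally have h2: "(cmod h)\<^sup>2 = (y - s) / (2 * s)" .
  have "G \<in> SL2"
    unfolding SL2_hol using ys0 by (simp add: G_def h2 g2 diff_divide_distrib[symmetric])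
  have a: "hol M = of_real (cos \<alpha>) + \<i> * of_real y"
    using \<alpha>(1) by (simp add: complex_eq_iff y_def)
  have c: "cis \<alpha> = of_real (cos \<alpha>) + \<i> * of_real s"
    by (simp add: complex_eq_iff s_def)
  have bh: "b * cnj h = - \<i> * of_real ((y - s) * g)"
  proof -
    have "b * cnj h = - \<i> * (b * cnj b) * of_real (g / (y + s))"
      by (simp add: h_def)
    also have "b * cnj b = of_real ((y - s) * (y + s))"
      unfolding yb[symmetric] by (simp add: complex_norm_square[symmetric])
    also have "- \<i> * of_real ((y - s) * (y + s)) * of_real (g / (y + s))
        = - \<i> * of_real (((y - s) * (y + s)) * (g / (y + s)))"
      by (simp only: of_real_mult mult.assoc)
    also have "((y - s) * (y + s)) * (g / (y + s)) = (y - s) * g" using ys0 by simp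
    finally show ?thesis .
  qed
  have hy: "h * of_real (y + s) = \<i> * b * of_real g"
  proof -
    have "h * of_real (y + s) = \<i> * b * of_real (g / (y + s) * (y + s))"
      by (simp only: h_def of_real_mult mult.assoc)
    also have "g / (y + s) * (y + s) = g" using ys0 by simp
    finally show ?thesis .
  qed
  have "M ** G = G ** rot \<alpha>"
  proof (rule matrix_eqI_hol)
    have "hol M * of_real g + b * cnj h = of_real g * cis \<alpha>"
      unfolding bh a c by (simp add: algebra_simps)
    then show "hol (M ** G) = hol (G ** rot \<alpha>)"
      by (simp add: hol_mult G_def b_def)
    have "hol M * h + b * of_real g - h * cnj (cis \<alpha>) = \<i> * (h * of_real (y + s)) + b * of_real g"
      unfolding a c by (simp add: algebra_simps)
    also have "\<dots> = 0" unfolding hy by (simp add: algebra_simps)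
    finally show "ahol (M ** G) = ahol (G ** rot \<alpha>)"
      by (simp add: ahol_mult G_def b_def)
  qed
  then have "matrix_inv G ** M ** G = rot \<alpha>"
    using SL2_matrix_inv(1)[OF \<open>G \<in> SL2\<close>] by (metis matrix_mul_assoc matrix_mul_lid)
  then show thesis using \<open>G \<in> SL2\<close> that by blast
qed

text \<open>The trace of the conjugate of $B$ gives the real part of its holomorphic part, and the trace of its
  product with the rotation gives the imaginary part. Traces do not depend on the conjugation, so the right side varies
  continuously with the tuple whichever $G$ is taken.\<close>
lemma hol_conjugate_by_traces:
  assumes G: "G \<in> SL2" "matrix_inv G ** M ** G = rot \<beta>" and "sin \<beta> \<noteq> 0"
  shows "(cmod (hol (matrix_inv G ** B ** G)))\<^sup>2
    = (trace B / 2)\<^sup>2 + ((cos \<beta> * trace B - trace (M ** B)) / (2 * sin \<beta>))\<^sup>2"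
proof -
  have conj: "trace (matrix_inv G ** N ** G) = trace N" for N
  proof -
    have "trace (matrix_inv G ** N ** G) = trace (G ** (matrix_inv G ** N))"
      by (rule trace_mul_sym)
    then show ?thesis by (simp add: matrix_mul_assoc SL2_matrix_inv[OF G(1)])
  qed
  define N where "N = matrix_inv G ** B ** G"
  have 1: "trace B = 2 * Re (hol N)" unfolding N_def conj[of B, symmetric] by (rule trace_hol)
  have "rot \<beta> ** N = matrix_inv G ** M ** (G ** matrix_inv G) ** B ** G"
    unfolding N_def G(2)[symmetric] by (simp only: matrix_mul_assoc)
  then have "rot \<beta> ** N = matrix_inv G ** (M ** B) ** G"
    by (simp add: SL2_matrix_inv[OF G(1)] matrix_mul_assoc)
  then have "trace (M ** B) = trace (rot \<beta> ** N)" using conj[of "M ** B"] by simp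
  also have "\<dots> = 2 * (cos \<beta> * Re (hol N) - sin \<beta> * Im (hol N))"
    by (simp add: trace_hol hol_mult)
  finally have "cos \<beta> * trace B - trace (M ** B) = 2 * sin \<beta> * Im (hol N)"
    by (simp add: 1 algebra_simps)
  then show ?thesis
    unfolding cmod_power2 N_def[symmetric] 1 using assms(3) by simp
qed

section \<open>Perturbation of tuples\<close>

lemma topspace_SL2_tuples: "topspace (SL2_tuples k) = PiE {1..k} (\<lambda>_. SL2)"
  by (simp add: SL2_tuples_def)

lemma continuous_matrix_mult: "continuous_on UNIV (\<lambda>p :: (real^2^2) \<times> (real^2^2). fst p ** snd p)"
  unfolding matrix_matrix_mult_def by (intro continuous_intros)

lemma continuous_word_mat:
  assumes "set w \<subseteq> {1..k}"
  shows "continuous_map (SL2_tuples k) euclidean (\<lambda>A. word_mat A w)"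
  using assms
proof (induction w)
  case Nil
  then show ?case by simp
next
  case (Cons x w)
  have "continuous_map (SL2_tuples k) (top_of_set SL2) (\<lambda>A. A x)"
    unfolding SL2_tuples_def using Cons.prems by (intro continuous_map_product_projection) simp
  then have x: "continuous_map (SL2_tuples k) euclidean (\<lambda>A. A x)"
    by (rule continuous_map_into_fulltopology)
  have w: "continuous_map (SL2_tuples k) euclidean (\<lambda>A. word_mat A w)"
    using Cons by simp
  have "continuous_map (SL2_tuples k) (prod_topology euclidean euclidean) (\<lambda>A. (word_mat A w, A x))"
    by (intro continuous_map_pairedI x w)
  then have "continuous_map (SL2_tuples k) euclidean ((\<lambda>p. fst p ** snd p) \<circ> (\<lambda>A. (word_mat A w, A x)))"
    by (rule continuous_map_compose) (simp add: continuous_matrix_mult)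
  then show ?case by (simp add: comp_def)
qed

lemma continuous_trace_word:
  assumes "set w \<subseteq> {1..k}"
  shows "continuous_map (SL2_tuples k) euclideanreal (\<lambda>A. trace (word_mat A w))"
proof -
  have "continuous_on UNIV (trace :: real^2^2 \<Rightarrow> real)"
    unfolding trace_def by (intro continuous_intros)
  then have "continuous_map (SL2_tuples k) euclideanreal (trace \<circ> (\<lambda>A. word_mat A w))"
    by (intro continuous_map_compose[OF continuous_word_mat[OF assms]]) simp
  then show ?thesis by (simp add: comp_def)
qed

lemma rot_mult: "rot \<theta> ** M = cos \<theta> *\<^sub>R M + sin \<theta> *\<^sub>R (mat_of \<i> 0 ** M)" for M :: "real^2^2"
  by (simp add: vec_eq_iff forall_2 matrix_mult_22 mat_of_def)

text \<open>The result is restricted to $\{1, \ldots, k\}$ because tuples are extensional functions.\<close>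
definition rotate_tuple :: "nat \<Rightarrow> (nat \<Rightarrow> real^2^2) \<Rightarrow> real \<Rightarrow> nat \<Rightarrow> real^2^2" where
  "rotate_tuple k A \<theta> = (\<lambda>x\<in>{1..k}. rot \<theta> ** A x)"

lemma continuous_rotate_tuple:
  assumes "A \<in> topspace (SL2_tuples k)"
  shows "continuous_map euclideanreal (SL2_tuples k) (rotate_tuple k A)"
  unfolding SL2_tuples_def continuous_map_componentwise
proof (intro conjI ballI)
  show "rotate_tuple k A ` topspace euclideanreal \<subseteq> extensional {1..k}"
    by (auto simp: rotate_tuple_def)
  fix x assume x: "x \<in> {1..k}"
  then have Ax: "A x \<in> SL2" using assms by (auto simp: topspace_SL2_tuples)
  have "continuous_on UNIV (\<lambda>\<theta>. rot \<theta> ** A x)"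
    unfolding rot_mult by (intro continuous_intros)
  moreover have "rot \<theta> ** A x \<in> SL2" for \<theta> by (intro SL2_mult Ax SL2_rot)
  ultimately show "continuous_map euclideanreal (top_of_set SL2) (\<lambda>\<theta>. rotate_tuple k A \<theta> x)"
    using x by (auto simp: rotate_tuple_def continuous_map_in_subtopology)
qed

lemma rotate_tuple_0:
  assumes "A \<in> topspace (SL2_tuples k)"
  shows "rotate_tuple k A 0 = A"
proof
  fix x
  have "rot 0 ** M = M" for M :: "real^2^2" by (subst rot_mult) simp
  then show "rotate_tuple k A 0 x = A x"
    using assms by (auto simp: rotate_tuple_def topspace_SL2_tuples PiE_def extensional_def)
qed

lemma word_mat_rotate_tuple:
  assumes "set w \<subseteq> {1..k}"
  shows "word_mat (rotate_tuple k A \<theta>) w = word_mat (\<lambda>x. rot \<theta> ** A x) w"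
  using assms by (induction w) (simp_all add: rotate_tuple_def)

lemma rotate_tuple_nearby:
  assumes "openin (SL2_tuples k) V" "A \<in> V"
  shows "\<exists>\<epsilon>>0. \<forall>\<theta>. \<bar>\<theta>\<bar> < \<epsilon> \<longrightarrow> rotate_tuple k A \<theta> \<in> V"
proof -
  have A: "A \<in> topspace (SL2_tuples k)" using openin_subset[OF assms(1)] assms(2) by blast
  have "openin euclideanreal {\<theta> \<in> topspace euclideanreal. rotate_tuple k A \<theta> \<in> V}"
    by (rule openin_continuous_map_preimage[OF continuous_rotate_tuple[OF A] assms(1)])
  then have "open {\<theta>. rotate_tuple k A \<theta> \<in> V}" by simp
  moreover have "0 \<in> {\<theta>. rotate_tuple k A \<theta> \<in> V}" using assms(2) rotate_tuple_0[OF A] by simp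
  ultimately obtain \<epsilon> where "0 < \<epsilon>" "ball 0 \<epsilon> \<subseteq> {\<theta>. rotate_tuple k A \<theta> \<in> V}"
    unfolding open_contains_ball by blast
  moreover have "\<theta> \<in> ball 0 \<epsilon>" if "\<bar>\<theta>\<bar> < \<epsilon>" for \<theta> using that by simp
  ultimately show ?thesis by blast
qed

text \<open>The rotated tuples stay in $V$ for small angles, so none of their products is elliptic and
  \<open>trace_growth\<close> applies to all words with the same $t$.\<close>
proposition uniformly_hyperbolic_if_no_elliptic_nearby:
  assumes V: "openin (SL2_tuples k) V" "A \<in> V"
    and no_elliptic: "\<And>B w. B \<in> V \<Longrightarrow> set w \<subseteq> {1..k} \<Longrightarrow> 2 \<le> \<bar>trace (word_mat B w)\<bar>"
  shows "uniformly_hyperbolic k A"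
proof -
  have A: "A x \<in> SL2" if "x \<in> {1..k}" for x
    using subsetD[OF openin_subset[OF V(1)] V(2)] that by (auto simp: topspace_SL2_tuples)
  obtain \<epsilon> where \<epsilon>: "0 < \<epsilon>" "\<And>\<theta>. \<bar>\<theta>\<bar> < \<epsilon> \<Longrightarrow> rotate_tuple k A \<theta> \<in> V"
    using rotate_tuple_nearby[OF V] by blast
  define t where "t = min (\<epsilon> / 2) 1"
  have t: "0 < t" "t < pi / 2" "t < \<epsilon>"
    using \<epsilon>(1) pi_gt3 by (auto simp: t_def)
  have "0 < cos t" using t by (simp add: cos_gt_zero)
  moreover have "cos t < 1"
    using cos_monotone_0_pi[of 0 t] t by simp
  ultimately have lam: "1 < 1 / cos t" by simp
  show ?thesis
  proof (rule uniformly_hyperbolic_if_growth[OF A lam])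
    fix w assume w: "set w \<subseteq> {1..k}"
    have "2 * (1 / cos t) ^ length w \<le> \<bar>trace (word_mat A w)\<bar>"
    proof (rule trace_growth[OF _ t(1,2)])
      show "A x \<in> SL2" if "x \<in> set w" for x using A w that by blast
      fix \<theta> assume "\<bar>\<theta>\<bar> \<le> t"
      then have "rotate_tuple k A \<theta> \<in> V" using t by (intro \<epsilon>(2)) linarith
      then show "2 \<le> \<bar>trace (word_mat (\<lambda>x. rot \<theta> ** A x) w)\<bar>"
        using no_elliptic[OF _ w] word_mat_rotate_tuple[OF w] by metis
    qed
    then have "(1 / cos t) ^ length w \<le> \<bar>Re (hol (word_mat A w))\<bar>"
      by (simp add: trace_hol abs_mult)
    then show "(1 / cos t) ^ length w \<le> mnorm (word_mat A w)"
      using abs_Re_le_cmod[of "hol (word_mat A w)"] cmod_hol_le_mnorm[of "word_mat A w"] by linarith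
  qed
qed

text \<open>If the trace were constant, then $q(z)^2 = p_0^2 z^n$ for infinitely many $z$, where $q$ is the trace
  polynomial and $n$ the length of the word. The identity would hold for all $z$, and $z = 0$ would be a
  root of $q$, whose roots lie on the unit circle.\<close>
lemma trace_rotation_not_constant:
  assumes w: "w \<noteq> []" "\<And>x. x \<in> set w \<Longrightarrow> A x \<in> SL2" and "0 < \<epsilon>"
  shows "\<exists>\<theta>. 0 \<le> \<theta> \<and> \<theta> < \<epsilon> \<and> trace (word_mat (\<lambda>x. rot \<theta> ** A x) w) \<noteq> p0"
proof (rule ccontr)
  assume "\<not> ?thesis"
  then have const: "trace (word_mat (\<lambda>x. rot \<theta> ** A x) w) = p0" if "0 \<le> \<theta>" "\<theta> < \<epsilon>" for \<theta>
    using that by blast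
  \<comment> \<open>squaring turns the factor $e^{in\theta}$ between the trace and the polynomial into $z^n$\<close>
  define Q where "Q = trace_poly A w ^ 2 - monom (of_real (p0\<^sup>2)) (length w)"
  define S where "S = (\<lambda>\<theta>. cis (2 * \<theta>)) ` {0<..<min \<epsilon> 1}"
  have "S \<subseteq> {z. poly Q z = 0}"
  proof
    fix z assume "z \<in> S"
    then obtain \<theta> where \<theta>: "z = cis (2 * \<theta>)" "0 < \<theta>" "\<theta> < \<epsilon>" by (auto simp: S_def)
    have "poly (trace_poly A w) z = cis (real (length w) * \<theta>) * of_real p0"
      unfolding \<theta>(1) poly_trace_poly_cis using const[of \<theta>] \<theta>(2,3) by simp
    moreover have "cis (real (length w) * \<theta>) ^ 2 = z ^ length w"
      unfolding \<theta>(1) Complex.DeMoivre by (simp add: mult.left_commute)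
    ultimately have "poly (trace_poly A w) z ^ 2 = of_real (p0\<^sup>2) * z ^ length w"
      by (simp add: power_mult_distrib)
    then show "z \<in> {z. poly Q z = 0}"
      by (simp add: Q_def poly_monom)
  qed
  moreover have "infinite S"
  proof -
    have "inj_on (\<lambda>\<theta>. cis (2 * \<theta>)) {0<..<min \<epsilon> 1}"
    proof (rule inj_onI)
      fix s t assume st: "s \<in> {0<..<min \<epsilon> 1}" "t \<in> {0<..<min \<epsilon> 1}" "cis (2 * s) = cis (2 * t)"
      have eq: "cos (2 * s) = cos (2 * t)" using arg_cong[OF st(3), of Re] unfolding cis.sel .
      have "2 * s = 2 * t"
        by (rule cos_inj_pi[OF _ _ _ _ eq]) (use st(1,2) pi_gt3 in auto)
      then show "s = t" by simp
    qed
    moreover have "infinite {0<..<min \<epsilon> 1}" using \<open>0 < \<epsilon>\<close> by (simp add: infinite_Ioo)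
    ultimately show ?thesis unfolding S_def by (simp add: finite_image_iff)
  qed
  ultimately have "infinite {z. poly Q z = 0}" using infinite_super by blast
  then have "Q = 0" using poly_roots_finite by blast
  then have "poly Q 0 = 0" by simp
  moreover have "(0::complex) ^ length w = 0" using w(1) by (simp add: zero_power)
  ultimately have "poly (trace_poly A w) 0 = 0"
    by (simp add: Q_def poly_monom)
  from trace_poly_roots[OF w this] show False by simp
qed

text \<open>Along the rotation family the trace takes all values of an interval. Only countably many of them are
  twice the cosine of a rational multiple of $\pi$.\<close>
lemma irrational_elliptic_nearby:
  assumes V: "openin (SL2_tuples k) V" "A \<in> V"
    and w: "set w \<subseteq> {1..k}" "\<bar>trace (word_mat A w)\<bar> < 2"
  obtains B where "B \<in> V" "\<bar>trace (word_mat B w)\<bar> < 2"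
    "arccos (trace (word_mat B w) / 2) / pi \<notin> \<rat>"
proof -
  have top: "A \<in> topspace (SL2_tuples k)" using openin_subset[OF V(1)] V(2) by blast
  have A: "A x \<in> SL2" if "x \<in> {1..k}" for x
    using top that by (auto simp: topspace_SL2_tuples)
  have "w \<noteq> []" using w(2) by (auto simp: trace_hol)
  define V' where "V' = {B \<in> topspace (SL2_tuples k). trace (word_mat B w) \<in> {-2<..<2}} \<inter> V"
  have "openin (SL2_tuples k) V'"
    unfolding V'_def
    by (intro openin_Int V(1) openin_continuous_map_preimage[OF continuous_trace_word[OF w(1)]]) simp
  moreover have "A \<in> V'" using top V(2) w(2) by (auto simp: V'_def)
  ultimately obtain \<epsilon> where \<epsilon>: "0 < \<epsilon>" "\<And>\<theta>. \<bar>\<theta>\<bar> < \<epsilon> \<Longrightarrow> rotate_tuple k A \<theta> \<in> V'"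
    using rotate_tuple_nearby[of k V' A] by blast
  define p where "p \<theta> = trace (word_mat (rotate_tuple k A \<theta>) w)" for \<theta>
  have "continuous_map euclideanreal euclideanreal ((\<lambda>B. trace (word_mat B w)) \<circ> rotate_tuple k A)"
    by (rule continuous_map_compose[OF continuous_rotate_tuple[OF top] continuous_trace_word[OF w(1)]])
  then have cont: "continuous_on UNIV p" by (simp add: comp_def p_def[abs_def])
  obtain \<theta>1 where \<theta>1: "0 \<le> \<theta>1" "\<theta>1 < \<epsilon>" "p \<theta>1 \<noteq> p 0"
    using trace_rotation_not_constant[OF \<open>w \<noteq> []\<close> _ \<epsilon>(1), of A "p 0"] A w(1)
    unfolding p_def word_mat_rotate_tuple[OF w(1)] by blast
  define lo hi where "lo = min (p 0) (p \<theta>1)" and "hi = max (p 0) (p \<theta>1)"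
  have "lo < hi" using \<theta>1(3) by (auto simp: lo_def hi_def min_def max_def)
  then have "uncountable {lo<..<hi}" by (simp add: uncountable_open_interval)
  moreover have "countable ((\<lambda>r. 2 * cos (pi * r)) ` \<rat>)" by (simp add: countable_rat)
  ultimately have "\<not> {lo<..<hi} \<subseteq> (\<lambda>r. 2 * cos (pi * r)) ` \<rat>"
    using countable_subset by blast
  then obtain v where "v \<in> {lo<..<hi}" and v3: "v \<notin> (\<lambda>r. 2 * cos (pi * r)) ` \<rat>" by blast
  then have v: "lo < v" "v < hi" by simp_all
  have conn: "connected (p ` {0..\<theta>1})"
    by (intro connected_continuous_image continuous_on_subset[OF cont]) auto
  have ends: "p 0 \<in> p ` {0..\<theta>1}" "p \<theta>1 \<in> p ` {0..\<theta>1}" using \<theta>1(1) by auto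
  consider "p 0 \<le> v" "v \<le> p \<theta>1" | "p \<theta>1 \<le> v" "v \<le> p 0"
    using v(1,2) unfolding lo_def hi_def by linarith
  then have "v \<in> p ` {0..\<theta>1}"
  proof cases
    case 1
    then show ?thesis by (rule connectedD_interval[OF conn ends])
  next
    case 2
    then show ?thesis by (rule connectedD_interval[OF conn ends(2,1)])
  qed
  then obtain \<theta> where \<theta>: "0 \<le> \<theta>" "\<theta> \<le> \<theta>1" "p \<theta> = v" by auto
  have "rotate_tuple k A \<theta> \<in> V'" using \<theta> \<theta>1 by (intro \<epsilon>(2)) auto
  then have B: "rotate_tuple k A \<theta> \<in> V" "\<bar>v\<bar> < 2" using \<theta>(3) by (auto simp: V'_def p_def)
  have "arccos (v / 2) / pi \<notin> \<rat>"
  proof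
    assume "arccos (v / 2) / pi \<in> \<rat>"
    moreover have "v = 2 * cos (pi * (arccos (v / 2) / pi))" using B(2) by (simp add: cos_arccos)
    ultimately show False using v3 by blast
  qed
  then show thesis using that[of "rotate_tuple k A \<theta>"] B \<theta>(3) unfolding p_def by simp
qed


text \<open>The hypotheses of \<open>elliptic_control\<close> expressed by the traces of the words $w$, $i$ and $wi$, which
  depend continuously on the tuple.\<close>
lemma bounded_positive_entropy_if_traces:
  assumes A: "\<And>x. x \<in> {1..k} \<Longrightarrow> A x \<in> SL2"
    and w: "set w \<subseteq> {1..k}" and i: "i \<in> {1..k}" "i \<noteq> hd w"
    and elliptic: "\<bar>trace (word_mat A w)\<bar> < 2"
    and C: "0 \<le> C" "(trace (A i) / 2)\<^sup>2 +
      (trace (word_mat A w) * trace (A i) / 2 - trace (word_mat A w ** A i))\<^sup>2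
        / (4 - (trace (word_mat A w))\<^sup>2) \<le> C\<^sup>2"
    and dense: "dense_rotation N (1 / (2 * (C + 1))) (arccos (trace (word_mat A w) / 2))"
  shows "bounded_positive_entropy k A"
proof -
  define M x \<alpha> where "M = word_mat A w" and "x = trace M" and "\<alpha> = arccos (x / 2)"
  have x: "\<bar>x\<bar> < 2" using elliptic by (simp add: x_def M_def)
  have "w \<noteq> []" using elliptic by (auto simp: trace_hol)
  have M: "M \<in> SL2" unfolding M_def by (rule word_mat_SL2) (use A w in blast)
  have cos: "cos \<alpha> = x / 2" using x by (simp add: \<alpha>_def cos_arccos)
  have "0 < \<alpha>" "\<alpha> < pi" using arccos_lt_bounded[of "x / 2"] x by (simp_all add: \<alpha>_def)
  then have sin: "0 < sin \<alpha>" by (rule sin_gt_zero)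
  have re: "Re (hol M) = cos \<alpha>" by (simp add: cos x_def trace_hol)
  have "Im (hol M) \<noteq> 0"
  proof
    assume "Im (hol M) = 0"
    then have "(cmod (hol M))\<^sup>2 = (x / 2)\<^sup>2" unfolding cmod_power2 re cos by simp
    also have "\<dots> < 1" using x by (simp add: abs_square_less_1)
    finally have "(cmod (hol M))\<^sup>2 < 1\<^sup>2" by simp
    then have "cmod (hol M) < 1" by (rule power2_less_imp_less) simp
    then show False using SL2_one_le_hol[OF M] by linarith
  qed
  \<comment> \<open>the sense of the rotation is not visible in the trace\<close>
  define \<beta> where "\<beta> = (if 0 < Im (hol M) then \<alpha> else - \<alpha>)"
  have \<beta>: "cos \<beta> = x / 2" "(sin \<beta>)\<^sup>2 = (sin \<alpha>)\<^sup>2" by (simp_all add: \<beta>_def cos)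
  have "0 < sin \<beta> * Im (hol M)"
    using sin \<open>Im (hol M) \<noteq> 0\<close> by (simp add: \<beta>_def mult_pos_neg)
  then obtain G where G: "G \<in> SL2" "matrix_inv G ** M ** G = rot \<beta>"
    using elliptic_conjugate_rotation[OF M, of \<beta>] re unfolding \<beta>(1) cos by metis
  have "sin \<beta> \<noteq> 0" using \<beta>(2) sin by auto
  have "(2 * sin \<beta>)\<^sup>2 = 4 - x\<^sup>2"
  proof -
    have "(sin \<beta>)\<^sup>2 = 1 - (x / 2)\<^sup>2" using sin_squared_eq[of \<beta>] \<beta>(1) by simp
    then show ?thesis by (simp add: power_mult_distrib power_divide)
  qed
  then have "(cmod (hol (matrix_inv G ** A i ** G)))\<^sup>2
      = (trace (A i) / 2)\<^sup>2 + (x * trace (A i) / 2 - trace (M ** A i))\<^sup>2 / (4 - x\<^sup>2)"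
    unfolding hol_conjugate_by_traces[OF G \<open>sin \<beta> \<noteq> 0\<close>] \<beta>(1) by (simp add: power_divide)
  also have "\<dots> \<le> C\<^sup>2" using C(2) by (simp only: x_def M_def)
  finally have hol_le: "cmod (hol (matrix_inv G ** A i ** G)) \<le> C"
    using C(1) by (rule power2_le_imp_le)
  have "dense_rotation N (1 / (2 * (C + 1))) \<alpha>" using dense by (simp only: \<alpha>_def x_def M_def)
  then have dense\<beta>: "dense_rotation N (1 / (2 * (C + 1))) \<beta>"
    using dense_rotation_uminus by (simp add: \<beta>_def)
  show ?thesis
    by (rule elliptic_control[OF A \<open>w \<noteq> []\<close> w i G(1) G(2)[unfolded M_def] hol_le dense\<beta>])
qed

proposition bounded_positive_entropy_on_open_set:
  assumes k: "2 \<le> k" and V: "openin (SL2_tuples k) V" "A \<in> V"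
    and w: "set w \<subseteq> {1..k}" "\<bar>trace (word_mat A w)\<bar> < 2"
  shows "\<exists>W. openin (SL2_tuples k) W \<and> W \<noteq> {} \<and> W \<subseteq> V \<and> (\<forall>B\<in>W. bounded_positive_entropy k B)"
proof -
  obtain B where B: "B \<in> V" "\<bar>trace (word_mat B w)\<bar> < 2"
    "arccos (trace (word_mat B w) / 2) / pi \<notin> \<rat>"
    using irrational_elliptic_nearby[OF V w] by blast
  \<comment> \<open>any letter other than the first letter of \<open>w\<close>, so that the blocks form a prefix code\<close>
  define i :: nat where "i = (if hd w = 1 then 2 else 1)"
  have i: "i \<in> {1..k}" "i \<noteq> hd w" using k by (auto simp: i_def)
  define g where "g A = (trace (word_mat A w), trace (word_mat A [i]), trace (word_mat A (i # w)))"
    for A :: "nat \<Rightarrow> real^2^2"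
  have g: "g A = (trace (word_mat A w), trace (A i), trace (word_mat A w ** A i))" for A
    by (simp add: g_def)
  have cont: "continuous_map (SL2_tuples k) euclidean g"
  proof -
    have "continuous_map (SL2_tuples k)
        (prod_topology euclideanreal (prod_topology euclideanreal euclideanreal)) g"
      unfolding g_def using w(1) i(1) by (intro continuous_map_pairedI continuous_trace_word) auto
    then show ?thesis by simp
  qed
  define Q where "Q = (\<lambda>(x, y, z). (y / 2)\<^sup>2 + (x * y / 2 - z)\<^sup>2 / (4 - x\<^sup>2) :: real)"
  \<comment> \<open>the square of \<open>C\<close> is strictly larger than \<open>Q (g B)\<close>, which leaves room for a perturbation\<close>
  define C where "C = Q (g B) + 1"
  have nz: "4 - (fst (g B))\<^sup>2 \<noteq> 0"
  proof -
    have "\<bar>trace (word_mat B w)\<bar>\<^sup>2 < 2\<^sup>2" using B(2) by (intro power_strict_mono) auto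
    then show ?thesis by (simp add: g)
  qed
  have "(fst (g B))\<^sup>2 < 4"
  proof -
    have "\<bar>trace (word_mat B w)\<bar>\<^sup>2 < 2\<^sup>2" using B(2) by (intro power_strict_mono) auto
    then show ?thesis by (simp add: g)
  qed
  then have "0 \<le> Q (g B)" by (simp add: Q_def split_beta)
  then have C: "0 \<le> C" "Q (g B) < C\<^sup>2"
    by (simp_all add: C_def power2_eq_square distrib_right distrib_left add_nonneg_pos)
  have \<delta>: "0 < 1 / (2 * (C + 1))" using C(1) by simp
  obtain N where N: "\<forall>\<^sub>F \<beta> in nhds (arccos (trace (word_mat B w) / 2)). dense_rotation N (1 / (2 * (C + 1))) \<beta>"
    using dense_rotation_nearby[OF B(3) \<delta>] by blast
  define good where "good p \<longleftrightarrow> \<bar>fst p\<bar> < 2 \<and> Q p < C\<^sup>2 \<and> dense_rotation N (1 / (2 * (C + 1))) (arccos (fst p / 2))"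
    for p :: "real \<times> real \<times> real"
  have "\<forall>\<^sub>F p in nhds (g B). good p"
    unfolding good_def
  proof (intro eventually_conj)
    have id: "((\<lambda>p. p) \<longlongrightarrow> g B) (nhds (g B))" by (rule filterlim_ident)
    show "\<forall>\<^sub>F p in nhds (g B). \<bar>fst p\<bar> < 2"
    proof (rule order_tendstoD(2))
      show "((\<lambda>p. \<bar>fst p\<bar>) \<longlongrightarrow> \<bar>fst (g B)\<bar>) (nhds (g B))"
        by (intro tendsto_rabs tendsto_fst id)
      show "\<bar>fst (g B)\<bar> < 2" using B(2) by (simp add: g)
    qed
    show "\<forall>\<^sub>F p in nhds (g B). Q p < C\<^sup>2"
    proof (rule order_tendstoD(2)[OF _ C(2)])
      show "(Q \<longlongrightarrow> Q (g B)) (nhds (g B))"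
        unfolding Q_def split_beta
        by (intro tendsto_add tendsto_power tendsto_divide tendsto_diff tendsto_mult tendsto_fst tendsto_snd id tendsto_const nz) simp_all
    qed
    have "isCont arccos (trace (word_mat B w) / 2)" using B(2) by (intro isCont_arccos) auto
    then have "((\<lambda>p. arccos (fst p / 2)) \<longlongrightarrow> arccos (trace (word_mat B w) / 2)) (nhds (g B))"
    proof (rule isCont_tendsto_compose)
      have "((\<lambda>p. fst p / 2) \<longlongrightarrow> fst (g B) / 2) (nhds (g B))"
        by (intro tendsto_divide tendsto_fst id tendsto_const) simp
      then show "((\<lambda>p. fst p / 2) \<longlongrightarrow> trace (word_mat B w) / 2) (nhds (g B))" by (simp add: g)
    qed
    then show "\<forall>\<^sub>F p in nhds (g B). dense_rotation N (1 / (2 * (C + 1))) (arccos (fst p / 2))"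
      using N by (rule eventually_compose_filterlim[rotated])
  qed
  then obtain S where S: "open S" "g B \<in> S" "\<And>p. p \<in> S \<Longrightarrow> good p"
    unfolding eventually_nhds by blast
  define W where "W = {A \<in> topspace (SL2_tuples k). g A \<in> S} \<inter> V"
  have "openin (SL2_tuples k) W"
    unfolding W_def using S(1) by (intro openin_Int V(1) openin_continuous_map_preimage[OF cont]) simp
  moreover have "B \<in> W" using S(2) B(1) openin_subset[OF V(1)] by (auto simp: W_def)
  moreover have "W \<subseteq> V" by (auto simp: W_def)
  moreover have "bounded_positive_entropy k A" if "A \<in> W" for A
  proof -
    have "A \<in> topspace (SL2_tuples k)" "good (g A)" using that S(3) by (auto simp: W_def)
    then have A: "A x \<in> SL2" if "x \<in> {1..k}" for x using that by (auto simp: topspace_SL2_tuples)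
    have gA: "\<bar>trace (word_mat A w)\<bar> < 2" "Q (g A) \<le> C\<^sup>2"
      "dense_rotation N (1 / (2 * (C + 1))) (arccos (trace (word_mat A w) / 2))"
      using \<open>good (g A)\<close> unfolding good_def by (simp_all add: g)
    show ?thesis
      by (rule bounded_positive_entropy_if_traces[OF A w(1) i gA(1) C(1) gA(2)[unfolded Q_def g prod.case] gA(3)])
  qed
  ultimately show ?thesis by blast
qed

theorem theorem3:
  fixes k :: nat
  assumes "k \<ge> 2"
  shows "\<exists>\<U>. openin (SL2_tuples k) \<U> \<and>
           SL2_tuples k closure_of \<U> = topspace (SL2_tuples k) \<and>
           (\<forall>A \<in> \<U>.
              uniformly_hyperbolic k A \<or>
              (\<exists>K. compactin (shift_space k) K \<and> shift ` K = K \<and>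
                   topological_entropy (subtopology (shift_space k) K) shift > 0 \<and>
                   (\<exists>C. \<forall>\<omega> \<in> K. \<forall>n::int. op_norm (cocycle A n \<omega>) \<le> C)))"
  unfolding bounded_positive_entropy_def[symmetric]
proof -
  define good where "good A \<longleftrightarrow> uniformly_hyperbolic k A \<or> bounded_positive_entropy k A" for A
  define \<U> where "\<U> = \<Union>{W. openin (SL2_tuples k) W \<and> (\<forall>A\<in>W. good A)}"
  have "openin (SL2_tuples k) \<U>" unfolding \<U>_def by (rule openin_Union) blast
  moreover have "SL2_tuples k closure_of \<U> = topspace (SL2_tuples k)"
    unfolding dense_intersects_open
  proof (intro allI impI)
    fix V assume "openin (SL2_tuples k) V \<and> V \<noteq> {}"
    then have V: "openin (SL2_tuples k) V" "V \<noteq> {}" by simp_all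
    show "\<U> \<inter> V \<noteq> {}"
    proof (cases "\<exists>A\<in>V. \<exists>w. set w \<subseteq> {1..k} \<and> \<bar>trace (word_mat A w)\<bar> < 2")
      case True
      then obtain A w where "A \<in> V" "set w \<subseteq> {1..k}" "\<bar>trace (word_mat A w)\<bar> < 2" by blast
      from bounded_positive_entropy_on_open_set[OF assms V(1) this]
      obtain W where W: "openin (SL2_tuples k) W" "W \<noteq> {}" "W \<subseteq> V" "\<forall>B\<in>W. bounded_positive_entropy k B"
        by blast
      then have "W \<subseteq> \<U>" unfolding \<U>_def good_def by blast
      then show ?thesis using W(2,3) by blast
    next
      case False
      then have "2 \<le> \<bar>trace (word_mat B w)\<bar>" if "B \<in> V" "set w \<subseteq> {1..k}" for B w
        using that not_less by blast
      then have "\<forall>A\<in>V. uniformly_hyperbolic k A"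
        using uniformly_hyperbolic_if_no_elliptic_nearby[OF V(1)] by blast
      then have "V \<subseteq> \<U>" using V(1) unfolding \<U>_def good_def by blast
      then show ?thesis using V(2) by blast
    qed
  qed
  moreover have "\<forall>A\<in>\<U>. uniformly_hyperbolic k A \<or> bounded_positive_entropy k A"
    unfolding \<U>_def good_def by blast
  ultimately show "\<exists>\<U>. openin (SL2_tuples k) \<U> \<and> SL2_tuples k closure_of \<U> = topspace (SL2_tuples k) \<and>
      (\<forall>A\<in>\<U>. uniformly_hyperbolic k A \<or> bounded_positive_entropy k A)"
    by blast
qed

end
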